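(* Let $N$ be a connected smooth manifold without boundary, of dimension $n\geq 1$. If $\pi_1(N)$ has a nontrivial proper subgroup, then for all $m\ge2$ every map $f\colon S^m\to N$ can be homotoped away from itself by a small deformation, i.e. the pair $(f,f)$ is loose by small deformation.
   Context: The pair $(f,f)$, $f\colon M\to N$, is loose by small deformation if for every metric on $N$ and every $\varepsilon>0$ there is an $\varepsilon$-approximation $f'$ of $f$ with $f'(x)\neq f(x)$ for all $x\in M$. *)

theory Defs
  imports "HOL-Analysis.Analysis" "HOL-Algebra.Group"
begin

section \<open>Smooth manifolds\<close>

text \<open>Only meaningful for open \<^term>\<open>S\<close>, since the derivatives are taken in the ambient space.\<close>

primrec Ck_on :: "nat \<Rightarrow> 'e set \<Rightarrow> ('e::euclidean_space \<Rightarrow> 'f::euclidean_space) \<Rightarrow> bool" where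
  "Ck_on 0 S f \<longleftrightarrow> continuous_on S f"
| "Ck_on (Suc k) S f \<longleftrightarrow>
     (\<forall>x\<in>S. f differentiable at x) \<and> (\<forall>v. Ck_on k S (\<lambda>x. frechet_derivative f (at x) v))"

definition smooth_on :: "'e set \<Rightarrow> ('e::euclidean_space \<Rightarrow> 'f::euclidean_space) \<Rightarrow> bool" where
  "smooth_on S f \<longleftrightarrow> (\<forall>k. Ck_on k S f)"

text \<open>A chart is a pair of a domain and a coordinate map. All charts take values in open subsets
  of the whole model space (there is no half-space), so there is no boundary.\<close>

definition smooth_atlas :: "'a topology \<Rightarrow> ('a set \<times> ('a \<Rightarrow> 'e::euclidean_space)) set \<Rightarrow> bool" where
  "smooth_atlas N \<A> \<longleftrightarrow>
     (\<forall>(U, \<phi>)\<in>\<A>. openin N U \<and>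
        (\<exists>V. open V \<and> homeomorphic_map (subtopology N U) (top_of_set V) \<phi>)) \<and>
     (\<Union>(U, \<phi>)\<in>\<A>. U) = topspace N \<and>
     (\<forall>(U, \<phi>)\<in>\<A>. \<forall>(V, \<psi>)\<in>\<A>. smooth_on (\<phi> ` (U \<inter> V)) (\<psi> \<circ> inv_into U \<phi>))"

text \<open>The dimension of the manifold is \<open>DIM('e)\<close>, which is always positive.
  The atlas need not be maximal.\<close>

definition smooth_manifold :: "'a topology \<Rightarrow> ('a set \<times> ('a \<Rightarrow> 'e::euclidean_space)) set \<Rightarrow> bool" where
  "smooth_manifold N \<A> \<longleftrightarrow> Hausdorff_space N \<and> second_countable N \<and> smooth_atlas N \<A>"


section \<open>The fundamental group\<close>

text \<open>The library's path homotopies and path concatenation are restricted to topological spaces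
  given by a type class; the following are their counterparts for abstract topologies.\<close>

definition loop_homotopic :: "'a topology \<Rightarrow> 'a \<Rightarrow> (real \<Rightarrow> 'a) \<Rightarrow> (real \<Rightarrow> 'a) \<Rightarrow> bool" where
  "loop_homotopic X x p q \<longleftrightarrow>
     homotopic_with (\<lambda>r. r 0 = x \<and> r 1 = x) (top_of_set {0..1}) X p q"

definition loops_at :: "'a topology \<Rightarrow> 'a \<Rightarrow> (real \<Rightarrow> 'a) set" where
  "loops_at X x = {p. pathin X p \<and> p 0 = x \<and> p 1 = x}"

definition path_concat :: "(real \<Rightarrow> 'a) \<Rightarrow> (real \<Rightarrow> 'a) \<Rightarrow> real \<Rightarrow> 'a" where
  "path_concat p q = (\<lambda>t. if t \<le> 1/2 then p (2 * t) else q (2 * t - 1))"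

definition fundamental_group :: "'a topology \<Rightarrow> 'a \<Rightarrow> (real \<Rightarrow> 'a) set monoid" where
  "fundamental_group X x =
     \<lparr>carrier = loops_at X x // {(p, q). loop_homotopic X x p q},
      mult = (\<lambda>A B. {r. \<exists>p\<in>A. \<exists>q\<in>B. loop_homotopic X x (path_concat p q) r}),
      one = {r. loop_homotopic X x (\<lambda>_. x) r}\<rparr>"

lemma loop_homotopic_altdef:
  "loop_homotopic X x p q \<longleftrightarrow>
     (\<exists>h. continuous_map (top_of_set ({0..1::real} \<times> {0..1})) X h \<and>
          (\<forall>t\<in>{0..1}. h (0, t) = p t) \<and> (\<forall>t\<in>{0..1}. h (1, t) = q t) \<and>
          (\<forall>s\<in>{0..1}. h (s, 0) = x \<and> h (s, 1) = x))"
  unfolding loop_homotopic_def by (subst homotopic_with) simp_all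

lemma loop_homotopic_imp_loops:
  assumes "loop_homotopic X x p q"
  shows "p \<in> loops_at X x" "q \<in> loops_at X x"
  using homotopic_with_imp_continuous_maps[OF assms[unfolded loop_homotopic_def]]
    homotopic_with_imp_property[OF assms[unfolded loop_homotopic_def]]
  by (auto simp: loops_at_def pathin_def)

lemma loop_homotopic_refl: "p \<in> loops_at X x \<Longrightarrow> loop_homotopic X x p p"
  by (auto simp: loop_homotopic_def loops_at_def pathin_def)

lemma loop_homotopic_sym: "loop_homotopic X x p q \<Longrightarrow> loop_homotopic X x q p"
  unfolding loop_homotopic_def by (simp add: homotopic_with_sym)

lemma loop_homotopic_trans [trans]:
  "loop_homotopic X x p q \<Longrightarrow> loop_homotopic X x q r \<Longrightarrow> loop_homotopic X x p r"
  unfolding loop_homotopic_def by (rule homotopic_with_trans)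

lemma equiv_loop_homotopic: "equiv (loops_at X x) {(p, q). loop_homotopic X x p q}"
  by (intro equivI refl_onI symI transI)
     (auto intro: loop_homotopic_refl loop_homotopic_sym loop_homotopic_trans
           dest: loop_homotopic_imp_loops)

lemma loop_homotopic_reparam:
  fixes f g :: "real \<Rightarrow> real"
  assumes p: "pathin X p"
    and f: "continuous_on {0..1} f" "f ` {0..1} \<subseteq> {0..1}"
    and g: "continuous_on {0..1} g" "g ` {0..1} \<subseteq> {0..1}"
    and ends: "f 0 = g 0" "f 1 = g 1" "p (f 0) = x" "p (f 1) = x"
  shows "loop_homotopic X x (p \<circ> f) (p \<circ> g)"
proof -
  let ?k = "\<lambda>(s, t). (1 - s) * f t + s * g t"
  have im: "?k ` ({0..1} \<times> {0..1}) \<subseteq> {0..1}"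
  proof clarsimp
    fix s t :: real assume st: "0 \<le> s" "s \<le> 1" "0 \<le> t" "t \<le> 1"
    then have fg: "0 \<le> f t" "f t \<le> 1" "0 \<le> g t" "g t \<le> 1"
      using f(2) g(2) by (auto simp: image_subset_iff)
    have "(1 - s) * f t + s * g t \<le> (1 - s) * 1 + s * 1"
      using st fg by (intro add_mono mult_left_mono) auto
    then show "0 \<le> (1 - s) * f t + s * g t \<and> (1 - s) * f t + s * g t \<le> 1"
      using st fg by simp
  qed
  have "continuous_on ({0..1} \<times> {0..1}) ?k"
    unfolding case_prod_unfold
    by (intro continuous_intros continuous_on_compose2[OF f(1)] continuous_on_compose2[OF g(1)]) auto
  then have "continuous_map (top_of_set ({0..1} \<times> {0..1})) (top_of_set {0..1}) ?k"
    using im by (auto simp: image_subset_iff)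
  then have "continuous_map (top_of_set ({0..1} \<times> {0..1})) X (p \<circ> ?k)"
    using p unfolding pathin_def by (rule continuous_map_compose)
  moreover have "(1 - s) * f 0 + s * g 0 = f 0" "(1 - s) * f 1 + s * g 1 = f 1" for s
    using ends(1,2) by (simp_all add: algebra_simps)
  ultimately show ?thesis
    unfolding loop_homotopic_altdef using ends
    by (intro exI[of _ "p \<circ> ?k"]) (simp add: o_def)
qed

lemma loop_homotopic_concat:
  assumes "loop_homotopic X x p p'" "loop_homotopic X x q q'"
  shows "loop_homotopic X x (path_concat p q) (path_concat p' q')"
proof -
  let ?I2 = "{0..1} \<times> {0..1} :: (real \<times> real) set"
  obtain h where h: "continuous_map (top_of_set ?I2) X h"
      "\<forall>t\<in>{0..1}. h (0, t) = p t" "\<forall>t\<in>{0..1}. h (1, t) = p' t"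
      "\<forall>s\<in>{0..1}. h (s, 0) = x \<and> h (s, 1) = x"
    using assms(1) unfolding loop_homotopic_altdef by blast
  obtain k where k: "continuous_map (top_of_set ?I2) X k"
      "\<forall>t\<in>{0..1}. k (0, t) = q t" "\<forall>t\<in>{0..1}. k (1, t) = q' t"
      "\<forall>s\<in>{0..1}. k (s, 0) = x \<and> k (s, 1) = x"
    using assms(2) unfolding loop_homotopic_altdef by blast
  let ?H = "\<lambda>z. if snd z \<le> 1/2 then (h \<circ> (\<lambda>z. (fst z, 2 * snd z))) z
                else (k \<circ> (\<lambda>z. (fst z, 2 * snd z - 1))) z"
  have "continuous_map (top_of_set ?I2) X ?H"
  proof (rule continuous_map_cases_le)
    show "continuous_map (top_of_set ?I2) euclideanreal snd"
      by (simp add: continuous_on_snd continuous_on_id)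
    show "continuous_map (top_of_set ?I2) euclideanreal (\<lambda>z. 1/2)"
      by simp
    show "continuous_map (subtopology (top_of_set ?I2) {z \<in> topspace (top_of_set ?I2). snd z \<le> 1/2}) X
            (h \<circ> (\<lambda>z. (fst z, 2 * snd z)))"
      by (rule continuous_map_compose[OF _ h(1)])
         (auto simp: subtopology_subtopology intro!: continuous_intros)
    show "continuous_map (subtopology (top_of_set ?I2) {z \<in> topspace (top_of_set ?I2). 1/2 \<le> snd z}) X
            (k \<circ> (\<lambda>z. (fst z, 2 * snd z - 1)))"
      by (rule continuous_map_compose[OF _ k(1)])
         (auto simp: subtopology_subtopology intro!: continuous_intros)
    fix z assume z: "z \<in> topspace (top_of_set ?I2)" "snd z = 1/2"
    then have "h (fst z, 1) = k (fst z, 0)"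
      using h(4) k(4) by auto
    then show "(h \<circ> (\<lambda>z. (fst z, 2 * snd z))) z = (k \<circ> (\<lambda>z. (fst z, 2 * snd z - 1))) z"
      unfolding o_def z(2) by simp
  qed
  then show ?thesis
    unfolding loop_homotopic_altdef using h k
    by (intro exI[of _ ?H]) (simp add: path_concat_def)
qed

lemma path_concat_in_loops:
  "p \<in> loops_at X x \<Longrightarrow> q \<in> loops_at X x \<Longrightarrow> path_concat p q \<in> loops_at X x"
  by (rule loop_homotopic_imp_loops(1)[OF loop_homotopic_concat[OF loop_homotopic_refl loop_homotopic_refl]])

lemma group_fundamental_group:
  assumes x: "x \<in> topspace X"
  shows "group (fundamental_group X x)"
proof -
  define C where "C p = {q. loop_homotopic X x p q}" for p
  have C_eqI: "C p = C q" if "loop_homotopic X x p q" for p q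
    unfolding C_def using loop_homotopic_trans[OF that]
      loop_homotopic_trans[OF loop_homotopic_sym[OF that]] by blast
  have carrier: "carrier (fundamental_group X x) = C ` loops_at X x"
    by (auto simp: fundamental_group_def quotient_def C_def)
  have mult: "C p \<otimes>\<^bsub>fundamental_group X x\<^esub> C q = C (path_concat p q)"
    if pq: "p \<in> loops_at X x" "q \<in> loops_at X x" for p q
  proof -
    have "loop_homotopic X x (path_concat p q) r"
      if "loop_homotopic X x p p'" "loop_homotopic X x q q'" "loop_homotopic X x (path_concat p' q') r"
      for p' q' r
      using loop_homotopic_trans[OF loop_homotopic_concat[OF that(1,2)] that(3)] .
    moreover have "loop_homotopic X x p p" "loop_homotopic X x q q"
      using pq by (simp_all add: loop_homotopic_refl)
    ultimately show ?thesis
      unfolding fundamental_group_def C_def by auto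
  qed
  have one: "\<one>\<^bsub>fundamental_group X x\<^esub> = C (\<lambda>_. x)"
    by (simp add: fundamental_group_def C_def)
  have const: "(\<lambda>_. x) \<in> loops_at X x"
    using x by (simp add: loops_at_def pathin_const)
  have unit: "loop_homotopic X x (path_concat (\<lambda>_. x) p) p" if p: "p \<in> loops_at X x" for p
  proof -
    have "path_concat (\<lambda>_. x) p = p \<circ> (\<lambda>t. max 0 (2 * t - 1))"
    proof
      fix t :: real
      have "max 0 (2 * t - 1) = (if t \<le> 1/2 then 0 else 2 * t - 1)" by auto
      then show "path_concat (\<lambda>_. x) p t = (p \<circ> (\<lambda>t. max 0 (2 * t - 1))) t"
        using p by (simp add: path_concat_def loops_at_def)
    qed
    moreover have "loop_homotopic X x (p \<circ> (\<lambda>t. max 0 (2 * t - 1))) (p \<circ> (\<lambda>t. t))"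
      using p by (intro loop_homotopic_reparam) (auto simp: loops_at_def intro!: continuous_intros)
    ultimately show ?thesis
      by (simp add: o_def)
  qed
  have inverse: "\<exists>q\<in>loops_at X x. loop_homotopic X x (path_concat q p) (\<lambda>_. x)"
    if p: "p \<in> loops_at X x" for p
  proof
    let ?r = "p \<circ> (\<lambda>t. 1 - t)"
    have "continuous_map (top_of_set {0..1}) (top_of_set {0..1}) (\<lambda>t::real. 1 - t)"
      by (auto intro!: continuous_intros)
    then have "pathin X ?r"
      using p unfolding loops_at_def pathin_def by (blast intro: continuous_map_compose)
    then show "?r \<in> loops_at X x"
      using p by (simp add: loops_at_def)
    have "path_concat ?r p = p \<circ> (\<lambda>t. \<bar>2 * t - 1\<bar>)"
      by (auto simp: path_concat_def fun_eq_iff)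
    moreover have "loop_homotopic X x (p \<circ> (\<lambda>t. \<bar>2 * t - 1\<bar>)) (p \<circ> (\<lambda>t. 1))"
      using p by (intro loop_homotopic_reparam) (auto simp: loops_at_def intro!: continuous_intros)
    moreover have "p \<circ> (\<lambda>t::real. 1) = (\<lambda>_. x)"
      using p by (auto simp: loops_at_def)
    ultimately show "loop_homotopic X x (path_concat ?r p) (\<lambda>_. x)"
      by (simp only:)
  qed
  have assoc: "loop_homotopic X x (path_concat (path_concat p q) r) (path_concat p (path_concat q r))"
    if pqr: "p \<in> loops_at X x" "q \<in> loops_at X x" "r \<in> loops_at X x" for p q r
  proof -
    let ?w = "path_concat (path_concat p q) r"
    let ?g = "\<lambda>t. max (t / 2) (max (t - 1/4) (2 * t - 1))"
    have ends: "p 0 = x" "p 1 = x" "q 0 = x" "q 1 = x" "r 0 = x" "r 1 = x"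
      using pqr by (auto simp: loops_at_def)
    have "path_concat p (path_concat q r) t = ?w (?g t)" for t
    proof -
      consider "t \<le> 1/2" | "1/2 < t" "t \<le> 3/4" | "3/4 < t" by linarith
      then show ?thesis
      proof cases
        case 1
        then have "?g t = t / 2" by auto
        with 1 show ?thesis by (simp add: path_concat_def)
      next
        case 2
        then have "?g t = t - 1/4" by auto
        with 2 show ?thesis by (auto simp: path_concat_def algebra_simps)
      next
        case 3
        then have "?g t = 2 * t - 1" by auto
        with 3 show ?thesis by (auto simp: path_concat_def algebra_simps)
      qed
    qed
    then have "path_concat p (path_concat q r) = ?w \<circ> ?g"
      by auto
    moreover have "?w \<in> loops_at X x"
      using pqr by (simp add: path_concat_in_loops)
    then have "loop_homotopic X x (?w \<circ> (\<lambda>t. t)) (?w \<circ> ?g)"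
      by (intro loop_homotopic_reparam)
         (auto simp: loops_at_def le_max_iff_disj intro!: continuous_intros)
    ultimately show ?thesis
      by (simp add: o_def)
  qed
  show ?thesis
  proof (rule groupI)
    show "\<exists>B\<in>carrier (fundamental_group X x).
            B \<otimes>\<^bsub>fundamental_group X x\<^esub> A = \<one>\<^bsub>fundamental_group X x\<^esub>"
      if "A \<in> carrier (fundamental_group X x)" for A
    proof -
      from that obtain p where p: "p \<in> loops_at X x" "A = C p"
        by (auto simp: carrier)
      from inverse[OF p(1)] obtain q
        where "q \<in> loops_at X x" "loop_homotopic X x (path_concat q p) (\<lambda>_. x)" ..
      with p show ?thesis
        by (auto simp: carrier mult one intro!: bexI[of _ q] C_eqI)
    qed
  qed (auto simp: carrier mult one const path_concat_in_loops C_eqI[OF unit] C_eqI[OF assoc])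
qed


section \<open>Selfcoincidences\<close>

text \<open>The metrics considered on the target are those inducing its topology. For a manifold
  \<open>N\<close> and a compact \<open>M\<close>, sufficiently close maps into \<open>N\<close> are homotopic, so no homotopy is
  required explicitly.\<close>

definition self_loose_by_small_deformation ::
    "'b topology \<Rightarrow> 'a topology \<Rightarrow> ('b \<Rightarrow> 'a) \<Rightarrow> bool" where
  "self_loose_by_small_deformation M N f \<longleftrightarrow>
     (\<forall>d \<epsilon>. Metric_space (topspace N) d \<and> Metric_space.mtopology (topspace N) d = N \<and> \<epsilon> > 0 \<longrightarrow>
       (\<exists>f'. continuous_map M N f' \<and>
          (\<forall>x\<in>topspace M. d (f x) (f' x) < \<epsilon>) \<and> (\<forall>x\<in>topspace M. f' x \<noteq> f x)))"

end

theory Submission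
  imports Defs "HOL-Probability.Discrete_Topology"
begin

text \<open>
  Let \<open>T\<close> be the universal covering of \<open>N\<close>. A group with a nontrivial proper subgroup has at least
  three elements, so there are three points of \<open>T\<close> over one value of \<open>f\<close>; since \<open>m \<ge> 2\<close> the map \<open>f\<close>
  lifts to \<open>T\<close> through each of them, and the three lifts \<open>F1\<close>, \<open>F2\<close>, \<open>F3\<close> differ from each other at
  every point of the sphere. The projection does not increase distances and is injective on small
  sets, so it suffices to push \<open>F1\<close> off itself in \<open>T\<close> by a small deformation. This is possible in
  every connected manifold \<open>T\<close> (lemma \<open>push_off_from_three_disjoint\<close>), for the following reason.

  View the sphere as a disc \<open>D\<close> whose boundary is collapsed, and let \<open>p\<close> be the value of \<open>F1\<close> on the
  boundary. As \<open>D\<close> is contractible, there are homeomorphisms \<open>\<Phi> x\<close> of \<open>T\<close>, depending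
  continuously on \<open>x \<in> D\<close>, with \<open>\<Phi> x p = F1 x\<close>. If \<open>k\<close> maps \<open>D\<close> into a small punctured
  neighbourhood of \<open>p\<close>, then \<open>\<Phi> x (k x)\<close> is close to \<open>F1 x\<close> and different from it, and it is constant
  on the boundary if \<open>k x = (\<Phi> x)\<inverse> u\<close> there for a fixed point \<open>u\<close>. So the problem is to extend the
  map \<open>x \<mapsto> (\<Phi> x)\<inverse> u\<close> from the boundary over \<open>D\<close>; this is the usual obstruction in the homotopy
  group of degree \<open>m - 1\<close> of a sphere of dimension one less than that of \<open>T\<close>.

  The other two lifts remove the obstruction. Since \<open>F2\<close> avoids \<open>F1\<close>, a second
  family of homeomorphisms, of \<open>T - {p}\<close>, makes \<open>(\<Phi> x)\<inverse> (F2 x)\<close> a constant \<open>q\<close>. In these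
  coordinates \<open>F3\<close> becomes a map from \<open>D\<close> to \<open>T - {p, q}\<close>, and after a change of \<open>F3\<close> near the
  boundary along a path ending at \<open>u\<close>, it extends the given boundary map. Finally a sphere
  around \<open>p\<close> is, up to homotopy, a retract of \<open>T - {p, q}\<close>: collapsing the complement of a ball
  that contains both points maps \<open>T - {p, q}\<close> to a sphere with two points removed (lemma \<open>pinch\<close>).
  With only one point removed this would fail: the complement of a point in a
  sphere is contractible, and the identity of an even-dimensional sphere, though disjoint from the
  antipodal map, cannot be pushed off itself by a small deformation. In dimension one the punctured
  neighbourhood consists of two contractible pieces and the extension exists because the collar of
  the boundary of \<open>D\<close> is connected.

  To have path homotopies and continuity on subsets at hand, \<open>N\<close> is replaced by an isometric copy in
  a normed space. The universal covering is the image, in another normed space, of the set of paths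
  from a base point under a pseudometric for which two paths have distance zero if and only if they
  are homotopic relative to their ends.
\<close>

section \<open>Continuity on subsets of metric spaces\<close>

lemma continuous_on_paste_open:
  assumes "openin (top_of_set S) A" "openin (top_of_set S) B" "S \<subseteq> A \<union> B"
    and "continuous_on A f" "continuous_on B g"
    and "\<And>x. x \<in> A \<Longrightarrow> F x = f x" "\<And>x. x \<in> B \<Longrightarrow> F x = g x"
  shows "continuous_on S F"
proof -
  have S: "S = A \<union> B"
    using assms(1-3) openin_imp_subset by fastforce
  have "continuous_on A F" "continuous_on B F"
    using assms(4-7) by (simp_all cong: continuous_on_cong)
  then show ?thesis
    using assms(1,2) unfolding S by (intro continuous_on_Un_local_open) auto
qed

lemma continuous_on_paste_closed:
  assumes "closedin (top_of_set S) A" "closedin (top_of_set S) B" "S \<subseteq> A \<union> B"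
    and "continuous_on A f" "continuous_on B g"
    and "\<And>x. x \<in> A \<Longrightarrow> F x = f x" "\<And>x. x \<in> B \<Longrightarrow> F x = g x"
  shows "continuous_on S F"
proof -
  have S: "S = A \<union> B"
    using assms(1-3) closedin_imp_subset by fastforce
  have "continuous_on A F" "continuous_on B F"
    using assms(4-7) by (simp_all cong: continuous_on_cong)
  then show ?thesis
    using assms(1,2) unfolding S by (intro continuous_on_Un_local) auto
qed

text \<open>A continuous function on a space that is not compact need not be uniformly continuous, but
  it is so near a compact set. This turns the pointwise continuity of families of
  homeomorphisms into estimates that hold along the whole graph of a map on a compact space.\<close>

lemma uniformly_continuous_near_compact:
  fixes f :: "'x::metric_space \<Rightarrow> 'y::metric_space"
  assumes f: "continuous_on A f" and K: "compact K" "K \<subseteq> A" and e: "0 < e"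
  obtains d where "0 < d" "\<And>k z. k \<in> K \<Longrightarrow> z \<in> A \<Longrightarrow> dist k z < d \<Longrightarrow> dist (f k) (f z) < e"
proof -
  have "\<exists>r>0. \<forall>z\<in>A. dist z k < r \<longrightarrow> dist (f z) (f k) < e/2" if "k \<in> K" for k
    using f K(2) that e unfolding continuous_on_iff by (meson half_gt_zero subsetD)
  then obtain r where r: "\<And>k. k \<in> K \<Longrightarrow> r k > 0"
      "\<And>k z. k \<in> K \<Longrightarrow> z \<in> A \<Longrightarrow> dist z k < r k \<Longrightarrow> dist (f z) (f k) < e/2"
    by metis
  obtain d where d: "0 < d" "\<And>x. x \<in> K \<Longrightarrow> \<exists>G\<in>(\<lambda>k. ball k (r k)) ` K. ball x d \<subseteq> G"
    by (rule Heine_Borel_lemma[OF K(1), of "(\<lambda>k. ball k (r k)) ` K"]) (use r(1) in auto)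
  show ?thesis
  proof (rule that[OF d(1)])
    fix k z assume kz: "k \<in> K" "z \<in> A" "dist k z < d"
    from d(2)[OF kz(1)] obtain k' where k': "k' \<in> K" "ball k d \<subseteq> ball k' (r k')" by auto
    have "k \<in> ball k d" "z \<in> ball k d" using kz d(1) by auto
    then have "k \<in> ball k' (r k')" "z \<in> ball k' (r k')" using k'(2) by blast+
    then have "dist k k' < r k'" "dist z k' < r k'" by (simp_all add: dist_commute)
    then have "dist (f k) (f k') < e/2" "dist (f z) (f k') < e/2"
      using r(2)[OF k'(1)] kz K(2) by blast+
    then show "dist (f k) (f z) < e"
      using dist_triangle_half_r[of "f k'" "f k" e "f z"] by (simp add: dist_commute)
  qed
qed


section \<open>Topological manifolds and pushes inside a chart\<close>

text \<open>The charts are onto the whole model space, so that images of balls of any radius are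
  available in every chart.\<close>

definition locally_euclidean :: "'e::euclidean_space itself \<Rightarrow> 'w::metric_space set \<Rightarrow> bool" where
  "locally_euclidean _ T \<longleftrightarrow>
     (\<forall>p\<in>T. \<exists>U. openin (top_of_set T) U \<and> p \<in> U \<and> U homeomorphic (UNIV :: 'e set))"

lemma locally_euclidean_chart:
  fixes T :: "'w::metric_space set"
  assumes "locally_euclidean TYPE('e::euclidean_space) T" "p \<in> T"
  obtains U \<theta> \<theta>' where "openin (top_of_set T) U" "p \<in> U"
    "homeomorphism (UNIV::'e set) U \<theta> \<theta>'" "\<theta> 0 = p"
proof -
  obtain U g k where U: "openin (top_of_set T) U" "p \<in> U" and h: "homeomorphism U (UNIV::'e set) g k"
    using assms unfolding locally_euclidean_def homeomorphic_def by meson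
  have "homeomorphism (UNIV::'e set) (UNIV::'e set) (\<lambda>y. g p + y) (\<lambda>y. y - g p)"
    by (auto simp: homeomorphism_def image_iff intro!: continuous_intros exI[of _ "_ - g p"])
  from homeomorphism_compose[OF this homeomorphism_symD[OF h]]
  have "homeomorphism (UNIV::'e set) U (k \<circ> (\<lambda>y. g p + y)) ((\<lambda>y. y - g p) \<circ> g)" .
  moreover have "(k \<circ> (\<lambda>y. g p + y)) 0 = p"
    using h U(2) by (simp add: homeomorphism_def)
  ultimately show ?thesis using that[OF U] by blast
qed

lemma locally_euclidean_openin:
  fixes T :: "'w::metric_space set"
  assumes LE: "locally_euclidean TYPE('e::euclidean_space) T" and V: "openin (top_of_set T) V"
  shows "locally_euclidean TYPE('e) V"
  unfolding locally_euclidean_def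
proof
  fix p assume p: "p \<in> V"
  then have pT: "p \<in> T" using V openin_imp_subset by blast
  obtain U \<theta> \<theta>' where U: "openin (top_of_set T) U" "p \<in> U"
    and h: "homeomorphism (UNIV::'e set) U \<theta> \<theta>'" "\<theta> 0 = p"
    by (rule locally_euclidean_chart[OF LE pT])
  have "openin (top_of_set U) (U \<inter> V)"
    using U(1) V by (metis Int_commute openin_Int openin_imp_subset openin_subset_trans inf_le2)
  then have "openin (top_of_set UNIV) (\<theta>' ` (U \<inter> V))"
    using homeomorphism_imp_open_map[OF homeomorphism_symD[OF h(1)]] by blast
  then have op: "open (\<theta>' ` (U \<inter> V))" by (simp)
  have "\<theta>' p = 0" using h by (metis homeomorphism_apply1 UNIV_I)
  then have "0 \<in> \<theta>' ` (U \<inter> V)" using p U(2) by force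
  then obtain r where r: "r > 0" "ball 0 r \<subseteq> \<theta>' ` (U \<inter> V)"
    using op openE by blast
  let ?B = "\<theta> ` ball 0 r"
  have BV: "?B \<subseteq> V" using r(2) h(1) by (auto simp: homeomorphism_def)
  have "openin (top_of_set U) ?B"
    using homeomorphism_imp_open_map[OF h(1), of "ball 0 r"] by simp
  then have "openin (top_of_set T) ?B" using U(1) by (metis openin_trans)
  then have "openin (top_of_set V) ?B"
    using BV V by (metis openin_imp_subset openin_subset_trans)
  moreover have "p \<in> ?B" using h(2) r(1) by force
  moreover have "homeomorphism (ball 0 r) ?B \<theta> \<theta>'"
    by (rule homeomorphism_of_subsets[OF h(1)]) auto
  then have "?B homeomorphic ball (0::'e) r"
    using homeomorphic_def homeomorphic_sym by metis
  then have "?B homeomorphic (UNIV::'e set)"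
    using homeomorphic_ball_UNIV[OF r(1)] homeomorphic_trans by blast
  ultimately show "\<exists>U. openin (top_of_set V) U \<and> p \<in> U \<and> U homeomorphic (UNIV::'e set)"
    by blast
qed

text \<open>For \<open>norm a < 1\<close> the map \<open>y \<mapsto> y + max 0 (1 - norm y) *\<^sub>R a\<close> is a perturbation
  of the identity with Lipschitz constant \<open>norm a\<close>, hence a homeomorphism by Banach's fixed
  point theorem. It is supported in the unit ball and moves the centre to \<open>a\<close>.\<close>

lemma chart_push_euclidean:
  obtains h g :: "'e::euclidean_space \<times> 'e \<Rightarrow> 'e"
  where "continuous_on (ball 0 1 \<times> UNIV) h" "continuous_on (ball 0 1 \<times> UNIV) g"
    "\<And>a y. a \<in> ball 0 1 \<Longrightarrow> h (a, g (a, y)) = y" "\<And>a y. a \<in> ball 0 1 \<Longrightarrow> g (a, h (a, y)) = y"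
    "\<And>a. h (a, 0) = a"
    "\<And>a y. 1 \<le> norm y \<Longrightarrow> h (a, y) = y"
proof -
  define h :: "'e \<times> 'e \<Rightarrow> 'e" where "h = (\<lambda>(a, y). y + max 0 (1 - norm y) *\<^sub>R a)"
  have lip: "\<bar>max 0 (1 - norm y) - max 0 (1 - norm y')\<bar> \<le> norm (y - y')" for y y' :: 'e
    using norm_triangle_ineq3[of y y'] by (auto simp: max_def)
  have lip': "norm (max 0 (1 - norm y) *\<^sub>R a - max 0 (1 - norm y') *\<^sub>R a') \<le>
       norm a * norm (y - y') + norm (a - a')" for y y' a a' :: 'e
  proof -
    have "max 0 (1 - norm y) *\<^sub>R a - max 0 (1 - norm y') *\<^sub>R a' =
      (max 0 (1 - norm y) - max 0 (1 - norm y')) *\<^sub>R a + max 0 (1 - norm y') *\<^sub>R (a - a')"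
      by (simp add: algebra_simps)
    also have "norm \<dots> \<le> norm (y - y') * norm a + 1 * norm (a - a')"
      by (intro norm_triangle_le add_mono) (auto simp: lip intro!: mult_right_mono mult_left_le_one_le)
    finally show ?thesis by (simp add: mult.commute)
  qed
  have inj: "norm (y - y') * (1 - norm a) \<le> norm (h (a, y) - h (a', y')) + norm (a - a')"
    for y y' a a' :: 'e
  proof -
    have "y - y' = (h (a, y) - h (a', y')) -
        (max 0 (1 - norm y) *\<^sub>R a - max 0 (1 - norm y') *\<^sub>R a')"
      by (simp add: h_def)
    then have "norm (y - y') \<le> norm (h (a, y) - h (a', y')) +
        norm (max 0 (1 - norm y) *\<^sub>R a - max 0 (1 - norm y') *\<^sub>R a')"
      by (metis norm_triangle_ineq4)
    with lip'[of y a y' a'] show ?thesis by (simp add: algebra_simps)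
  qed
  have ex: "\<exists>y. h (a, y) = z" if a: "a \<in> ball 0 1" for a z
  proof -
    have "\<exists>!y. z - max 0 (1 - norm y) *\<^sub>R a = y"
      by (rule banach_fix_type[of "norm a"])
         (use a lip'[of _ a _ a] in \<open>auto simp: dist_norm norm_minus_commute\<close>)
    then show ?thesis by (auto simp: h_def algebra_simps)
  qed
  define g where "g = (\<lambda>(a, z). SOME y. h (a, y) = z)"
  have hg: "h (a, g (a, z)) = z" if "a \<in> ball 0 1" for a z
    using someI_ex[OF ex[OF that, of z]] by (simp add: g_def)
  have gh: "g (a, h (a, y)) = y" if a: "a \<in> ball 0 1" for a y
  proof -
    have "norm (g (a, h (a, y)) - y) * (1 - norm a) \<le> 0"
      using inj[of "g (a, h (a, y))" y a a] hg[OF a] by simp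
    with a have "norm (g (a, h (a, y)) - y) \<le> 0" by (simp add: mult_le_0_iff)
    then show ?thesis by simp
  qed
  have "continuous_on (ball 0 1 \<times> UNIV) h"
    unfolding h_def case_prod_unfold by (intro continuous_intros)
  moreover have "continuous_on (ball 0 1 \<times> UNIV) g"
    unfolding continuous_on_iff
  proof clarify
    fix a z :: 'e and e :: real assume a: "a \<in> ball 0 1" and e: "e > 0"
    let ?d = "e * (1 - norm a) / 2"
    have d: "?d > 0" using a e by simp
    show "\<exists>d>0. \<forall>x'\<in>ball 0 1 \<times> UNIV. dist x' (a, z) < d \<longrightarrow> dist (g x') (g (a, z)) < e"
    proof (intro exI[of _ ?d] conjI d ballI impI)
      fix x' assume x': "x' \<in> ball (0::'e) 1 \<times> (UNIV::'e set)" "dist x' (a, z) < ?d"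
      obtain a' z' where [simp]: "x' = (a', z')" by (cases x')
      have "dist a a' < ?d" "dist z z' < ?d"
        using x'(2) dist_fst_le[of x' "(a, z)"] dist_snd_le[of x' "(a, z)"] by (auto simp: dist_commute)
      moreover have "norm (g (a, z) - g (a', z')) * (1 - norm a) \<le> norm (z - z') + norm (a - a')"
        using inj[of "g (a,z)" "g (a',z')" a a'] hg a x'(1) by simp
      ultimately have "norm (g (a, z) - g (a', z')) * (1 - norm a) < e * (1 - norm a)"
        by (simp add: dist_norm)
      then show "dist (g x') (g (a, z)) < e"
        using a by (simp add: dist_norm norm_minus_commute)
    qed
  qed
  ultimately show ?thesis
    by (rule that) (use hg gh in \<open>auto simp: h_def\<close>)
qed

text \<open>The pushes of the model space, transported to a chart and extended by the identity:
  \<open>A (c, _)\<close> moves the centre of the chart to \<open>c\<close>, and \<open>B (c, _)\<close> is its inverse.\<close>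

lemma chart_push:
  fixes T :: "'w::metric_space set" and \<theta> :: "'e::euclidean_space \<Rightarrow> 'w"
  assumes U: "openin (top_of_set T) U" and h: "homeomorphism UNIV U \<theta> \<theta>'"
  obtains A B where "continuous_on (\<theta> ` ball 0 1 \<times> T) A" "continuous_on (\<theta> ` ball 0 1 \<times> T) B"
    "\<And>c y. c \<in> \<theta> ` ball 0 1 \<Longrightarrow> y \<in> T \<Longrightarrow> A (c, y) \<in> T \<and> B (c, y) \<in> T \<and> A (c, B (c, y)) = y \<and> B (c, A (c, y)) = y"
    "\<And>c y. c \<in> \<theta> ` ball 0 1 \<Longrightarrow> y \<notin> \<theta> ` cball 0 1 \<Longrightarrow> A (c, y) = y \<and> B (c, y) = y"
    "\<And>c. c \<in> \<theta> ` ball 0 1 \<Longrightarrow> A (c, \<theta> 0) = c"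
proof -
  obtain a b :: "'e \<times> 'e \<Rightarrow> 'e" where
    ab: "continuous_on (ball 0 1 \<times> UNIV) a" "continuous_on (ball 0 1 \<times> UNIV) b"
    "\<And>c y. c \<in> ball 0 1 \<Longrightarrow> a (c, b (c, y)) = y" "\<And>c y. c \<in> ball 0 1 \<Longrightarrow> b (c, a (c, y)) = y"
    "\<And>c. a (c, 0) = c" "\<And>c y. 1 \<le> norm y \<Longrightarrow> a (c, y) = y"
    by (rule chart_push_euclidean, rule that)
  have b_id: "b (c, y) = y" if "c \<in> ball 0 1" "1 \<le> norm y" for c y
    using ab(4,6) that by metis
  have UT: "U \<subseteq> T" using U openin_imp_subset by blast
  have \<theta>[simp]: "\<theta>' (\<theta> y) = y" "\<theta> y \<in> U" for y using h by (auto simp: homeomorphism_def)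
  have \<theta>'[simp]: "y \<in> U \<Longrightarrow> \<theta> (\<theta>' y) = y" for y using h by (auto simp: homeomorphism_def)
  have c\<theta>: "continuous_on X \<theta>" for X
    using h continuous_on_subset by (auto simp: homeomorphism_def)
  have c\<theta>': "continuous_on U \<theta>'" using h by (auto simp: homeomorphism_def)
  define L where "L k = (\<lambda>(c, y). if y \<in> U then \<theta> (k (\<theta>' c, \<theta>' y)) else y)" for k :: "'e \<times> 'e \<Rightarrow> 'e"
  have cont: "continuous_on (\<theta> ` ball 0 1 \<times> T) (L k)"
    if k: "continuous_on (ball 0 1 \<times> UNIV) k" "\<And>c y. c \<in> ball 0 1 \<Longrightarrow> 1 \<le> norm y \<Longrightarrow> k (c, y) = y" for k
  proof (rule continuous_on_paste_open)
    show "openin (top_of_set (\<theta> ` ball 0 1 \<times> T)) (\<theta> ` ball 0 1 \<times> U)"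
      by (intro openin_Times U) auto
    have "compact (\<theta> ` cball 0 1)" by (intro compact_continuous_image c\<theta>) auto
    then have "openin (top_of_set T) (T - \<theta> ` cball 0 1)"
      using compact_imp_closed by (auto simp: openin_open intro!: exI[of _ "- \<theta> ` cball 0 1"])
    then show "openin (top_of_set (\<theta> ` ball 0 1 \<times> T)) (\<theta> ` ball 0 1 \<times> (T - \<theta> ` cball 0 1))"
      by (intro openin_Times) auto
    show "\<theta> ` ball 0 1 \<times> T \<subseteq> \<theta> ` ball 0 1 \<times> U \<union> \<theta> ` ball 0 1 \<times> (T - \<theta> ` cball 0 1)"
      by auto
    show "continuous_on (\<theta> ` ball 0 1 \<times> U) (\<lambda>z. \<theta> (k (\<theta>' (fst z), \<theta>' (snd z))))"
      by (rule continuous_on_compose2[OF c\<theta>[of UNIV]],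
          rule continuous_on_compose2[OF k(1)],
          intro continuous_intros continuous_on_compose2[OF c\<theta>']) auto
    show "continuous_on (\<theta> ` ball 0 1 \<times> (T - \<theta> ` cball 0 1)) snd"
      by (intro continuous_intros)
    show "L k x = \<theta> (k (\<theta>' (fst x), \<theta>' (snd x)))" if "x \<in> \<theta> ` ball 0 1 \<times> U" for x
      using that by (auto simp: L_def)
    show "L k x = snd x" if x: "x \<in> \<theta> ` ball 0 1 \<times> (T - \<theta> ` cball 0 1)" for x
    proof (cases "snd x \<in> U")
      case True
      then have "\<theta>' (snd x) \<notin> cball 0 1" using x by (metis DiffE \<theta>' imageI mem_Times_iff)
      then have "k (\<theta>' (fst x), \<theta>' (snd x)) = \<theta>' (snd x)" using x by (intro k(2)) auto
      with True show ?thesis by (simp add: L_def case_prod_unfold)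
    qed (auto simp: L_def case_prod_unfold)
  qed
  have off: "L k (c, y) = y"
    if "\<And>c y. c \<in> ball 0 1 \<Longrightarrow> 1 \<le> norm y \<Longrightarrow> k (c, y) = y" "c \<in> \<theta> ` ball 0 1" "y \<notin> \<theta> ` cball 0 1" for k c y
  proof (cases "y \<in> U")
    case True
    then have "\<theta>' y \<notin> cball 0 1" using that(3) by (metis \<theta>' imageI)
    moreover have "\<theta>' c \<in> ball 0 1" using that(2) by auto
    ultimately have "k (\<theta>' c, \<theta>' y) = \<theta>' y" by (intro that(1)) auto
    then show ?thesis using True by (simp add: L_def)
  qed (simp add: L_def)
  have inv: "L a (c, L b (c, y)) = y \<and> L b (c, L a (c, y)) = y \<and> L a (c, y) \<in> T \<and> L b (c, y) \<in> T"
    if "c \<in> \<theta> ` ball 0 1" "y \<in> T" for c y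
    using that ab(3,4) UT by (auto simp: L_def subset_iff)
  show ?thesis
  proof (rule that[of "L a" "L b"])
    show "continuous_on (\<theta> ` ball 0 1 \<times> T) (L a)" by (rule cont) (use ab in auto)
    show "continuous_on (\<theta> ` ball 0 1 \<times> T) (L b)" by (rule cont) (use ab b_id in auto)
    show "L a (c, y) = y \<and> L b (c, y) = y" if "c \<in> \<theta> ` ball 0 1" "y \<notin> \<theta> ` cball 0 1" for c y
      using off[of a c y] off[of b c y] that ab(6) b_id by auto
    show "L a (c, \<theta> 0) = c" if "c \<in> \<theta> ` ball 0 1" for c
      using that ab(5) by (auto simp: L_def)
  qed (use inv in auto)
qed


section \<open>Isotopies covering homotopies\<close>

lemma closedin_Collect_le:
  fixes f g :: "'x::topological_space \<Rightarrow> real"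
  assumes "continuous_on X f" "continuous_on X g"
  shows "closedin (top_of_set X) {x \<in> X. f x \<le> g x}"
proof -
  have "closedin (top_of_set X) (X \<inter> (\<lambda>x. f x - g x) -` {..0})"
    by (intro continuous_closedin_preimage continuous_intros assms)
  moreover have "X \<inter> (\<lambda>x. f x - g x) -` {..0} = {x \<in> X. f x \<le> g x}" by auto
  ultimately show ?thesis by simp
qed

text \<open>For each parameter \<open>x\<close>, the map \<open>\<Phi> (x, _)\<close> is a homeomorphism of \<open>T\<close> with inverse
  \<open>\<Psi> (x, _)\<close>. The compact support \<open>K\<close> matters when \<open>T\<close> is a punctured manifold: the
  homeomorphisms are then the identity near the puncture.\<close>

definition homeo_family :: "'x::metric_space set \<Rightarrow> 'w::metric_space set \<Rightarrow> 'w set \<Rightarrow>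
    ('x \<times> 'w \<Rightarrow> 'w) \<Rightarrow> ('x \<times> 'w \<Rightarrow> 'w) \<Rightarrow> bool" where
  "homeo_family X T K \<Phi> \<Psi> \<longleftrightarrow> compact K \<and> K \<subseteq> T \<and>
     continuous_on (X \<times> T) \<Phi> \<and> continuous_on (X \<times> T) \<Psi> \<and>
     (\<forall>x\<in>X. \<forall>y\<in>T. \<Phi> (x, y) \<in> T \<and> \<Psi> (x, y) \<in> T \<and> \<Phi> (x, \<Psi> (x, y)) = y \<and> \<Psi> (x, \<Phi> (x, y)) = y) \<and>
     (\<forall>x\<in>X. \<forall>y\<in>T - K. \<Phi> (x, y) = y \<and> \<Psi> (x, y) = y)"

lemma homeo_familyD:
  assumes "homeo_family X T K \<Phi> \<Psi>"
  shows "compact K" "K \<subseteq> T" "continuous_on (X \<times> T) \<Phi>" "continuous_on (X \<times> T) \<Psi>"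
    "\<And>x y. x \<in> X \<Longrightarrow> y \<in> T \<Longrightarrow> \<Phi> (x, y) \<in> T" "\<And>x y. x \<in> X \<Longrightarrow> y \<in> T \<Longrightarrow> \<Psi> (x, y) \<in> T"
    "\<And>x y. x \<in> X \<Longrightarrow> y \<in> T \<Longrightarrow> \<Phi> (x, \<Psi> (x, y)) = y" "\<And>x y. x \<in> X \<Longrightarrow> y \<in> T \<Longrightarrow> \<Psi> (x, \<Phi> (x, y)) = y"
    "\<And>x y. x \<in> X \<Longrightarrow> y \<in> T \<Longrightarrow> y \<notin> K \<Longrightarrow> \<Phi> (x, y) = y" "\<And>x y. x \<in> X \<Longrightarrow> y \<in> T \<Longrightarrow> y \<notin> K \<Longrightarrow> \<Psi> (x, y) = y"
  using assms by (simp_all add: homeo_family_def)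

definition moves :: "'x::metric_space set \<Rightarrow> 'w::metric_space set \<Rightarrow> ('x \<Rightarrow> 'w) \<Rightarrow> ('x \<Rightarrow> 'w) \<Rightarrow> bool" where
  "moves X T f g \<longleftrightarrow> (\<exists>K \<Phi> \<Psi>. homeo_family X T K \<Phi> \<Psi> \<and> (\<forall>x\<in>X. \<Phi> (x, f x) = g x))"

lemma movesE:
  assumes "moves X T f g"
  obtains K \<Phi> \<Psi> where "homeo_family X T K \<Phi> \<Psi>" "\<forall>x\<in>X. \<Phi> (x, f x) = g x"
  using assms by (auto simp: moves_def)

lemma moves_refl: "moves X T f f"
  unfolding moves_def homeo_family_def
  by (intro exI[of _ snd] exI[of _ "{}"]) (auto intro!: continuous_intros)

lemma moves_trans:
  assumes "moves X T f g" "moves X T g k"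
  shows "moves X T f k"
proof -
  obtain K1 \<Phi>1 \<Psi>1 where 1: "homeo_family X T K1 \<Phi>1 \<Psi>1" "\<forall>x\<in>X. \<Phi>1 (x, f x) = g x"
    using assms(1) by (rule movesE)
  note h1 = homeo_familyD[OF 1(1)]
  obtain K2 \<Phi>2 \<Psi>2 where 2: "homeo_family X T K2 \<Phi>2 \<Psi>2" "\<forall>x\<in>X. \<Phi>2 (x, g x) = k x"
    using assms(2) by (rule movesE)
  note h2 = homeo_familyD[OF 2(1)]
  show ?thesis
    unfolding moves_def homeo_family_def
  proof (intro exI conjI)
    show "compact (K1 \<union> K2)" "K1 \<union> K2 \<subseteq> T" using h1(1,2) h2(1,2) by auto
    show "continuous_on (X \<times> T) (\<lambda>(x, y). \<Phi>2 (x, \<Phi>1 (x, y)))"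
      unfolding case_prod_unfold
      by (rule continuous_on_compose2[OF h2(3)], intro continuous_intros continuous_on_compose2[OF h1(3)])
         (use h1(5) in auto)
    show "continuous_on (X \<times> T) (\<lambda>(x, y). \<Psi>1 (x, \<Psi>2 (x, y)))"
      unfolding case_prod_unfold
      by (rule continuous_on_compose2[OF h1(4)], intro continuous_intros continuous_on_compose2[OF h2(4)])
         (use h2(6) in auto)
  qed (use h1(5-) h2(5-) 1(2) 2(2) in auto)
qed

text \<open>Where \<open>f\<close> and \<open>g\<close> differ, both lie in one chart ball, so the push that takes \<open>f x\<close> to the
  centre followed by the push from the centre to \<open>g x\<close> works. Where \<open>f x = g x\<close> this
  composition is the identity, so it can be continued by the identity.\<close>

lemma moves_local:
  fixes T :: "'w::metric_space set" and \<theta> :: "'e::euclidean_space \<Rightarrow> 'w"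
  assumes U: "openin (top_of_set T) U" and h: "homeomorphism UNIV U \<theta> \<theta>'"
    and C: "closedin (top_of_set X) C" "closedin (top_of_set X) C'" "X \<subseteq> C \<union> C'"
    and f: "continuous_on X f" "f ` X \<subseteq> T" and g: "continuous_on X g"
    and fC: "f ` C \<subseteq> \<theta> ` ball 0 1" "g ` C \<subseteq> \<theta> ` ball 0 1" and eq: "\<And>x. x \<in> C' \<Longrightarrow> f x = g x"
  shows "moves X T f g"
proof -
  obtain A B where AB: "continuous_on (\<theta> ` ball 0 1 \<times> T) A" "continuous_on (\<theta> ` ball 0 1 \<times> T) B"
    and inv: "\<And>c y. c \<in> \<theta> ` ball 0 1 \<Longrightarrow> y \<in> T \<Longrightarrow> A (c, y) \<in> T \<and> B (c, y) \<in> T \<and> A (c, B (c, y)) = y \<and> B (c, A (c, y)) = y"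
    and off: "\<And>c y. c \<in> \<theta> ` ball 0 1 \<Longrightarrow> y \<notin> \<theta> ` cball 0 1 \<Longrightarrow> A (c, y) = y \<and> B (c, y) = y"
    and centre: "\<And>c. c \<in> \<theta> ` ball 0 1 \<Longrightarrow> A (c, \<theta> 0) = c"
    by (rule chart_push[OF U h], rule that; assumption)
  have CX: "C \<subseteq> X" "C' \<subseteq> X" using C closedin_imp_subset by blast+
  have UT: "U \<subseteq> T" using U openin_imp_subset by blast
  have c\<theta>: "continuous_on Z \<theta>" for Z
    using h continuous_on_subset by (auto simp: homeomorphism_def)
  have \<theta>0: "\<theta> 0 \<in> T" using h UT by (auto simp: homeomorphism_def)
  have fg: "f x \<in> \<theta> ` ball 0 1" "g x \<in> \<theta> ` ball 0 1" if "x \<in> C" for x using fC that by blast+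
  define \<Phi> where "\<Phi> k l = (\<lambda>(x, y). if x \<in> C then A (k x, B (l x, y)) else y)" for k l :: "'a \<Rightarrow> 'w"
  have cont: "continuous_on (X \<times> T) (\<Phi> k l)"
    if k: "continuous_on X k" "k ` C \<subseteq> \<theta> ` ball 0 1" and l: "continuous_on X l" "l ` C \<subseteq> \<theta> ` ball 0 1"
      and kl: "\<And>x. x \<in> C' \<Longrightarrow> k x = l x" for k l
  proof (rule continuous_on_paste_closed)
    show "closedin (top_of_set (X \<times> T)) (C \<times> T)" "closedin (top_of_set (X \<times> T)) (C' \<times> T)"
      using C(1,2) by (auto intro: closedin_Times)
    show "X \<times> T \<subseteq> C \<times> T \<union> C' \<times> T" using C(3) by auto
    show "continuous_on (C \<times> T) (\<lambda>z. A (k (fst z), B (l (fst z), snd z)))"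
      by (rule continuous_on_compose2[OF AB(1)],
          intro continuous_intros continuous_on_compose2[OF AB(2)]
            continuous_on_compose2[OF k(1)] continuous_on_compose2[OF l(1)])
         (use k(2) l(2) CX inv in \<open>auto simp: image_subset_iff\<close>)
    show "continuous_on (C' \<times> T) snd" by (intro continuous_intros)
    show "\<Phi> k l z = A (k (fst z), B (l (fst z), snd z))" if "z \<in> C \<times> T" for z
      using that by (auto simp: \<Phi>_def)
    show "\<Phi> k l z = snd z" if "z \<in> C' \<times> T" for z
    proof (cases "fst z \<in> C")
      case True
      then have "k (fst z) = l (fst z)" "l (fst z) \<in> \<theta> ` ball 0 1" using that kl l(2) by auto
      then show ?thesis using that inv by (auto simp: \<Phi>_def)
    qed (use that in \<open>auto simp: \<Phi>_def\<close>)
  qed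
  have B_centre: "B (c, c) = \<theta> 0" if "c \<in> \<theta> ` ball 0 1" for c
    using centre[OF that] inv[OF that \<theta>0] by simp
  show ?thesis
    unfolding moves_def homeo_family_def
  proof (intro exI conjI)
    show "compact (\<theta> ` cball 0 1)" by (intro compact_continuous_image c\<theta>) auto
    show "\<theta> ` cball 0 1 \<subseteq> T" using h UT by (auto simp: homeomorphism_def)
    show "continuous_on (X \<times> T) (\<Phi> g f)" by (rule cont[OF g fC(2) f(1) fC(1)]) (simp add: eq)
    show "continuous_on (X \<times> T) (\<Phi> f g)" by (rule cont[OF f(1) fC(1) g fC(2)]) (simp add: eq)
    show "\<forall>x\<in>X. \<forall>y\<in>T. \<Phi> g f (x, y) \<in> T \<and> \<Phi> f g (x, y) \<in> T \<and>
        \<Phi> g f (x, \<Phi> f g (x, y)) = y \<and> \<Phi> f g (x, \<Phi> g f (x, y)) = y"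
      using inv fg by (auto simp: \<Phi>_def)
    show "\<forall>x\<in>X. \<forall>y\<in>T - \<theta> ` cball 0 1. \<Phi> g f (x, y) = y \<and> \<Phi> f g (x, y) = y"
      using off fg by (auto simp: \<Phi>_def)
    show "\<forall>x\<in>X. \<Phi> g f (x, f x) = g x"
    proof
      fix x assume "x \<in> X"
      then show "\<Phi> g f (x, f x) = g x"
        using B_centre centre fg eq[of x] C(3) by (cases "x \<in> C") (auto simp: \<Phi>_def)
    qed
  qed
qed

text \<open>The isotopy covering a homotopy. By a Lebesgue number argument, \<open>H\<close> sends small balls of
  \<open>X \<times> {0..1}\<close> into chart balls. Time is cut into short intervals, and within one
  interval the clock is advanced on one small ball of \<open>X\<close> after the other, so that each single
  step is covered by \<open>moves_local\<close>.\<close>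

lemma moves_homotopy:
  fixes T :: "'w::metric_space set" and H :: "'x::metric_space \<times> real \<Rightarrow> 'w"
  assumes LE: "locally_euclidean TYPE('e::euclidean_space) T" and X: "compact X"
    and H: "continuous_on (X \<times> {0..1}) H" "H ` (X \<times> {0..1}) \<subseteq> T"
  shows "moves X T (\<lambda>x. H (x, 0)) (\<lambda>x. H (x, 1))"
proof (cases "X = {}")
  case True
  then show ?thesis unfolding moves_def homeo_family_def by (intro exI[of _ snd] exI[of _ "{}"]) auto
next
  case False
  define chart_ball where "chart_ball A \<longleftrightarrow> (\<exists>U \<theta> \<theta>'. openin (top_of_set T) U \<and>
     homeomorphism (UNIV::'e set) U \<theta> \<theta>' \<and> A = \<theta> ` ball 0 1)" for A
  define \<C> where "\<C> = {V. open V \<and> (\<exists>A. chart_ball A \<and> H ` (V \<inter> X \<times> {0..1}) \<subseteq> A)}"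
  have "\<exists>V\<in>\<C>. z \<in> V" if z: "z \<in> X \<times> {0..1}" for z
  proof -
    have "H z \<in> T" using z H(2) by blast
    then obtain U \<theta> \<theta>' where U: "openin (top_of_set T) U" "H z \<in> U"
      and h: "homeomorphism (UNIV::'e set) U \<theta> \<theta>'" "\<theta> 0 = H z"
      by (rule locally_euclidean_chart[OF LE])
    have "openin (top_of_set U) (\<theta> ` ball 0 1)"
      using homeomorphism_imp_open_map[OF h(1), of "ball 0 1"] by simp
    then have "openin (top_of_set T) (\<theta> ` ball 0 1)" using U(1) by (metis openin_trans)
    then have "openin (top_of_set (X \<times> {0..1})) (X \<times> {0..1} \<inter> H -` (\<theta> ` ball 0 1))"
      using H by (metis continuous_openin_preimage image_subset_iff_funcset)
    then obtain V where V: "open V" "X \<times> {0..1} \<inter> H -` (\<theta> ` ball 0 1) = X \<times> {0..1} \<inter> V"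
      by (auto simp: openin_open)
    have "chart_ball (\<theta> ` ball 0 1)" using U h chart_ball_def by blast
    moreover have "H ` (V \<inter> X \<times> {0..1}) \<subseteq> \<theta> ` ball 0 1" using V(2) by blast
    moreover have "H z \<in> \<theta> ` ball 0 1" using h(2) by (metis centre_in_ball imageI zero_less_one)
    then have "z \<in> V" using V(2) z by blast
    ultimately show ?thesis using V(1) unfolding \<C>_def by blast
  qed
  then have sub: "X \<times> {0..1} \<subseteq> \<Union>\<C>" by blast
  obtain d where d: "d > 0" and leb: "\<And>z. z \<in> X \<times> {0..1} \<Longrightarrow> \<exists>V\<in>\<C>. ball z d \<subseteq> V"
    by (rule Heine_Borel_lemma[OF compact_Times[OF X compact_Icc] sub], (simp add: \<C>_def; fail), rule that; assumption)
  have small: "\<exists>A. chart_ball A \<and> H ` (ball z d \<inter> X \<times> {0..1}) \<subseteq> A" if "z \<in> X \<times> {0..1}" for z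
  proof -
    from leb[OF that] obtain V A where "ball z d \<subseteq> V" "chart_ball A" "H ` (V \<inter> X \<times> {0..1}) \<subseteq> A"
      by (auto simp: \<C>_def)
    then show ?thesis by (intro exI[of _ A]) blast
  qed
  define r where "r = d / 4"
  have r: "r > 0" using d by (simp add: r_def)
  have "X \<subseteq> (\<Union>x\<in>X. ball x (r/2))" using r by force
  then obtain Y where Y: "Y \<subseteq> X" "finite Y" "X \<subseteq> (\<Union>x\<in>Y. ball x (r/2))"
    by (rule compactE_image[OF X, rotated]) auto
  obtain ys where ys: "set ys = Y" using Y(2) finite_list by blast
  \<comment> \<open>\<open>M zs\<close> is \<open>1\<close> near the points of \<open>zs\<close>, so \<open>\<tau> zs\<close> below is a clock already advanced near these points.\<close>
  define \<mu> where "\<mu> y x = max 0 (min 1 (2 - 2 * dist x y / r))" for x y :: 'x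
  define M where "M zs x = foldr (\<lambda>y s. max (\<mu> y x) s) zs 0" for zs x
  have M_simps: "M [] x = 0" "M (z # zs) x = max (\<mu> z x) (M zs x)" for z zs x by (simp_all add: M_def)
  have cM: "continuous_on X (M zs)" for zs
    by (induction zs) (use r in \<open>auto simp: M_simps \<mu>_def[abs_def] intro!: continuous_intros\<close>)
  have M01: "0 \<le> M zs x \<and> M zs x \<le> 1" for zs x
    by (induction zs) (auto simp: M_simps \<mu>_def)
  have M1: "M zs x = 1" if "y \<in> set zs" "dist x y < r/2" for zs x y
    using that(1)
  proof (induction zs)
    case (Cons z zs)
    have "\<mu> y x = 1" using that(2) r by (auto simp: \<mu>_def field_simps)
    moreover have "\<mu> z x \<le> 1" by (simp add: \<mu>_def)
    ultimately show ?case using Cons M01[of zs x] by (auto simp: M_simps)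
  qed simp
  have step: "moves X T (\<lambda>x. H (x, a)) (\<lambda>x. H (x, b))" if ab: "0 \<le> a" "a \<le> b" "b \<le> 1" "b - a < d/2" for a b
  proof -
    define \<tau> where "\<tau> zs x = a + (b - a) * M zs x" for zs x
    have \<tau>ab: "a \<le> \<tau> zs x \<and> \<tau> zs x \<le> b" for zs x
      using M01[of zs x] ab mult_left_le[of "M zs x" "b - a"] by (auto simp: \<tau>_def)
    have \<tau>01: "\<tau> zs x \<in> {0..1}" for zs x using \<tau>ab[of zs x] ab by auto
    have c\<tau>: "continuous_on X (\<lambda>x. H (x, \<tau> zs x))" for zs
      by (rule continuous_on_compose2[OF H(1)], unfold \<tau>_def, intro continuous_intros cM)
         (use \<tau>01[unfolded \<tau>_def] in auto)
    have "moves X T (\<lambda>x. H (x, a)) (\<lambda>x. H (x, \<tau> zs x))" if "set zs \<subseteq> X" for zs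
      using that
    proof (induction zs)
      case Nil
      then show ?case by (simp add: \<tau>_def M_simps moves_refl)
    next
      case (Cons z zs)
      then obtain A where A: "chart_ball A" "H ` (ball (z, a) d \<inter> X \<times> {0..1}) \<subseteq> A"
        using small[of "(z, a)"] ab by auto
      then obtain U \<theta> \<theta>' where U: "openin (top_of_set T) U" "homeomorphism (UNIV::'e set) U \<theta> \<theta>'"
        "A = \<theta> ` ball 0 1" by (auto simp: chart_ball_def)
      have inA: "H (x, \<tau> ws x) \<in> A" if "x \<in> X" "dist x z \<le> r" for x ws
      proof -
        have "dist (z, a) (x, \<tau> ws x) \<le> dist z x + dist a (\<tau> ws x)"
          using sqrt_sum_squares_le_sum[of "dist z x" "dist a (\<tau> ws x)"] by (simp add: dist_Pair_Pair)
        also have "\<dots> < d" using that(2) \<tau>ab[of ws x] ab d by (simp add: r_def dist_commute dist_real_def)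
        finally have "(x, \<tau> ws x) \<in> ball (z, a) d \<inter> X \<times> {0..1}"
          using that(1) \<tau>ab[of ws x] ab by auto
        then show ?thesis using A(2) by blast
      qed
      have "moves X T (\<lambda>x. H (x, \<tau> zs x)) (\<lambda>x. H (x, \<tau> (z # zs) x))"
      proof (rule moves_local[OF U(1,2), where C = "{x\<in>X. dist x z \<le> r}" and C' = "{x\<in>X. r \<le> dist x z}"])
        show "closedin (top_of_set X) {x \<in> X. dist x z \<le> r}" "closedin (top_of_set X) {x \<in> X. r \<le> dist x z}"
          by (intro closedin_Collect_le continuous_intros)+
        show "(\<lambda>x. H (x, \<tau> zs x)) ` X \<subseteq> T" using H(2) \<tau>01 by blast
        show "H (x, \<tau> zs x) = H (x, \<tau> (z # zs) x)" if "x \<in> {x \<in> X. r \<le> dist x z}" for x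
        proof -
          have "\<mu> z x = 0" using that r by (auto simp: \<mu>_def field_simps)
          then show ?thesis using M01[of zs x] by (simp add: \<tau>_def M_simps)
        qed
      qed (use c\<tau> inA U(3) in auto)
      then show ?case using Cons moves_trans by auto
    qed
    from this[of ys] have "moves X T (\<lambda>x. H (x, a)) (\<lambda>x. H (x, \<tau> ys x))" using ys Y(1) by auto
    moreover have "\<tau> ys x = b" if "x \<in> X" for x
    proof -
      from that Y(3) obtain y where "y \<in> Y" "dist x y < r/2" by (auto simp: dist_commute)
      then show ?thesis using M1[of y ys x] ys by (simp add: \<tau>_def)
    qed
    ultimately show ?thesis by (auto simp: moves_def)
  qed
  obtain k :: nat where k: "k > 0" "1 / real k < d / 2"
    using real_arch_inverse[of "d/2"] d by (auto simp: inverse_eq_divide)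
  have "moves X T (\<lambda>x. H (x, 0)) (\<lambda>x. H (x, real i / real k))" if "i \<le> k" for i
    using that
  proof (induction i)
    case 0
    then show ?case by (simp add: moves_refl)
  next
    case (Suc i)
    have "moves X T (\<lambda>x. H (x, real i / real k)) (\<lambda>x. H (x, real (Suc i) / real k))"
      using Suc k by (intro step) (auto simp: divide_simps)
    then show ?case using Suc moves_trans by auto
  qed
  from this[of k] k show ?thesis by simp
qed


section \<open>Complements of points in a manifold\<close>

lemma locally_euclidean_path_connected:
  fixes T :: "'w::metric_space set"
  assumes LE: "locally_euclidean TYPE('e::euclidean_space) T" and T: "connected T"
  shows "path_connected T"
  unfolding path_connected_component
proof (intro ballI)
  fix a b assume ab: "a \<in> T" "b \<in> T"
  show "path_component T a b"
  proof (rule connected_equivalence_relation[OF T ab, where R = "path_component T"])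
    fix p assume "p \<in> T"
    then obtain U \<theta> \<theta>' where U: "openin (top_of_set T) U" "p \<in> U"
      and h: "homeomorphism (UNIV::'e set) U \<theta> \<theta>'" "\<theta> 0 = p"
      by (rule locally_euclidean_chart[OF LE])
    have "path_connected U"
      using h(1) homeomorphic_path_connectedness homeomorphic_def path_connected_UNIV by metis
    then have "path_component T p x" if "x \<in> U" for x
      using U that unfolding path_connected_component
      by (meson openin_imp_subset path_component_of_subset)
    with U show "\<exists>V. openin (top_of_set T) V \<and> p \<in> V \<and> (\<forall>x\<in>V. path_component T p x)" by blast
  qed (auto intro: path_component_sym path_component_trans)
qed

text \<open>Follow a path towards the removed point until shortly before it first arrives there: by then
  it has entered the chart, and a punctured chart of dimension at least two is path-connected.\<close>

lemma path_connected_minus_point: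
  fixes T :: "'w::metric_space set"
  assumes LE: "locally_euclidean TYPE('e::euclidean_space) T" and T: "path_connected T"
    and dim: "2 \<le> DIM('e)"
  shows "path_connected (T - {p})"
proof (cases "p \<in> T")
  case False
  with T show ?thesis by simp
next
  case True
  then obtain U \<theta> \<theta>' where U: "openin (top_of_set T) U" "p \<in> U"
    and h: "homeomorphism (UNIV::'e set) U \<theta> \<theta>'" "\<theta> 0 = p"
    by (rule locally_euclidean_chart[OF LE])
  have UT: "U \<subseteq> T" using U openin_imp_subset by blast
  have "continuous_on (- {0}) \<theta>" using h continuous_on_subset by (auto simp: homeomorphism_def)
  then have "path_connected (\<theta> ` (- {0}))"
    by (intro path_connected_continuous_image path_connected_punctured_universe dim)
  moreover have "\<theta> ` (- {0}) = U - {p}"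
  proof -
    have "inj \<theta>" using h(1) by (metis homeomorphism_def injI UNIV_I)
    moreover have "range \<theta> = U" using h(1) by (simp add: homeomorphism_def)
    ultimately show ?thesis
      using h(2) image_set_diff[of \<theta> UNIV "{0}"] by (simp add: Compl_eq_Diff_UNIV)
  qed
  ultimately have pcU: "path_component (T - {p}) b c" if "b \<in> U - {p}" "c \<in> U - {p}" for b c
    using that UT unfolding path_connected_component
    by (metis Diff_mono order_refl path_component_of_subset)
  have reach: "\<exists>b\<in>U - {p}. path_component (T - {p}) a b" if a: "a \<in> T - {p}" for a
  proof -
    obtain g where g: "path g" "path_image g \<subseteq> T" "pathstart g = a" "pathfinish g = p"
      using T True a unfolding path_connected_def by blast
    have cg: "continuous_on {0..1} g" using g(1) by (simp add: path_def)
    have gT: "g ` {0..1} \<subseteq> T" using g(2) by (simp add: path_image_def)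
    let ?Z = "{t \<in> {0..1}. g t = p}"
    have "?Z = {0..1} \<inter> g -` {p}" by auto
    then have "closedin (top_of_set {0..1}) ?Z"
      using continuous_closedin_preimage[OF cg, of "{p}"] by simp
    then have "compact ?Z" using closedin_compact compact_Icc by blast
    moreover have "1 \<in> ?Z" using g(4) by (simp add: pathfinish_def)
    ultimately obtain t0 where t0: "t0 \<in> ?Z" "\<And>t. t \<in> ?Z \<Longrightarrow> t0 \<le> t"
      using compact_attains_inf[of ?Z] by blast
    have "t0 > 0" using t0(1) g(3) a by (cases "t0 = 0") (auto simp: pathstart_def)
    have "openin (top_of_set {0..1}) ({0..1} \<inter> g -` U)"
      using continuous_openin_preimage[OF cg _ U(1)] gT by auto
    then obtain e where e: "e > 0" "\<And>t. t \<in> {0..1} \<Longrightarrow> dist t t0 < e \<Longrightarrow> g t \<in> U"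
    proof -
      have "t0 \<in> {0..1} \<inter> g -` U" using t0(1) U(2) by simp
      with \<open>openin (top_of_set {0..1}) ({0..1} \<inter> g -` U)\<close>
      obtain e where "e > 0" "\<forall>t\<in>{0..1}. dist t t0 < e \<longrightarrow> t \<in> {0..1} \<inter> g -` U"
        unfolding openin_euclidean_subtopology_iff by blast
      then show thesis by (intro that[of e]) auto
    qed
    define s where "s = max 0 (t0 - e/2)"
    have s: "0 \<le> s" "s < t0" "dist s t0 < e" "s \<in> {0..1}"
      using \<open>t0 > 0\<close> e(1) t0(1) by (auto simp: s_def dist_real_def max_def abs_if)
    have ne: "g t \<noteq> p" if "t \<in> {0..s}" for t using t0 s that by force
    have s01: "s * t \<in> {0..1}" if "t \<in> {0..1}" for t using that s(4) by (auto simp: mult_le_one)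
    have s0s: "s * t \<in> {0..s}" if "t \<in> {0..1}" for t
      using that s(1) by (auto simp: mult_left_le)
    have "path (\<lambda>t. g (s * t))"
      unfolding path_def by (intro continuous_on_compose2[OF cg] continuous_intros) (use s01 in auto)
    moreover have "path_image (\<lambda>t. g (s * t)) \<subseteq> T - {p}"
      using s01 ne[OF s0s] gT by (auto simp: path_image_def image_subset_iff)
    ultimately have "path_component (T - {p}) a (g s)"
      unfolding path_component_def using g(3)
      by (intro exI[of _ "\<lambda>t. g (s * t)"]) (auto simp: pathstart_def pathfinish_def)
    moreover have "g s \<in> U - {p}" using e(2)[OF s(4,3)] ne[of s] s(1) by auto
    ultimately show ?thesis by blast
  qed
  show ?thesis
    unfolding path_connected_component
    using reach pcU by (meson path_component_sym path_component_trans)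
qed

text \<open>The map \<open>k\<close> of the proof turns \<open>y\<close> into \<open>- a\<close> while \<open>norm y\<close> grows from \<open>1/2\<close> to \<open>3/2\<close>. The
  segment from \<open>y\<close> to \<open>- a\<close> meets the origin only if \<open>y\<close> is a positive multiple of \<open>a\<close>, and
  with the chosen speed it is there at the right moment only for \<open>y = a\<close>. So \<open>k\<close> has no zeros
  besides \<open>0\<close> and \<open>a\<close>; shrinking its values radially into the ball of radius \<open>\<eta>\<close> leaves
  the points near the origin fixed.\<close>

lemma pinch_euclidean:
  fixes a :: "'e::euclidean_space"
  assumes a: "norm a = 1" and \<eta>: "0 < \<eta>"
  obtains \<rho> :: "'e \<Rightarrow> 'e" and c where "continuous_on (- {0, a}) \<rho>"
    "\<And>y. y \<notin> {0, a} \<Longrightarrow> \<rho> y \<in> cball 0 \<eta> - {0}"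
    "\<And>y. norm y \<le> 1/2 \<Longrightarrow> norm y \<le> \<eta> \<Longrightarrow> \<rho> y = y"
    "\<And>y. 3/2 \<le> norm y \<Longrightarrow> \<rho> y = c" "c \<in> cball 0 \<eta> - {0}"
proof -
  define \<xi> where "\<xi> y = max 0 (min 1 (norm y - 1/2))" for y :: 'e
  define k where "k y = (1 - \<xi> y) *\<^sub>R y - \<xi> y *\<^sub>R a" for y
  define s where "s v = min 1 (\<eta> / norm v) *\<^sub>R v" for v :: 'e
  have k0: "k y \<noteq> 0" if "y \<notin> {0, a}" for y
  proof
    assume "k y = 0"
    then have eq: "(1 - \<xi> y) *\<^sub>R y = \<xi> y *\<^sub>R a" by (simp add: k_def)
    have \<xi>01: "0 \<le> \<xi> y" "\<xi> y \<le> 1" by (auto simp: \<xi>_def)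
    from arg_cong[OF eq, of norm] have "\<bar>1 - \<xi> y\<bar> * norm y = \<bar>\<xi> y\<bar>"
      by (simp only: norm_scaleR a mult_1_right)
    then have n: "(1 - \<xi> y) * norm y = \<xi> y" using \<xi>01 by simp
    consider "norm y \<le> 1/2" | "norm y \<ge> 3/2" | "1/2 < norm y" "norm y < 3/2" by linarith
    then show False
    proof cases
      case 1
      then have "\<xi> y = 0" by (simp add: \<xi>_def)
      with eq that show False by simp
    next
      case 2
      then have "\<xi> y = 1" by (simp add: \<xi>_def)
      with n show False by simp
    next
      case 3
      then have \<xi>: "\<xi> y = norm y - 1/2" by (simp add: \<xi>_def)
      from n have "(1 - (norm y - 1/2)) * norm y = norm y - 1/2" unfolding \<xi> .
      moreover have "(t - 1) * (t + 1/2) = (t - 1/2) - (1 - (t - 1/2)) * t" for t :: real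
        by (simp add: field_simps)
      ultimately have "(norm y - 1) * (norm y + 1/2) = 0" by simp
      then have "norm y = 1" using 3 by auto
      with \<xi> have "\<xi> y = 1/2" by simp
      with eq that show False by simp
    qed
  qed
  have sball: "s v \<in> cball 0 \<eta> - {0}" if "v \<noteq> 0" for v
    using that \<eta> by (auto simp: s_def min_def field_simps)
  show ?thesis
  proof (rule that[of "s \<circ> k" "s (- a)"])
    show "continuous_on (- {0, a}) (s \<circ> k)"
      unfolding s_def k_def \<xi>_def o_def
      by (intro continuous_intros) (use k0 in \<open>auto simp: k_def \<xi>_def\<close>)
    show "(s \<circ> k) y \<in> cball 0 \<eta> - {0}" if "y \<notin> {0, a}" for y
      using sball[OF k0[OF that]] by simp
    show "(s \<circ> k) y = y" if "norm y \<le> 1/2" "norm y \<le> \<eta>" for y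
    proof -
      have "\<xi> y = 0" using that by (simp add: \<xi>_def)
      then show ?thesis using that by (cases "y = 0") (auto simp: k_def s_def min_def field_simps)
    qed
    show "(s \<circ> k) y = s (- a)" if "3/2 \<le> norm y" for y
    proof -
      have "\<xi> y = 1" using that by (simp add: \<xi>_def)
      then show ?thesis by (simp add: k_def)
    qed
    show "s (- a) \<in> cball 0 \<eta> - {0}" using a by (intro sball) auto
  qed
qed

text \<open>The homotopy retraction of \<open>T - {p, q}\<close> to a small sphere around \<open>p\<close>. If \<open>q\<close> lies next to
  \<open>p\<close> in a chart, it is given by the previous lemma, continued by a constant outside the
  chart. In general a homeomorphism of \<open>T\<close>, fixed near \<open>p\<close>, first moves \<open>q\<close> there; it exists
  as \<open>T - {p}\<close> is path-connected.\<close>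

lemma pinch:
  fixes T :: "'w::metric_space set"
  assumes LE: "locally_euclidean TYPE('e::euclidean_space) T" and T: "path_connected T"
    and dim: "2 \<le> DIM('e)" and pq: "p \<in> T" "q \<in> T" "p \<noteq> q" and V: "open V" "p \<in> V"
  obtains \<rho> W where "openin (top_of_set T) W" "p \<in> W" "continuous_on (T - {p, q}) \<rho>"
    "\<And>y. y \<in> T - {p, q} \<Longrightarrow> \<rho> y \<in> T \<inter> V - {p}" "\<And>y. y \<in> W - {p} \<Longrightarrow> \<rho> y = y"
proof -
  obtain U \<theta> \<theta>' where U: "openin (top_of_set T) U" "p \<in> U"
    and h: "homeomorphism (UNIV::'e set) U \<theta> \<theta>'" "\<theta> 0 = p"
    by (rule locally_euclidean_chart[OF LE pq(1)])
  have UT: "U \<subseteq> T" using U openin_imp_subset by blast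
  have \<theta>[simp]: "\<theta>' (\<theta> y) = y" "\<theta> y \<in> U" for y using h by (auto simp: homeomorphism_def)
  have \<theta>'[simp]: "y \<in> U \<Longrightarrow> \<theta> (\<theta>' y) = y" for y using h by (auto simp: homeomorphism_def)
  have c\<theta>: "continuous_on X \<theta>" for X
    using h continuous_on_subset by (auto simp: homeomorphism_def)
  have c\<theta>': "continuous_on U \<theta>'" using h by (auto simp: homeomorphism_def)
  have inj: "\<theta> x = \<theta> y \<longleftrightarrow> x = y" for x y by (metis \<theta>(1))
  have "open (\<theta> -` V)" using c\<theta>[of UNIV] V(1) by (simp add: continuous_on_open_vimage)
  then obtain r where r: "r > 0" "ball 0 r \<subseteq> \<theta> -` V"
    using V(2) h(2) by (metis openE vimage_eq)
  define \<eta> where "\<eta> = r / 2"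
  have \<eta>: "\<eta> > 0" using r by (simp add: \<eta>_def)
  have \<eta>V: "\<theta> y \<in> V" if "y \<in> cball 0 \<eta>" for y
    using r that by (auto simp: \<eta>_def subset_iff)
  obtain a :: 'e where a: "a \<in> Basis" using nonempty_Basis by blast
  then have na: "norm a = 1" by simp
  obtain k :: "'e \<Rightarrow> 'e" and c where k: "continuous_on (- {0, a}) k"
    "\<And>y. y \<notin> {0, a} \<Longrightarrow> k y \<in> cball 0 \<eta> - {0}"
    "\<And>y. norm y \<le> 1/2 \<Longrightarrow> norm y \<le> \<eta> \<Longrightarrow> k y = y"
    "\<And>y. 3/2 \<le> norm y \<Longrightarrow> k y = c" "c \<in> cball 0 \<eta> - {0}"
    by (rule pinch_euclidean[OF na \<eta>], rule that; assumption)
  define p' where "p' = \<theta> a"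
  have p': "p' \<in> T - {p}" using UT h(2) inj[of a 0] a by (auto simp: p'_def)
  define \<rho>0 where "\<rho>0 y = (if y \<in> U then \<theta> (k (\<theta>' y)) else \<theta> c)" for y
  have c\<rho>0: "continuous_on (T - {p, p'}) \<rho>0"
  proof (rule continuous_on_paste_open)
    show "openin (top_of_set (T - {p, p'})) (U - {p, p'})"
      using U(1) unfolding openin_open by blast
    have "compact (\<theta> ` cball 0 (3/2))" by (intro compact_continuous_image c\<theta>) auto
    then show "openin (top_of_set (T - {p, p'})) (T - {p, p'} - \<theta> ` cball 0 (3/2))"
      using compact_imp_closed by (auto simp: openin_open intro!: exI[of _ "- \<theta> ` cball 0 (3/2)"])
    show "T - {p, p'} \<subseteq> U - {p, p'} \<union> (T - {p, p'} - \<theta> ` cball 0 (3/2))" by auto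
    have "\<theta>' y \<notin> {0, a}" if "y \<in> U - {p, p'}" for y
      using that h(2) p'_def by (metis DiffD1 DiffD2 \<theta>' insert_iff singletonD)
    then show "continuous_on (U - {p, p'}) (\<lambda>y. \<theta> (k (\<theta>' y)))"
      by (intro continuous_on_compose2[OF c\<theta>[of UNIV]] continuous_on_compose2[OF k(1)]
            continuous_on_subset[OF c\<theta>']) auto
    show "continuous_on (T - {p, p'} - \<theta> ` cball 0 (3/2)) (\<lambda>_. \<theta> c)" by simp
    show "\<rho>0 y = \<theta> (k (\<theta>' y))" if "y \<in> U - {p, p'}" for y using that by (simp add: \<rho>0_def)
    show "\<rho>0 y = \<theta> c" if y: "y \<in> T - {p, p'} - \<theta> ` cball 0 (3/2)" for y
    proof (cases "y \<in> U")
      case True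
      then have "\<theta>' y \<notin> cball 0 (3/2)" using y by (metis DiffD2 \<theta>' imageI)
      then show ?thesis using k(4)[of "\<theta>' y"] True by (simp add: \<rho>0_def)
    qed (simp add: \<rho>0_def)
  qed
  have \<rho>0: "\<rho>0 y \<in> T \<inter> V - {p}" if y: "y \<in> T - {p, p'}" for y
  proof -
    have *: "\<theta> z \<in> T \<inter> V - {p}" if "z \<in> cball 0 \<eta> - {0}" for z
      using that \<eta>V[of z] UT h(2) inj[of z 0] by auto
    show ?thesis
    proof (cases "y \<in> U")
      case True
      then have "\<theta>' y \<notin> {0, a}" using y h(2) p'_def by (metis DiffD2 \<theta>' insert_iff singletonD)
      then show ?thesis using *[OF k(2)] True by (simp add: \<rho>0_def)
    qed (use *[OF k(5)] in \<open>simp add: \<rho>0_def\<close>)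
  qed
  \<comment> \<open>As the support of the homeomorphism moving \<open>p'\<close> to \<open>q\<close> is compact in \<open>T - {p}\<close>, it is fixed near \<open>p\<close>.\<close>
  have LE': "locally_euclidean TYPE('e) (T - {p})"
    by (rule locally_euclidean_openin[OF LE]) (simp add: openin_delete)
  obtain \<gamma> where \<gamma>: "path \<gamma>" "path_image \<gamma> \<subseteq> T - {p}" "pathstart \<gamma> = p'" "pathfinish \<gamma> = q"
    using path_connected_minus_point[OF LE T dim, of p] p' pq unfolding path_connected_def by blast
  have "moves {0::real} (T - {p}) (\<lambda>x. (\<gamma> \<circ> snd) (x, 0)) (\<lambda>x. (\<gamma> \<circ> snd) (x, 1))"
    by (rule moves_homotopy[OF LE'])
       (use \<gamma> in \<open>auto simp: path_def path_image_def
          intro!: continuous_intros continuous_on_compose2[of "{0..1}" \<gamma>]\<close>)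
  then have "moves {0::real} (T - {p}) (\<lambda>x. p') (\<lambda>x. q)"
    using \<gamma> by (simp add: pathstart_def pathfinish_def)
  then obtain K \<Phi> \<Psi> where m: "homeo_family {0::real} (T - {p}) K \<Phi> \<Psi>"
    and \<Phi>p': "\<forall>x\<in>{0::real}. \<Phi> (x, p') = q"
    by (rule movesE)
  note hm = homeo_familyD[OF m]
  have \<Psi>: "\<Psi> (0, y) \<in> T - {p, p'}" if y: "y \<in> T - {p, q}" for y
  proof -
    have "\<Psi> (0, y) \<in> T - {p}" "\<Phi> (0, \<Psi> (0, y)) = y" using hm(6,7) y by auto
    moreover from this have "\<Psi> (0, y) \<noteq> p'" using \<Phi>p' y by auto
    ultimately show ?thesis by auto
  qed
  define W where "W = \<theta> ` ball 0 (min \<eta> (1/2)) - K"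
  show ?thesis
  proof (rule that[of W "\<lambda>y. \<rho>0 (\<Psi> (0, y))"])
    have "openin (top_of_set U) (\<theta> ` ball 0 (min \<eta> (1/2)))"
      using homeomorphism_imp_open_map[OF h(1), of "ball 0 (min \<eta> (1/2))"] by simp
    then have "openin (top_of_set T) (\<theta> ` ball 0 (min \<eta> (1/2)))"
      using U(1) by (metis openin_trans)
    moreover have "closedin (top_of_set T) K"
      using hm(1,2) by (intro closed_subset compact_imp_closed) auto
    ultimately show "openin (top_of_set T) W" unfolding W_def by (rule openin_diff)
    show "p \<in> W" using hm(2) h(2) \<eta> by (force simp: W_def)
    show "continuous_on (T - {p, q}) (\<lambda>y. \<rho>0 (\<Psi> (0, y)))"
      by (intro continuous_on_compose2[OF c\<rho>0] continuous_on_compose2[OF hm(4)] continuous_intros)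
         (use \<Psi> in auto)
    show "\<rho>0 (\<Psi> (0, y)) \<in> T \<inter> V - {p}" if "y \<in> T - {p, q}" for y
      by (rule \<rho>0[OF \<Psi>[OF that]])
    show "\<rho>0 (\<Psi> (0, y)) = y" if y: "y \<in> W - {p}" for y
    proof -
      from y obtain z where z: "y = \<theta> z" "norm z < \<eta>" "norm z < 1/2" by (auto simp: W_def)
      have "y \<in> T" using z(1) UT \<theta>(2)[of z] by blast
      then have "\<Psi> (0, y) = y" using y hm(10)[of 0 y] by (auto simp: W_def)
      then show ?thesis using z k(3)[of z] by (simp add: \<rho>0_def)
    qed
  qed
qed


section \<open>Pushing a map off itself\<close>

text \<open>A continuous choice of paths between any two points that is constant on the diagonal. It
  yields contractions to every point, homotopies between any two paths with the same ends, and
  short paths between nearby points; convex sets, charts and discs all have one.\<close>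

definition equiconnecting :: "'x::metric_space set \<Rightarrow> ('x \<times> 'x \<times> real \<Rightarrow> 'x) \<Rightarrow> bool" where
  "equiconnecting X l \<longleftrightarrow> continuous_on (X \<times> X \<times> {0..1}) l \<and>
     (\<forall>x\<in>X. \<forall>y\<in>X. l (x, y, 0) = x \<and> l (x, y, 1) = y \<and>
        (\<forall>t\<in>{0..1}. l (x, y, t) \<in> X \<and> l (x, x, t) = x))"

lemma locally_euclidean_not_isolated:
  fixes T :: "'w::metric_space set"
  assumes LE: "locally_euclidean TYPE('e::euclidean_space) T" and p: "p \<in> T" and d: "0 < d"
  obtains u where "u \<in> T" "u \<noteq> p" "dist p u < d"
proof -
  obtain U \<theta> \<theta>' where U: "openin (top_of_set T) U" "p \<in> U"
    and h: "homeomorphism (UNIV::'e set) U \<theta> \<theta>'" "\<theta> 0 = p"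
    by (rule locally_euclidean_chart[OF LE p])
  have UT: "U \<subseteq> T" using U openin_imp_subset by blast
  have "continuous_on UNIV \<theta>" using h by (simp add: homeomorphism_def)
  then obtain e where e: "e > 0" "\<And>z. dist z 0 < e \<Longrightarrow> dist (\<theta> z) p < d"
    using d h(2) unfolding continuous_on_iff by (metis UNIV_I)
  obtain a :: 'e where a: "a \<in> Basis" using nonempty_Basis by blast
  let ?z = "(e/2) *\<^sub>R a"
  have "?z \<noteq> 0" using a e(1) by auto
  then have "\<theta> ?z \<noteq> p" using h by (metis UNIV_I homeomorphism_apply1)
  moreover have "\<theta> ?z \<in> T" using h(1) UT by (auto simp: homeomorphism_def)
  moreover have "dist p (\<theta> ?z) < d" using e a by (subst dist_commute) (intro e(2), simp)
  ultimately show ?thesis using that by blast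
qed

text \<open>The argument is the one given at the beginning. The function \<open>h\<close> describes a collar: the
  maps are constant on the set where \<open>0 \<le> h x\<close>, and \<open>s\<close> is constant where \<open>1 \<le> h x\<close>.
  The part of the collar between these sets is used to move the value \<open>r\<close> of the third map to
  a point \<open>u\<close> near \<open>p\<close>.\<close>

lemma push_off_from_three_disjoint:
  fixes T :: "'w::metric_space set" and X :: "'x::metric_space set" and h :: "'x \<Rightarrow> real"
  assumes LE: "locally_euclidean TYPE('e::euclidean_space) T" and T: "connected T"
    and X: "compact X" "equiconnecting X l"
    and F: "continuous_on X F1" "continuous_on X F2" "continuous_on X F3"
    and FT: "\<And>x. x \<in> X \<Longrightarrow> F1 x \<in> T \<and> F2 x \<in> T \<and> F3 x \<in> T"
    and disj: "\<And>x. x \<in> X \<Longrightarrow> F1 x \<noteq> F2 x \<and> F1 x \<noteq> F3 x \<and> F2 x \<noteq> F3 x"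
    and h: "continuous_on X h" "connected {x \<in> X. 0 \<le> h x}"
    and collar: "\<And>x. x \<in> X \<Longrightarrow> 0 \<le> h x \<Longrightarrow> F1 x = p \<and> F2 x = q \<and> F3 x = r"
    and x0: "x0 \<in> X" "0 \<le> h x0" and \<epsilon>: "0 < \<epsilon>"
  obtains s u where "continuous_on X s"
    "\<And>x. x \<in> X \<Longrightarrow> s x \<in> T \<and> s x \<noteq> F1 x \<and> dist (s x) (F1 x) < \<epsilon>"
    "\<And>x. x \<in> X \<Longrightarrow> 1 \<le> h x \<Longrightarrow> s x = u"
proof -
  note lD = X(2)[unfolded equiconnecting_def]
  have pT: "p \<in> T" "q \<in> T" "r \<in> T" and pqr: "p \<noteq> q" "p \<noteq> r" "q \<noteq> r"
    using FT[OF x0(1)] disj[OF x0(1)] collar[OF x0] by auto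
  define C where "C = {x \<in> X. 0 \<le> h x}"
  define N where "N = {x \<in> X. h x \<le> 0}"
  have CN: "closedin (top_of_set X) C" "closedin (top_of_set X) N" "X \<subseteq> N \<union> C" "C \<subseteq> X" "N \<subseteq> X"
    unfolding C_def N_def
    using closedin_Collect_le[OF continuous_on_const h(1), of 0]
      closedin_Collect_le[OF h(1) continuous_on_const, of 0] by auto
  have compC: "compact C" using CN(1) X(1) closedin_compact by blast
  have moves_from: "moves X S (\<lambda>x. G x0) G"
    if "locally_euclidean TYPE('e) S" "continuous_on X G" "G ` X \<subseteq> S" for S :: "'w set" and G
  proof -
    let ?H = "\<lambda>z. G (l (x0, fst z, snd z))"
    have "continuous_on (X \<times> {0..1}) ?H"
      by (intro continuous_on_compose2[OF that(2)] continuous_on_compose2[OF conjunct1[OF lD]] continuous_intros)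
         (use lD x0 in auto)
    moreover have "?H ` (X \<times> {0..1}) \<subseteq> S" using that(3) lD x0 by auto
    ultimately have "moves X S (\<lambda>x. ?H (x, 0)) (\<lambda>x. ?H (x, 1))"
      by (rule moves_homotopy[OF that(1) X(1)])
    moreover have "G (l (x0, x, 0)) = G x0" "G (l (x0, x, 1)) = G x" if "x \<in> X" for x
      using lD x0 that by auto
    ultimately show ?thesis by (auto simp: moves_def)
  qed
  have "moves X T (\<lambda>x. F1 x0) F1" by (rule moves_from[OF LE F(1)]) (use FT in auto)
  moreover have "F1 x0 = p" using collar x0 by simp
  ultimately obtain K1 \<Phi>1 \<Psi>1 where m1: "homeo_family X T K1 \<Phi>1 \<Psi>1" and \<Phi>1p: "\<forall>x\<in>X. \<Phi>1 (x, p) = F1 x"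
    by (auto elim: movesE)
  note hm1 = homeo_familyD[OF m1]
  have \<Psi>1F1: "\<Psi>1 (x, F1 x) = p" if "x \<in> X" for x
    using hm1(8)[OF that pT(1)] \<Phi>1p that by simp
  have \<Psi>1_inj: "\<Psi>1 (x, y) \<noteq> \<Psi>1 (x, z)" if "x \<in> X" "y \<in> T" "z \<in> T" "y \<noteq> z" for x y z
    using hm1(7)[OF that(1,2)] hm1(7)[OF that(1,3)] that(4) by metis
  have \<Psi>1p: "\<Psi>1 (x, p) = p" if "x \<in> C" for x
    using \<Psi>1F1[of x] collar[of x] that by (simp add: C_def)
  have Xp: "compact (X \<times> {p})" "X \<times> {p} \<subseteq> X \<times> T" using pT by (auto intro: compact_Times X)
  obtain d where d: "d > 0" "\<And>k z. k \<in> X \<times> {p} \<Longrightarrow> z \<in> X \<times> T \<Longrightarrow> dist k z < d \<Longrightarrow> dist (\<Phi>1 k) (\<Phi>1 z) < \<epsilon>"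
    by (rule uniformly_continuous_near_compact[OF hm1(3) Xp \<epsilon>], rule that; assumption)
  have near: "dist (\<Phi>1 (x, y)) (F1 x) < \<epsilon>" if "x \<in> X" "y \<in> T \<inter> ball p d" for x y
    using d(2)[of "(x, p)" "(x, y)"] that \<Phi>1p by (auto simp: dist_Pair_Pair dist_commute)
  have pick_u: "\<exists>u. u \<in> T - {p, q} \<and> (\<forall>x\<in>C. \<Psi>1 (x, u) \<in> W - {p})"
    if W: "openin (top_of_set T) W" "p \<in> W" for W
  proof -
    obtain e where e: "e > 0" "\<And>y. y \<in> T \<Longrightarrow> dist y p < e \<Longrightarrow> y \<in> W"
      using W unfolding openin_euclidean_subtopology_iff by blast
    have Cp: "compact (C \<times> {p})" "C \<times> {p} \<subseteq> X \<times> T"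
      using CN(4) pT by (auto intro: compact_Times compC)
    obtain d where d: "d > 0" "\<And>k z. k \<in> C \<times> {p} \<Longrightarrow> z \<in> X \<times> T \<Longrightarrow> dist k z < d \<Longrightarrow> dist (\<Psi>1 k) (\<Psi>1 z) < e"
      by (rule uniformly_continuous_near_compact[OF hm1(4) Cp e(1)], rule that; assumption)
    have "min d (dist p q) > 0" using d(1) pqr by simp
    then obtain u where u: "u \<in> T" "u \<noteq> p" "dist p u < min d (dist p q)"
      using locally_euclidean_not_isolated[OF LE pT(1)] by metis
    have "\<Psi>1 (x, u) \<in> W - {p}" if x: "x \<in> C" for x
    proof -
      have "dist p (\<Psi>1 (x, u)) < e"
        using d(2)[of "(x, p)" "(x, u)"] x u \<Psi>1p[OF x] CN(4) by (auto simp: dist_Pair_Pair)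
      moreover have "\<Psi>1 (x, u) \<in> T" using hm1(6) x CN(4) u by blast
      moreover have "\<Psi>1 (x, u) \<noteq> p"
        using \<Psi>1_inj[of x u p] \<Psi>1p[OF x] x u pT CN(4) by auto
      ultimately show ?thesis using e(2) by (auto simp: dist_commute)
    qed
    with u show ?thesis by (intro exI[of _ u]) auto
  qed
  \<comment> \<open>The extension \<open>k\<close> of the boundary map into the punctured neighbourhood of \<open>p\<close>.\<close>
  have "\<exists>u k. u \<in> T \<and> continuous_on X k \<and> (\<forall>x\<in>X. k x \<in> T \<inter> ball p d - {p}) \<and> (\<forall>x\<in>X. 1 \<le> h x \<longrightarrow> k x = \<Psi>1 (x, u))"
  proof (cases "2 \<le> DIM('e)")
    case True
    have pcT: "path_connected T" by (rule locally_euclidean_path_connected[OF LE T])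
    have LE': "locally_euclidean TYPE('e) (T - {p})"
      by (rule locally_euclidean_openin[OF LE]) (simp add: openin_delete)
    have pcT': "path_connected (T - {p})" by (rule path_connected_minus_point[OF LE pcT True])
    have pcT'': "path_connected (T - {p} - {q})" by (rule path_connected_minus_point[OF LE' pcT' True])
    \<comment> \<open>In the coordinates given by \<open>\<Psi>1\<close> the first map is the constant \<open>p\<close>; in those given by \<open>\<Psi>2\<close> the second map is constant, too.\<close>
    define G where "G x = \<Psi>1 (x, F2 x)" for x
    have cG: "continuous_on X G"
      unfolding G_def by (rule continuous_on_compose2[OF hm1(4)], intro continuous_intros F) (use FT in auto)
    have GT: "G x \<in> T - {p}" if "x \<in> X" for x
    proof -
      have "F1 x \<in> T" "F2 x \<in> T" "F2 x \<noteq> F1 x" using FT[OF that] disj[OF that] by auto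
      then show ?thesis
        using hm1(6)[OF that, of "F2 x"] \<Psi>1_inj[OF that, of "F2 x" "F1 x"] \<Psi>1F1[OF that] by (simp add: G_def)
    qed
    have "moves X (T - {p}) (\<lambda>x. G x0) G" by (rule moves_from[OF LE' cG]) (use GT in auto)
    then obtain K2 \<Phi>2 \<Psi>2 where m2: "homeo_family X (T - {p}) K2 \<Phi>2 \<Psi>2" and \<Phi>2q: "\<forall>x\<in>X. \<Phi>2 (x, G x0) = G x"
      by (rule movesE)
    note hm2 = homeo_familyD[OF m2]
    obtain \<rho> W where W: "openin (top_of_set T) W" "p \<in> W" and \<rho>: "continuous_on (T - {p, G x0}) \<rho>"
      and \<rho>V: "\<forall>y\<in>T - {p, G x0}. \<rho> y \<in> T \<inter> ball p d - {p}" and \<rho>_id: "\<forall>y\<in>W - {p}. \<rho> y = y"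
    proof (rule pinch[OF LE pcT True pT(1) _ _ open_ball, of "G x0" p d])
      show "G x0 \<in> T" "p \<noteq> G x0" using GT[OF x0(1)] by auto
      show "p \<in> ball p d" using d(1) by simp
    qed (use that in blast)
    have "closedin (top_of_set T) K2" using hm2(1,2) by (intro closed_subset compact_imp_closed) auto
    then have "openin (top_of_set T) (W - K2)" using W(1) by (intro openin_diff)
    moreover have "p \<in> W - K2" using W(2) hm2(2) by auto
    ultimately obtain u where u: "u \<in> T - {p, q}" "\<And>x. x \<in> C \<Longrightarrow> \<Psi>1 (x, u) \<in> W - K2 - {p}"
      using pick_u by metis
    obtain \<gamma> where \<gamma>: "path \<gamma>" "path_image \<gamma> \<subseteq> T - {p} - {q}" "pathstart \<gamma> = r" "pathfinish \<gamma> = u"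
      using pcT'' u(1) pT pqr unfolding path_connected_def by blast
    have c\<gamma>: "continuous_on {0..1} \<gamma>" and \<gamma>T: "\<And>t. t \<in> {0..1} \<Longrightarrow> \<gamma> t \<in> T - {p} - {q}"
      using \<gamma>(1,2) unfolding path_def path_image_def by blast+
    \<comment> \<open>Third map, continued over the collar along \<open>\<gamma>\<close>.\<close>
    define F3' where "F3' x = (if h x \<le> 0 then F3 x else \<gamma> (min 1 (max 0 (h x))))" for x
    have cF3': "continuous_on X F3'"
    proof (rule continuous_on_paste_closed[OF CN(2,1,3)])
      show "continuous_on N F3" using F(3) CN(5) continuous_on_subset by blast
      show "continuous_on C (\<lambda>x. \<gamma> (min 1 (max 0 (h x))))"
        by (intro continuous_on_compose2[OF c\<gamma>] continuous_intros continuous_on_subset[OF h(1) CN(4)]) auto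
      show "F3' x = \<gamma> (min 1 (max 0 (h x)))" if "x \<in> C" for x
        using that collar[of x] \<gamma>(3) by (cases "h x = 0") (auto simp: F3'_def C_def pathstart_def)
    qed (auto simp: F3'_def N_def)
    have F3'T: "F3' x \<in> T \<and> F3' x \<noteq> F1 x \<and> F3' x \<noteq> F2 x" if x: "x \<in> X" for x
    proof (cases "h x \<le> 0")
      case True
      then show ?thesis using FT[OF x] disj[OF x] by (auto simp: F3'_def)
    next
      case False
      then show ?thesis using \<gamma>T[of "min 1 (max 0 (h x))"] collar[OF x] by (auto simp: F3'_def)
    qed
    define J where "J x = \<Psi>1 (x, F3' x)" for x
    have cJ: "continuous_on X J"
      unfolding J_def by (rule continuous_on_compose2[OF hm1(4)], intro continuous_intros cF3') (use F3'T in auto)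
    have JT: "J x \<in> T - {p}" "J x \<noteq> G x" if "x \<in> X" for x
      using FT[OF that] F3'T[OF that] hm1(6)[OF that, of "F3' x"] \<Psi>1_inj[OF that, of "F3' x" "F1 x"]
        \<Psi>1_inj[OF that, of "F3' x" "F2 x"] \<Psi>1F1[OF that]
      by (simp_all add: J_def G_def)
    define L where "L x = \<Psi>2 (x, J x)" for x
    have cL: "continuous_on X L"
      unfolding L_def by (rule continuous_on_compose2[OF hm2(4)], intro continuous_intros cJ) (use JT in auto)
    have LT: "L x \<in> T - {p, G x0}" if x: "x \<in> X" for x
    proof -
      have "L x \<in> T - {p}" unfolding L_def using hm2(6) JT(1) x by blast
      moreover have "\<Phi>2 (x, L x) = J x" unfolding L_def using hm2(7) JT(1) x by blast
      then have "L x \<noteq> G x0" using JT(2)[OF x] \<Phi>2q x by auto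
      ultimately show ?thesis by auto
    qed
    have "\<rho> (L x) = \<Psi>1 (x, u)" if x: "x \<in> X" "1 \<le> h x" for x
    proof -
      have "F3' x = u" using x \<gamma>(4) by (auto simp: F3'_def pathfinish_def)
      then have J: "J x = \<Psi>1 (x, u)" by (simp add: J_def)
      have "J x \<in> W - K2 - {p}" using u(2)[of x] x by (auto simp: J C_def)
      then have "L x = J x" "\<rho> (J x) = J x"
        using hm2(10)[of x "J x"] JT(1)[of x] x \<rho>_id by (auto simp: L_def)
      then show ?thesis using J by simp
    qed
    moreover have "continuous_on X (\<lambda>x. \<rho> (L x))"
      by (rule continuous_on_compose2[OF \<rho> cL]) (use LT in auto)
    ultimately show ?thesis using u(1) \<rho>V LT by (intro exI[of _ u] exI[of _ "\<lambda>x. \<rho> (L x)"]) auto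
  next
    case False
    obtain b :: 'e where b: "b \<in> Basis" using nonempty_Basis by blast
    have "card (Basis :: 'e set) = 1" using False DIM_positive[where 'a='e] by linarith
    then have Basis: "Basis = {b}" using b by (metis card_1_singletonE singletonD)
    have vb: "(v \<bullet> b) *\<^sub>R b = v" for v :: 'e
      using euclidean_representation[of v] by (simp add: Basis)
    have nb: "norm b = 1" using b by simp
    obtain U \<theta> \<theta>' where U: "openin (top_of_set T) U" "p \<in> U"
      and ho: "homeomorphism (UNIV::'e set) U \<theta> \<theta>'" "\<theta> 0 = p"
      by (rule locally_euclidean_chart[OF LE pT(1)])
    have UT: "U \<subseteq> T" using U openin_imp_subset by blast
    have \<theta>[simp]: "\<theta>' (\<theta> y) = y" "\<theta> y \<in> U" for y using ho by (auto simp: homeomorphism_def)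
    have \<theta>'[simp]: "y \<in> U \<Longrightarrow> \<theta> (\<theta>' y) = y" for y using ho by (auto simp: homeomorphism_def)
    have c\<theta>: "continuous_on Z \<theta>" for Z
      using ho continuous_on_subset by (auto simp: homeomorphism_def)
    have c\<theta>': "continuous_on U \<theta>'" using ho by (auto simp: homeomorphism_def)
    have "open (\<theta> -` ball p d)" using c\<theta>[of UNIV] by (simp add: continuous_on_open_vimage)
    moreover have "0 \<in> \<theta> -` ball p d" using ho(2) d(1) by simp
    ultimately obtain \<eta> where \<eta>: "\<eta> > 0" "ball 0 \<eta> \<subseteq> \<theta> -` ball p d"
      by (meson openE)
    have "openin (top_of_set U) (\<theta> ` ball 0 \<eta>)"
      using homeomorphism_imp_open_map[OF ho(1), of "ball 0 \<eta>"] by simp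
    then have "openin (top_of_set T) (\<theta> ` ball 0 \<eta>)" using U(1) by (metis openin_trans)
    moreover have "p \<in> \<theta> ` ball 0 \<eta>" using ho(2) \<eta>(1) by force
    ultimately obtain u where u: "u \<in> T - {p, q}" "\<And>x. x \<in> C \<Longrightarrow> \<Psi>1 (x, u) \<in> \<theta> ` ball 0 \<eta> - {p}"
      using pick_u by metis
    define c where "c x = \<theta>' (\<Psi>1 (x, u)) \<bullet> b" for x
    have uU: "\<Psi>1 (x, u) \<in> U" if "x \<in> C" for x using u(2)[OF that] by auto
    have c\<theta>c: "\<theta> (c x *\<^sub>R b) = \<Psi>1 (x, u)" if "x \<in> C" for x
      using uU[OF that] by (simp add: c_def vb)
    have cbd: "\<bar>c x\<bar> < \<eta>" "c x \<noteq> 0" if x: "x \<in> C" for x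
    proof -
      obtain z where z: "\<Psi>1 (x, u) = \<theta> z" "norm z < \<eta>" "\<theta> z \<noteq> p" using u(2)[OF x] by auto
      have "c x *\<^sub>R b = z" using z(1) by (simp add: c_def vb)
      then show "\<bar>c x\<bar> < \<eta>" "c x \<noteq> 0" using z(2,3) nb ho(2) by auto
    qed
    have cc: "continuous_on C c"
      unfolding c_def
      by (intro continuous_intros continuous_on_compose2[OF c\<theta>'] continuous_on_compose2[OF hm1(4)])
         (use uU CN(4) u(1) in auto)
    then have "connected (c ` C)" using h(2) unfolding C_def by (rule connected_continuous_image)
    moreover have "0 \<notin> c ` C" using cbd(2) by auto
    moreover have x0C: "x0 \<in> C" using x0 by (simp add: C_def)
    ultimately have "\<not> (c x \<le> 0 \<and> 0 \<le> c y)" if "x \<in> C" "y \<in> C" for x y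
      using that unfolding connected_iff_interval by blast
    then have sgn: "0 < c x0 * c x" if "x \<in> C" for x
      using that x0C unfolding zero_less_mult_iff by (meson linorder_not_le order_less_imp_le)
    \<comment> \<open>On the collar \<open>c\<close> has constant sign, so interpolating to a constant avoids zero.\<close>
    define v where "v x = (if h x \<le> 0 then c x0 else (1 - min 1 (max 0 (h x))) * c x0 + min 1 (max 0 (h x)) * c x)" for x
    have cv: "continuous_on X v"
    proof (rule continuous_on_paste_closed[OF CN(2,1,3)])
      show "continuous_on N (\<lambda>_. c x0)" by simp
      show "continuous_on C (\<lambda>x. (1 - min 1 (max 0 (h x))) * c x0 + min 1 (max 0 (h x)) * c x)"
        by (intro continuous_intros continuous_on_subset[OF h(1) CN(4)] cc)
    qed (auto simp: v_def N_def C_def)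
    have v: "\<bar>v x\<bar> < \<eta> \<and> v x \<noteq> 0" if x: "x \<in> X" for x
    proof (cases "h x \<le> 0")
      case True
      then show ?thesis using cbd[OF x0C] by (simp add: v_def)
    next
      case False
      then have xC: "x \<in> C" using x by (simp add: C_def)
      define w where "w = min 1 (max 0 (h x))"
      have w: "0 \<le> w" "w \<le> 1" by (auto simp: w_def)
      have vw: "v x = (1 - w) * c x0 + w * c x" using False by (simp add: v_def w_def)
      have "\<bar>v x\<bar> \<le> (1 - w) * \<bar>c x0\<bar> + w * \<bar>c x\<bar>"
        using w abs_triangle_ineq[of "(1 - w) * c x0" "w * c x"] by (simp add: vw abs_mult)
      also have "\<dots> < \<eta>"
        using cbd(1)[OF x0C] cbd(1)[OF xC] w by (intro convex_bound_lt) auto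
      finally have "\<bar>v x\<bar> < \<eta>" .
      moreover have "c x0 * v x > 0"
      proof -
        have "c x0 * v x = (1 - w) * (c x0 * c x0) + w * (c x0 * c x)" by (simp add: vw algebra_simps)
        moreover have "c x0 * c x0 > 0" using sgn[OF x0C] .
        ultimately show ?thesis using sgn[OF xC] w
          by (cases "w = 0") (auto intro: add_nonneg_pos)
      qed
      ultimately show ?thesis by auto
    qed
    have "\<theta> (v x *\<^sub>R b) \<in> T \<inter> ball p d - {p}" if x: "x \<in> X" for x
    proof -
      have "v x *\<^sub>R b \<in> ball 0 \<eta>" using v[OF x] nb by simp
      then have "\<theta> (v x *\<^sub>R b) \<in> ball p d" using \<eta>(2) by blast
      moreover have "v x *\<^sub>R b \<noteq> 0" using v[OF x] nb by auto
      then have "\<theta> (v x *\<^sub>R b) \<noteq> p" using ho(2) by (metis \<theta>(1))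
      moreover have "\<theta> (v x *\<^sub>R b) \<in> T" using UT \<theta>(2) by blast
      ultimately show ?thesis by blast
    qed
    moreover have "continuous_on X (\<lambda>x. \<theta> (v x *\<^sub>R b))"
      by (intro continuous_on_compose2[OF c\<theta>[of UNIV]] continuous_intros cv) auto
    moreover have "\<theta> (v x *\<^sub>R b) = \<Psi>1 (x, u)" if "x \<in> X" "1 \<le> h x" for x
      using that c\<theta>c[of x] by (simp add: v_def C_def)
    ultimately show ?thesis using u(1) by blast
  qed
  then obtain u k where u: "u \<in> T" and k: "continuous_on X k" "\<forall>x\<in>X. k x \<in> T \<inter> ball p d - {p}"
    "\<forall>x\<in>X. 1 \<le> h x \<longrightarrow> k x = \<Psi>1 (x, u)" by blast
  show ?thesis
  proof (rule that[of "\<lambda>x. \<Phi>1 (x, k x)" u])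
    show "continuous_on X (\<lambda>x. \<Phi>1 (x, k x))"
      by (rule continuous_on_compose2[OF hm1(3)], intro continuous_intros k) (use k in auto)
    show "\<Phi>1 (x, k x) \<in> T \<and> \<Phi>1 (x, k x) \<noteq> F1 x \<and> dist (\<Phi>1 (x, k x)) (F1 x) < \<epsilon>" if x: "x \<in> X" for x
    proof -
      have kx: "k x \<in> T" "k x \<in> T \<inter> ball p d" "k x \<noteq> p" using k(2) x by auto
      have "\<Phi>1 (x, k x) \<noteq> F1 x" using hm1(8)[OF x kx(1)] \<Psi>1F1[OF x] kx(3) by auto
      then show ?thesis using hm1(5)[OF x kx(1)] near[OF x kx(2)] by blast
    qed
    show "\<Phi>1 (x, k x) = u" if "x \<in> X" "1 \<le> h x" for x
      using k(3) that hm1(7) u by simp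
  qed
qed


section \<open>Pseudometrics and equiconnected sets\<close>

text \<open>Kuratowski's embedding \<open>x \<mapsto> d x - d a0\<close>. For a pseudometric it identifies exactly
  the points at distance zero; so the image is the quotient metric space, realised as a subset
  of a normed space. The discrete topology on the arguments makes every bounded function
  continuous.\<close>

lemma pseudometric_embedding:
  fixes d :: "'a \<Rightarrow> 'a \<Rightarrow> real"
  assumes d0: "\<And>x. x \<in> A \<Longrightarrow> d x x = 0" and sym: "\<And>x y. x \<in> A \<Longrightarrow> y \<in> A \<Longrightarrow> d x y = d y x"
    and tri: "\<And>x y z. x \<in> A \<Longrightarrow> y \<in> A \<Longrightarrow> z \<in> A \<Longrightarrow> d x z \<le> d x y + d y z"
  shows "\<exists>e :: 'a \<Rightarrow> ('a discrete \<Rightarrow>\<^sub>C real). \<forall>x\<in>A. \<forall>y\<in>A. dist (e x) (e y) = d x y"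
proof (cases "A = {}")
  case False
  then obtain a0 where a0: "a0 \<in> A" by blast
  define f where "f x a = (if of_discrete a \<in> A then d x (of_discrete a) - d a0 (of_discrete a) else 0)" for x a
  have bd: "\<bar>d x a - d y a\<bar> \<le> d x y" if "x \<in> A" "y \<in> A" "a \<in> A" for x y a
    using tri[OF that(1,2,3)] tri[OF that(2,1,3)] sym[OF that(1,2)] by linarith
  have "f x \<in> bcontfun" if "x \<in> A" for x
  proof (rule bcontfun_normI)
    show "continuous_on UNIV (f x)"
      unfolding continuous_on_open_vimage[OF open_UNIV] by (auto intro: open_discrete)
    show "norm (f x a) \<le> d x a0" for a
      using bd[OF that a0, of "of_discrete a"] bd[OF that a0 a0] by (auto simp: f_def)
  qed
  then have ap: "apply_bcontfun (Bcontfun (f x)) = f x" if "x \<in> A" for x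
    using that by (simp add: Bcontfun_inverse)
  have "dist (Bcontfun (f x)) (Bcontfun (f y)) = d x y" if xy: "x \<in> A" "y \<in> A" for x y
  proof (rule antisym)
    show "dist (Bcontfun (f x)) (Bcontfun (f y)) \<le> d x y"
    proof (rule dist_bound)
      fix a show "dist (apply_bcontfun (Bcontfun (f x)) a) (apply_bcontfun (Bcontfun (f y)) a) \<le> d x y"
        using bd[OF xy, of "of_discrete a"] bd[OF xy xy(1)]
        by (auto simp: ap xy f_def dist_real_def)
    qed
    have "d x y = dist (f x (discrete y)) (f y (discrete y))"
      using xy d0[OF xy(2)] bd[OF xy xy(1)] by (auto simp: f_def discrete_inverse dist_real_def)
    also have "\<dots> \<le> dist (Bcontfun (f x)) (Bcontfun (f y))"
      using dist_bounded[of "Bcontfun (f x)" "discrete y" "Bcontfun (f y)"] by (simp add: ap xy)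
    finally show "d x y \<le> dist (Bcontfun (f x)) (Bcontfun (f y))" .
  qed
  then show ?thesis by (intro exI[of _ "\<lambda>x. Bcontfun (f x)"]) blast
qed auto

lemma equiconnectingD:
  assumes "equiconnecting X l"
  shows "continuous_on (X \<times> X \<times> {0..1}) l"
    "\<And>x y. x \<in> X \<Longrightarrow> y \<in> X \<Longrightarrow> l (x, y, 0) = x" "\<And>x y. x \<in> X \<Longrightarrow> y \<in> X \<Longrightarrow> l (x, y, 1) = y"
    "\<And>x y t. x \<in> X \<Longrightarrow> y \<in> X \<Longrightarrow> 0 \<le> t \<Longrightarrow> t \<le> 1 \<Longrightarrow> l (x, y, t) \<in> X"
    "\<And>x t. x \<in> X \<Longrightarrow> 0 \<le> t \<Longrightarrow> t \<le> 1 \<Longrightarrow> l (x, x, t) = x"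
  using assms unfolding equiconnecting_def by auto

lemma equiconnecting_path:
  assumes l: "equiconnecting X l" and xy: "x \<in> X" "y \<in> X"
  shows "path (\<lambda>t. l (x, y, t))" "path_image (\<lambda>t. l (x, y, t)) \<subseteq> X"
    "pathstart (\<lambda>t. l (x, y, t)) = x" "pathfinish (\<lambda>t. l (x, y, t)) = y"
proof -
  show "path (\<lambda>t. l (x, y, t))"
    unfolding path_def
    by (intro continuous_on_compose2[OF equiconnectingD(1)[OF l]] continuous_intros) (use xy in auto)
qed (use equiconnectingD[OF l] xy in \<open>auto simp: path_image_def pathstart_def pathfinish_def\<close>)

lemma equiconnecting_homotopic_paths:
  assumes l: "equiconnecting X l"
    and p: "path p" "path_image p \<subseteq> X" and q: "path q" "path_image q \<subseteq> X"
    and ends: "pathstart p = pathstart q" "pathfinish p = pathfinish q"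
  shows "homotopic_paths X p q"
  unfolding homotopic_paths
proof (intro exI[of _ "\<lambda>z. l (p (snd z), q (snd z), fst z)"] conjI ballI)
  have pq: "p t \<in> X" "q t \<in> X" if "t \<in> {0..1}" for t
    using p q that by (auto simp: path_image_def)
  show "continuous_on ({0..1} \<times> {0..1}) (\<lambda>z. l (p (snd z), q (snd z), fst z))"
    by (intro continuous_on_compose2[OF equiconnectingD(1)[OF l]] continuous_intros
        continuous_on_compose2[OF p(1)[unfolded path_def]] continuous_on_compose2[OF q(1)[unfolded path_def]])
      (use pq in auto)
  show "(\<lambda>z. l (p (snd z), q (snd z), fst z)) \<in> {0..1} \<times> {0..1} \<rightarrow> X"
    using pq equiconnectingD(4)[OF l] by auto
qed (use p q ends equiconnectingD[OF l] in \<open>auto simp: path_image_def pathstart_def pathfinish_def image_subset_iff\<close>)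

lemma equiconnecting_chart:
  fixes \<theta> :: "'e::euclidean_space \<Rightarrow> 'w::metric_space"
  assumes h: "homeomorphism UNIV U \<theta> \<theta>'"
  shows "equiconnecting U (\<lambda>(x, y, t). \<theta> ((1 - t) *\<^sub>R \<theta>' x + t *\<^sub>R \<theta>' y))"
proof -
  have c: "continuous_on UNIV \<theta>" "continuous_on U \<theta>'" using h by (auto simp: homeomorphism_def)
  show ?thesis
    unfolding equiconnecting_def
  proof (intro conjI ballI)
    show "continuous_on (U \<times> U \<times> {0..1}) (\<lambda>(x, y, t). \<theta> ((1 - t) *\<^sub>R \<theta>' x + t *\<^sub>R \<theta>' y))"
      unfolding case_prod_unfold
      by (intro continuous_on_compose2[OF c(1)] continuous_intros continuous_on_compose2[OF c(2)]) auto
  qed (use h in \<open>auto simp: homeomorphism_def simp flip: scaleR_add_left\<close>)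
qed

lemma equiconnecting_convex:
  fixes X :: "'x::real_normed_vector set"
  assumes "convex X"
  shows "equiconnecting X (\<lambda>(x, y, t). (1 - t) *\<^sub>R x + t *\<^sub>R y)"
  unfolding equiconnecting_def case_prod_unfold
  using assms by (auto intro!: continuous_intros convexD_alt simp flip: scaleR_add_left)

text \<open>Since the path from \<open>x\<close> to itself is constant, the paths to nearby points stay near \<open>x\<close>.\<close>

lemma equiconnecting_short:
  fixes X :: "'x::metric_space set" and G :: "'x \<Rightarrow> 'w::metric_space"
  assumes l: "equiconnecting X l" and G: "continuous_on X G" and x: "x \<in> X" and e: "0 < e"
  shows "\<exists>d>0. \<forall>y\<in>X. dist x y < d \<longrightarrow> (\<forall>t\<in>{0..1}. dist (G x) (G (l (x, y, t))) < e)"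
proof -
  have "continuous_on (X \<times> X \<times> {0..1}) (\<lambda>z. G (l z))"
    by (rule continuous_on_compose2[OF G equiconnectingD(1)[OF l]]) (use equiconnectingD(4)[OF l] in auto)
  note cont = this
  have comp: "compact ({x} \<times> {x} \<times> {0..1::real})" by (intro compact_Times) auto
  have sub: "{x} \<times> {x} \<times> {0..1} \<subseteq> X \<times> X \<times> {0..1::real}" using x by auto
  obtain d where d: "d > 0" and
    near: "\<And>k z. k \<in> {x} \<times> {x} \<times> {0..1} \<Longrightarrow> z \<in> X \<times> X \<times> {0..1} \<Longrightarrow> dist k z < d \<Longrightarrow> dist (G (l k)) (G (l z)) < e"
    by (rule uniformly_continuous_near_compact[OF cont comp sub e], rule that; assumption)
  from near have "dist (G (l (x, x, t))) (G (l (x, y, t))) < e" if "y \<in> X" "dist x y < d" "t \<in> {0..1}" for y t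
    using that x by (force simp: dist_Pair_Pair)
  then show ?thesis using d equiconnectingD(5)[OF l x] by (intro exI[of _ d]) auto
qed


section \<open>The universal covering\<close>

definition paths_from :: "'w::real_normed_vector set \<Rightarrow> 'w \<Rightarrow> (real \<Rightarrow> 'w) set" where
  "paths_from S a = {\<gamma>. path \<gamma> \<and> path_image \<gamma> \<subseteq> S \<and> pathstart \<gamma> = a}"

text \<open>\<open>\<eta>\<close> leads from the end of \<open>\<gamma>\<close> to the end of \<open>\<gamma>'\<close> and, as a path in the
  universal covering, from the class of \<open>\<gamma>\<close> to that of \<open>\<gamma>'\<close>.\<close>

definition links :: "'w::real_normed_vector set \<Rightarrow> (real \<Rightarrow> 'w) \<Rightarrow> (real \<Rightarrow> 'w) \<Rightarrow> (real \<Rightarrow> 'w) \<Rightarrow> bool" where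
  "links S \<eta> \<gamma> \<gamma>' \<longleftrightarrow> path \<eta> \<and> path_image \<eta> \<subseteq> S \<and> pathstart \<eta> = pathfinish \<gamma> \<and> homotopic_paths S (\<gamma> +++ \<eta>) \<gamma>'"

definition path_near :: "'w::real_normed_vector set \<Rightarrow> real \<Rightarrow> (real \<Rightarrow> 'w) \<Rightarrow> (real \<Rightarrow> 'w) \<Rightarrow> bool" where
  "path_near S r \<gamma> \<gamma>' \<longleftrightarrow> (\<exists>\<eta>. links S \<eta> \<gamma> \<gamma>' \<and> (\<forall>a\<in>path_image \<eta>. \<forall>b\<in>path_image \<eta>. dist a b \<le> r))"

text \<open>The infimum of the diameters of the paths leading from the class of \<open>\<gamma>\<close> to that of
  \<open>\<gamma>'\<close>.\<close>

definition path_dist :: "'w::real_normed_vector set \<Rightarrow> (real \<Rightarrow> 'w) \<Rightarrow> (real \<Rightarrow> 'w) \<Rightarrow> real" where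
  "path_dist S \<gamma> \<gamma>' = Inf {r. path_near S r \<gamma> \<gamma>'}"

lemma linksD:
  assumes "links S \<eta> \<gamma> \<gamma>'"
  shows "path \<eta>" "path_image \<eta> \<subseteq> S" "pathstart \<eta> = pathfinish \<gamma>" "homotopic_paths S (\<gamma> +++ \<eta>) \<gamma>'"
    "pathfinish \<eta> = pathfinish \<gamma>'"
  using assms homotopic_paths_imp_pathfinish[of S "\<gamma> +++ \<eta>" \<gamma>'] by (auto simp: links_def)

lemma links_sym:
  assumes "\<gamma> \<in> paths_from S a" "links S \<eta> \<gamma> \<gamma>'"
  shows "links S (reversepath \<eta>) \<gamma>' \<gamma>"
proof -
  note g = assms(1)[unfolded paths_from_def, simplified]
  note e = assms(2)[unfolded links_def]
  have fin: "pathfinish \<gamma>' = pathfinish \<eta>"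
    using homotopic_paths_imp_pathfinish[of S "\<gamma> +++ \<eta>" \<gamma>'] e by simp
  have "homotopic_paths S (\<gamma>' +++ reversepath \<eta>) ((\<gamma> +++ \<eta>) +++ reversepath \<eta>)"
    by (intro homotopic_paths_join homotopic_paths_sym[of S "\<gamma> +++ \<eta>"])
       (use e fin in auto)
  also have "homotopic_paths S ((\<gamma> +++ \<eta>) +++ reversepath \<eta>) (\<gamma> +++ (\<eta> +++ reversepath \<eta>))"
    by (rule homotopic_paths_sym, rule homotopic_paths_assoc) (use g e in auto)
  also have "homotopic_paths S (\<gamma> +++ (\<eta> +++ reversepath \<eta>)) (\<gamma> +++ linepath (pathstart \<eta>) (pathstart \<eta>))"
    by (intro homotopic_paths_join homotopic_paths_rinv) (use g e in auto)
  also have "homotopic_paths S (\<gamma> +++ linepath (pathstart \<eta>) (pathstart \<eta>)) \<gamma>"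
    using homotopic_paths_rid[of \<gamma> S] g e by simp
  finally show ?thesis using e fin by (simp add: links_def)
qed

lemma links_trans:
  assumes "\<gamma> \<in> paths_from S a" "links S \<eta> \<gamma> \<gamma>'" "links S \<eta>' \<gamma>' \<gamma>''"
  shows "links S (\<eta> +++ \<eta>') \<gamma> \<gamma>''"
proof -
  note g = assms(1)[unfolded paths_from_def, simplified]
  note e = assms(2)[unfolded links_def]
  note e' = assms(3)[unfolded links_def]
  have fin: "pathfinish \<gamma>' = pathfinish \<eta>"
    using homotopic_paths_imp_pathfinish[of S "\<gamma> +++ \<eta>" \<gamma>'] e by simp
  have "homotopic_paths S (\<gamma> +++ (\<eta> +++ \<eta>')) ((\<gamma> +++ \<eta>) +++ \<eta>')"
    by (rule homotopic_paths_assoc) (use g e e' fin in auto)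
  also have "homotopic_paths S ((\<gamma> +++ \<eta>) +++ \<eta>') (\<gamma>' +++ \<eta>')"
    by (intro homotopic_paths_join) (use e e' fin in auto)
  also have "homotopic_paths S (\<gamma>' +++ \<eta>') \<gamma>''" using e' by simp
  finally show ?thesis using e e' fin path_image_join_subset[of \<eta> \<eta>'] by (auto simp: links_def)
qed

lemma path_near_homotopic:
  assumes "homotopic_paths S \<gamma> \<gamma>'"
  shows "path_near S 0 \<gamma> \<gamma>'"
proof -
  note p = homotopic_paths_imp_path[OF assms] homotopic_paths_imp_subset[OF assms]
  let ?\<eta> = "linepath (pathfinish \<gamma>) (pathfinish \<gamma>)"
  have "homotopic_paths S (\<gamma> +++ ?\<eta>) \<gamma>'"
    using homotopic_paths_trans[OF homotopic_paths_rid assms] p by auto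
  then have "links S ?\<eta> \<gamma> \<gamma>'" using p by (auto simp: links_def path_image_def pathfinish_def)
  then show ?thesis unfolding path_near_def by (intro exI[of _ ?\<eta>]) auto
qed

lemma path_near_sym: "\<gamma> \<in> paths_from S a \<Longrightarrow> path_near S r \<gamma> \<gamma>' \<Longrightarrow> path_near S r \<gamma>' \<gamma>"
  unfolding path_near_def using links_sym by (metis path_image_reversepath)

lemma path_near_trans:
  assumes "\<gamma> \<in> paths_from S a" "path_near S r \<gamma> \<gamma>'" "path_near S r' \<gamma>' \<gamma>''"
  shows "path_near S (r + r') \<gamma> \<gamma>''"
proof -
  obtain \<eta> where e: "links S \<eta> \<gamma> \<gamma>'" "\<forall>a\<in>path_image \<eta>. \<forall>b\<in>path_image \<eta>. dist a b \<le> r"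
    using assms(2) unfolding path_near_def by blast
  obtain \<eta>' where e': "links S \<eta>' \<gamma>' \<gamma>''" "\<forall>a\<in>path_image \<eta>'. \<forall>b\<in>path_image \<eta>'. dist a b \<le> r'"
    using assms(3) unfolding path_near_def by blast
  let ?c = "pathfinish \<eta>"
  have fin: "pathstart \<eta>' = ?c"
    using homotopic_paths_imp_pathfinish[of S "\<gamma> +++ \<eta>" \<gamma>'] e(1) e'(1) by (simp add: links_def)
  have c: "?c \<in> path_image \<eta>" "?c \<in> path_image \<eta>'" using pathfinish_in_path_image[of \<eta>] pathstart_in_path_image[of \<eta>'] by (auto simp: fin)
  have nn: "0 \<le> r" "0 \<le> r'" using e(2) e'(2) c by fastforce+
  have "dist a b \<le> r + r'" if "a \<in> path_image (\<eta> +++ \<eta>')" "b \<in> path_image (\<eta> +++ \<eta>')" for a b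
  proof -
    have ab: "a \<in> path_image \<eta> \<or> a \<in> path_image \<eta>'" "b \<in> path_image \<eta> \<or> b \<in> path_image \<eta>'"
      using that path_image_join_subset by blast+
    have "dist a ?c + dist b ?c \<le> r + r' \<or> dist a b \<le> r \<or> dist a b \<le> r'"
      using ab c e(2) e'(2) by (smt (verit, best) dist_commute)
    then show ?thesis using dist_triangle2[of a b ?c] nn by linarith
  qed
  then show ?thesis unfolding path_near_def using links_trans[OF assms(1) e(1) e'(1)] by blast
qed

lemma path_near_ends:
  assumes "path_near S r \<gamma> \<gamma>'"
  shows "dist (pathfinish \<gamma>) (pathfinish \<gamma>') \<le> r"
proof -
  obtain \<eta> where e: "links S \<eta> \<gamma> \<gamma>'" "\<forall>a\<in>path_image \<eta>. \<forall>b\<in>path_image \<eta>. dist a b \<le> r"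
    using assms unfolding path_near_def by blast
  have "pathfinish \<gamma>' = pathfinish \<eta>" "pathfinish \<gamma> = pathstart \<eta>"
    using homotopic_paths_imp_pathfinish[of S "\<gamma> +++ \<eta>" \<gamma>'] e(1) by (auto simp: links_def)
  then show ?thesis using e(2) pathfinish_in_path_image[of \<eta>] pathstart_in_path_image[of \<eta>] by simp
qed

lemma path_near_exists:
  assumes "\<gamma> \<in> paths_from S a" "\<gamma>' \<in> paths_from S a"
  shows "\<exists>r. path_near S r \<gamma> \<gamma>'"
proof -
  note g = assms[unfolded paths_from_def, simplified]
  let ?\<eta> = "reversepath \<gamma> +++ \<gamma>'"
  have "homotopic_paths S (\<gamma> +++ ?\<eta>) ((\<gamma> +++ reversepath \<gamma>) +++ \<gamma>')"
    by (rule homotopic_paths_assoc) (use g in auto)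
  also have "homotopic_paths S ((\<gamma> +++ reversepath \<gamma>) +++ \<gamma>') (linepath (pathstart \<gamma>) (pathstart \<gamma>) +++ \<gamma>')"
    by (intro homotopic_paths_join homotopic_paths_rinv) (use g in auto)
  also have "homotopic_paths S (linepath (pathstart \<gamma>) (pathstart \<gamma>) +++ \<gamma>') \<gamma>'"
    using homotopic_paths_lid[of \<gamma>' S] g by simp
  finally have "links S ?\<eta> \<gamma> \<gamma>'"
    using g path_image_join_subset[of "reversepath \<gamma>" \<gamma>'] by (auto simp: links_def)
  moreover have "bounded (path_image ?\<eta>)" using g by (intro bounded_path_image) auto
  then have "\<forall>a\<in>path_image ?\<eta>. \<forall>b\<in>path_image ?\<eta>. dist a b \<le> diameter (path_image ?\<eta>)"
    using diameter_bounded_bound by blast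
  ultimately show ?thesis unfolding path_near_def by blast
qed

lemma path_dist_le: "path_near S r \<gamma> \<gamma>' \<Longrightarrow> path_dist S \<gamma> \<gamma>' \<le> r"
  unfolding path_dist_def
  by (rule cInf_lower) (auto intro!: bdd_belowI[of _ 0] dest: path_near_ends order_trans[OF zero_le_dist])

lemma path_dist_lt:
  assumes "\<gamma> \<in> paths_from S a" "\<gamma>' \<in> paths_from S a" "path_dist S \<gamma> \<gamma>' < r"
  shows "path_near S r \<gamma> \<gamma>'"
proof -
  have "{r. path_near S r \<gamma> \<gamma>'} \<noteq> {}" using path_near_exists[OF assms(1,2)] by auto
  from cInf_lessD[OF this assms(3)[unfolded path_dist_def]]
  obtain r' where "path_near S r' \<gamma> \<gamma>'" "r' < r" by auto
  then show ?thesis unfolding path_near_def by (meson less_le_not_le order_trans)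
qed

lemma path_dist_ends:
  assumes "\<gamma> \<in> paths_from S a" "\<gamma>' \<in> paths_from S a"
  shows "dist (pathfinish \<gamma>) (pathfinish \<gamma>') \<le> path_dist S \<gamma> \<gamma>'"
  using path_near_ends path_dist_lt[OF assms] by (meson dense_ge)

lemma path_dist_homotopic:
  assumes "homotopic_paths S \<gamma> \<gamma>'"
  shows "path_dist S \<gamma> \<gamma>' = 0"
proof (rule antisym)
  show "path_dist S \<gamma> \<gamma>' \<le> 0" by (rule path_dist_le[OF path_near_homotopic[OF assms]])
  have "\<gamma> \<in> paths_from S (pathstart \<gamma>)" "\<gamma>' \<in> paths_from S (pathstart \<gamma>)"
    using homotopic_paths_imp_path[OF assms] homotopic_paths_imp_subset[OF assms]
      homotopic_paths_imp_pathstart[OF assms] by (auto simp: paths_from_def)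
  from path_dist_ends[OF this] show "0 \<le> path_dist S \<gamma> \<gamma>'" by (meson order_trans zero_le_dist)
qed

lemma path_dist_sym:
  assumes "\<gamma> \<in> paths_from S a" "\<gamma>' \<in> paths_from S a"
  shows "path_dist S \<gamma> \<gamma>' = path_dist S \<gamma>' \<gamma>"
proof -
  have "{r. path_near S r \<gamma> \<gamma>'} = {r. path_near S r \<gamma>' \<gamma>}"
    using path_near_sym assms by blast
  then show ?thesis by (simp add: path_dist_def)
qed

lemma path_dist_triangle:
  assumes "\<gamma> \<in> paths_from S a" "\<gamma>' \<in> paths_from S a" "\<gamma>'' \<in> paths_from S a"
  shows "path_dist S \<gamma> \<gamma>'' \<le> path_dist S \<gamma> \<gamma>' + path_dist S \<gamma>' \<gamma>''"
proof (rule field_le_epsilon)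
  fix e :: real assume e: "e > 0"
  have "path_near S (path_dist S \<gamma> \<gamma>' + e/2) \<gamma> \<gamma>'" "path_near S (path_dist S \<gamma>' \<gamma>'' + e/2) \<gamma>' \<gamma>''"
    using e assms by (auto intro: path_dist_lt)
  from path_dist_le[OF path_near_trans[OF assms(1) this]]
  show "path_dist S \<gamma> \<gamma>'' \<le> path_dist S \<gamma> \<gamma>' + path_dist S \<gamma>' \<gamma>'' + e" by simp
qed

text \<open>A fixed isometric embedding of the space of paths from \<open>a\<close>. It sends two paths to the same
  point if and only if they have distance zero, so its image models the set of classes of
  paths.\<close>

definition cover_point :: "'w::real_normed_vector set \<Rightarrow> 'w \<Rightarrow> (real \<Rightarrow> 'w) \<Rightarrow> ((real \<Rightarrow> 'w) discrete \<Rightarrow>\<^sub>C real)" where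
  "cover_point S a = (SOME e. \<forall>\<gamma>\<in>paths_from S a. \<forall>\<gamma>'\<in>paths_from S a. dist (e \<gamma>) (e \<gamma>') = path_dist S \<gamma> \<gamma>')"

lemma dist_cover_point:
  assumes "\<gamma> \<in> paths_from S a" "\<gamma>' \<in> paths_from S a"
  shows "dist (cover_point S a \<gamma>) (cover_point S a \<gamma>') = path_dist S \<gamma> \<gamma>'"
proof -
  have "\<exists>e :: (real \<Rightarrow> 'a) \<Rightarrow> ((real \<Rightarrow> 'a) discrete \<Rightarrow>\<^sub>C real).
      \<forall>\<gamma>\<in>paths_from S a. \<forall>\<gamma>'\<in>paths_from S a. dist (e \<gamma>) (e \<gamma>') = path_dist S \<gamma> \<gamma>'"
  proof (rule pseudometric_embedding)
    show "path_dist S \<gamma> \<gamma> = 0" if "\<gamma> \<in> paths_from S a" for \<gamma>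
      using that by (intro path_dist_homotopic) (simp add: paths_from_def)
  qed (use path_dist_sym path_dist_triangle in blast)+
  from someI_ex[OF this] assms show ?thesis unfolding cover_point_def by blast
qed

definition universal_cover :: "'w::real_normed_vector set \<Rightarrow> 'w \<Rightarrow> ((real \<Rightarrow> 'w) discrete \<Rightarrow>\<^sub>C real) set" where
  "universal_cover S a = cover_point S a ` paths_from S a"

definition cover_proj :: "'w::real_normed_vector set \<Rightarrow> 'w \<Rightarrow> ((real \<Rightarrow> 'w) discrete \<Rightarrow>\<^sub>C real) \<Rightarrow> 'w" where
  "cover_proj S a t = pathfinish (SOME \<gamma>. \<gamma> \<in> paths_from S a \<and> cover_point S a \<gamma> = t)"

lemma cover_proj_point:
  assumes "\<gamma> \<in> paths_from S a"
  shows "cover_proj S a (cover_point S a \<gamma>) = pathfinish \<gamma>"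
proof -
  define \<gamma>' where "\<gamma>' = (SOME \<gamma>'. \<gamma>' \<in> paths_from S a \<and> cover_point S a \<gamma>' = cover_point S a \<gamma>)"
  have *: "\<gamma>' \<in> paths_from S a \<and> cover_point S a \<gamma>' = cover_point S a \<gamma>"
    unfolding \<gamma>'_def by (rule someI[of _ \<gamma>]) (use assms in simp)
  then have "path_dist S \<gamma>' \<gamma> = 0" using dist_cover_point[of \<gamma>' S a \<gamma>] assms by simp
  then have "pathfinish \<gamma>' = pathfinish \<gamma>" using path_dist_ends[of \<gamma>' S a \<gamma>] * assms by simp
  then show ?thesis by (simp add: cover_proj_def \<gamma>'_def)
qed

lemma cover_proj_in: "t \<in> universal_cover S a \<Longrightarrow> cover_proj S a t \<in> S"
  unfolding universal_cover_def
  using pathfinish_in_path_image by (fastforce simp: cover_proj_point paths_from_def)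

lemma cover_proj_dist:
  assumes "t \<in> universal_cover S a" "t' \<in> universal_cover S a"
  shows "dist (cover_proj S a t) (cover_proj S a t') \<le> dist t t'"
  using assms unfolding universal_cover_def
  by (auto simp: cover_proj_point dist_cover_point intro: path_dist_ends)

lemma cover_point_homotopic:
  assumes "homotopic_paths S \<gamma> \<gamma>'" "\<gamma> \<in> paths_from S a"
  shows "cover_point S a \<gamma> = cover_point S a \<gamma>'"
proof -
  have "\<gamma>' \<in> paths_from S a"
    using homotopic_paths_imp_path[OF assms(1)] homotopic_paths_imp_subset[OF assms(1)]
      homotopic_paths_imp_pathstart[OF assms(1)] assms(2) by (auto simp: paths_from_def)
  then have "dist (cover_point S a \<gamma>) (cover_point S a \<gamma>') = 0"
    using dist_cover_point[OF assms(2)] path_dist_homotopic[OF assms(1)] by simp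
  then show ?thesis by simp
qed

text \<open>Lifting to the universal covering. The lift of \<open>G\<close> at \<open>x\<close> is represented by the path from
  the base point to \<open>G x0\<close> followed by the image of the chosen path from \<open>x0\<close> to \<open>x\<close>. For \<open>y\<close>
  near \<open>x\<close> the image of the short path from \<open>x\<close> to \<open>y\<close> links the two representatives, because
  triangles of chosen paths are contractible in \<open>X\<close>.\<close>

lemma continuous_on_lift:
  fixes X :: "'x::metric_space set" and S :: "'w::real_normed_vector set"
  assumes l: "equiconnecting X l" and G: "continuous_on X G" "G ` X \<subseteq> S" and x0: "x0 \<in> X"
    and \<gamma>: "\<gamma> \<in> paths_from S a" "pathfinish \<gamma> = G x0"
  shows "continuous_on X (\<lambda>x. cover_point S a (\<gamma> +++ (\<lambda>t. G (l (x0, x, t)))))"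
    and "\<And>x. x \<in> X \<Longrightarrow> \<gamma> +++ (\<lambda>t. G (l (x0, x, t))) \<in> paths_from S a"
proof -
  let ?c = "\<lambda>x y t. G (l (x, y, t))"
  have c: "path (?c x y)" "path_image (?c x y) \<subseteq> S" "pathstart (?c x y) = G x" "pathfinish (?c x y) = G y"
    if "x \<in> X" "y \<in> X" for x y
  proof -
    have eq: "?c x y = G \<circ> (\<lambda>t. l (x, y, t))" by auto
    note lp = equiconnecting_path[OF l that]
    show "path (?c x y)" unfolding eq
      by (rule path_continuous_image[OF lp(1)]) (use G(1) lp(2) continuous_on_subset in blast)
    show "path_image (?c x y) \<subseteq> S" unfolding eq path_image_compose using lp(2) G(2) by blast
    show "pathstart (?c x y) = G x" "pathfinish (?c x y) = G y"
      unfolding eq pathstart_compose pathfinish_compose lp by simp_all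
  qed
  note g = \<gamma>(1)[unfolded paths_from_def, simplified]
  show P: "\<gamma> +++ ?c x0 x \<in> paths_from S a" if "x \<in> X" for x
    using c[OF x0 that] g \<gamma>(2) path_image_join_subset[of \<gamma> "?c x0 x"] by (auto simp: paths_from_def)
  have lk: "links S (?c x y) (\<gamma> +++ ?c x0 x) (\<gamma> +++ ?c x0 y)" if xy: "x \<in> X" "y \<in> X" for x y
  proof -
    note lx = equiconnecting_path[OF l x0 xy(1)]
    note ly = equiconnecting_path[OF l x0 xy(2)]
    note lxy = equiconnecting_path[OF l xy]
    have "homotopic_paths X ((\<lambda>t. l (x0, x, t)) +++ (\<lambda>t. l (x, y, t))) (\<lambda>t. l (x0, y, t))"
      by (rule equiconnecting_homotopic_paths[OF l])
         (use lx ly lxy path_image_join_subset[of "\<lambda>t. l (x0, x, t)" "\<lambda>t. l (x, y, t)"] in auto)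
    from homotopic_paths_continuous_image[OF this G(1), of S]
    have "homotopic_paths S (?c x0 x +++ ?c x y) (?c x0 y)"
      using G(2) unfolding path_compose_join by (auto simp: o_def)
    then have "homotopic_paths S (\<gamma> +++ (?c x0 x +++ ?c x y)) (\<gamma> +++ ?c x0 y)"
      by (intro homotopic_paths_join) (use g \<gamma>(2) c x0 xy in auto)
    moreover have "homotopic_paths S (\<gamma> +++ (?c x0 x +++ ?c x y)) ((\<gamma> +++ ?c x0 x) +++ ?c x y)"
      by (rule homotopic_paths_assoc) (use g \<gamma>(2) c x0 xy in auto)
    ultimately have "homotopic_paths S ((\<gamma> +++ ?c x0 x) +++ ?c x y) (\<gamma> +++ ?c x0 y)"
      using homotopic_paths_sym homotopic_paths_trans by blast
    then show ?thesis using c xy x0 by (simp add: links_def)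
  qed
  show "continuous_on X (\<lambda>x. cover_point S a (\<gamma> +++ ?c x0 x))"
    unfolding continuous_on_iff
  proof (intro ballI allI impI)
    fix x and e :: real assume x: "x \<in> X" and e: "0 < e"
    have "0 < e / 3" using e by simp
    then obtain d where d: "d > 0" "\<forall>y\<in>X. dist x y < d \<longrightarrow> (\<forall>t\<in>{0..1}. dist (G x) (?c x y t) < e / 3)"
      using equiconnecting_short[OF l G(1) x] by blast
    have "dist (cover_point S a (\<gamma> +++ ?c x0 y)) (cover_point S a (\<gamma> +++ ?c x0 x)) < e"
      if y: "y \<in> X" "dist y x < d" for y
    proof -
      have s: "dist (G x) b < e / 3" if "b \<in> path_image (?c x y)" for b
        using that d(2) y by (auto simp: path_image_def dist_commute)
      have "dist b b' \<le> 2 * (e / 3)" if "b \<in> path_image (?c x y)" "b' \<in> path_image (?c x y)" for b b'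
        using s[OF that(1)] s[OF that(2)] dist_triangle3[of b b' "G x"] by simp
      then have "path_near S (2 * (e / 3)) (\<gamma> +++ ?c x0 x) (\<gamma> +++ ?c x0 y)"
        unfolding path_near_def using lk[OF x y(1)] by blast
      from path_dist_le[OF this] e show ?thesis
        by (simp add: dist_commute[of _ "cover_point S a (\<gamma> +++ ?c x0 x)"] dist_cover_point P x y)
    qed
    then show "\<exists>d>0. \<forall>y\<in>X. dist y x < d \<longrightarrow>
        dist (cover_point S a (\<gamma> +++ ?c x0 y)) (cover_point S a (\<gamma> +++ ?c x0 x)) < e"
      using d(1) by blast
  qed
qed

text \<open>A linking loop that stays in an equiconnected set, such as a chart, is contractible.\<close>

lemma links_in_equiconnected:
  assumes U: "U \<subseteq> S" "equiconnecting U l" and \<gamma>: "\<gamma> \<in> paths_from S a"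
    and lk: "links S \<eta> \<gamma> \<gamma>'" "path_image \<eta> \<subseteq> U" and fin: "pathfinish \<gamma> = pathfinish \<gamma>'"
  shows "homotopic_paths S \<gamma> \<gamma>'"
proof -
  note e = linksD[OF lk(1)]
  note g = \<gamma>[unfolded paths_from_def, simplified]
  let ?y = "pathfinish \<gamma>"
  have ends: "pathstart \<eta> = ?y" by (rule linksD(3)[OF lk(1)])
  have ends': "pathfinish \<eta> = ?y" by (rule trans[OF linksD(5)[OF lk(1)] sym[OF fin]])
  have "?y \<in> U" using lk(2) pathstart_in_path_image[of \<eta>] by (auto simp: ends)
  then have "homotopic_paths U \<eta> (linepath ?y ?y)"
    by (intro equiconnecting_homotopic_paths[OF U(2)]) (simp_all add: e(1) lk(2) ends ends')
  then have "homotopic_paths S \<eta> (linepath ?y ?y)" using U(1) homotopic_paths_subset by blast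
  then have "homotopic_paths S (\<gamma> +++ \<eta>) (\<gamma> +++ linepath ?y ?y)"
    by (intro homotopic_paths_join) (use g ends in auto)
  also have "homotopic_paths S (\<gamma> +++ linepath ?y ?y) \<gamma>"
    by (rule homotopic_paths_rid) (use g in auto)
  finally have "homotopic_paths S (\<gamma> +++ \<eta>) \<gamma>" .
  then show ?thesis by (rule homotopic_paths_trans[OF homotopic_paths_sym e(4)])
qed

text \<open>Compactness gives one radius such that every ball of this radius around a point of \<open>C\<close> lies
  in a chart. Paths that end at the same point of \<open>C\<close> and are closer than this radius are
  linked by a loop in that chart.\<close>

lemma cover_locally_injective:
  fixes S :: "'w::real_normed_vector set"
  assumes LE: "locally_euclidean TYPE('e::euclidean_space) S" and C: "compact C" "C \<subseteq> S"
  obtains d where "0 < d"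
    "\<forall>\<gamma>\<in>paths_from S a. \<forall>\<gamma>'\<in>paths_from S a. pathfinish \<gamma> \<in> C \<longrightarrow> pathfinish \<gamma> = pathfinish \<gamma>' \<longrightarrow>
       path_dist S \<gamma> \<gamma>' < d \<longrightarrow> homotopic_paths S \<gamma> \<gamma>'"
proof -
  define \<G> where "\<G> = {V. open V \<and> (\<exists>U l. U \<subseteq> S \<and> equiconnecting U l \<and> V \<inter> S \<subseteq> U)}"
  have "\<exists>V\<in>\<G>. y \<in> V" if y: "y \<in> C" for y
  proof -
    have "y \<in> S" using y C by blast
    then obtain U \<theta> \<theta>' where U: "openin (top_of_set S) U" "y \<in> U"
      and h: "homeomorphism (UNIV::'e set) U \<theta> \<theta>'" "\<theta> 0 = y"
      by (rule locally_euclidean_chart[OF LE])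
    obtain V where "open V" "U = S \<inter> V" using U(1) unfolding openin_open by blast
    then have "V \<in> \<G>" "y \<in> V" using equiconnecting_chart[OF h(1)] U(2) unfolding \<G>_def by blast+
    then show ?thesis by blast
  qed
  then have sub: "C \<subseteq> \<Union>\<G>" by blast
  obtain d where d: "d > 0" and leb: "\<And>y. y \<in> C \<Longrightarrow> \<exists>V\<in>\<G>. ball y d \<subseteq> V"
    by (rule Heine_Borel_lemma[OF C(1) sub], (simp add: \<G>_def; fail), rule that; assumption)
  have "homotopic_paths S \<gamma> \<gamma>'"
    if P: "\<gamma> \<in> paths_from S a" "\<gamma>' \<in> paths_from S a" and fin: "pathfinish \<gamma> \<in> C" "pathfinish \<gamma> = pathfinish \<gamma>'"
      and lt: "path_dist S \<gamma> \<gamma>' < d" for \<gamma> \<gamma>'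
  proof -
    obtain r where r: "path_dist S \<gamma> \<gamma>' < r" "r < d" using lt dense by blast
    obtain \<eta> where e: "links S \<eta> \<gamma> \<gamma>'" "\<forall>a\<in>path_image \<eta>. \<forall>b\<in>path_image \<eta>. dist a b \<le> r"
      using path_dist_lt[OF P r(1)] unfolding path_near_def by blast
    obtain V U l where V: "ball (pathfinish \<gamma>) d \<subseteq> V" "U \<subseteq> S" "equiconnecting U l" "V \<inter> S \<subseteq> U"
      using leb[OF fin(1)] unfolding \<G>_def by blast
    have "pathfinish \<gamma> \<in> path_image \<eta>" using e(1) pathstart_in_path_image unfolding links_def by metis
    then have "path_image \<eta> \<subseteq> ball (pathfinish \<gamma>) d" using e(2) r(2) by fastforce
    moreover have "path_image \<eta> \<subseteq> S" using e(1) by (simp add: links_def)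
    ultimately have "path_image \<eta> \<subseteq> U" using V by blast
    then show ?thesis by (rule links_in_equiconnected[OF V(2,3) P(1) e(1) _ fin(2)])
  qed
  then show ?thesis using that[OF d] by blast
qed

lemma cover_point_eq_iff:
  assumes LE: "locally_euclidean TYPE('e::euclidean_space) S" and P: "\<gamma> \<in> paths_from S a" "\<gamma>' \<in> paths_from S a"
  shows "cover_point S a \<gamma> = cover_point S a \<gamma>' \<longleftrightarrow> homotopic_paths S \<gamma> \<gamma>'"
proof
  assume "cover_point S a \<gamma> = cover_point S a \<gamma>'"
  then have 0: "path_dist S \<gamma> \<gamma>' = 0" using dist_cover_point[OF P] by simp
  then have fin: "pathfinish \<gamma> = pathfinish \<gamma>'" using path_dist_ends[OF P] by simp
  have "compact {pathfinish \<gamma>}" "{pathfinish \<gamma>} \<subseteq> S"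
    using P(1) pathfinish_in_path_image by (auto simp: paths_from_def)
  then obtain d where "0 < d"
    "\<forall>\<gamma>1\<in>paths_from S a. \<forall>\<gamma>'\<in>paths_from S a. pathfinish \<gamma>1 \<in> {pathfinish \<gamma>} \<longrightarrow> pathfinish \<gamma>1 = pathfinish \<gamma>' \<longrightarrow>
       path_dist S \<gamma>1 \<gamma>' < d \<longrightarrow> homotopic_paths S \<gamma>1 \<gamma>'"
    by (rule cover_locally_injective[OF LE])
  then show "homotopic_paths S \<gamma> \<gamma>'" using 0 P fin by auto
qed (rule cover_point_homotopic[OF _ P(1)])

lemma cover_injective_near_compact:
  fixes S :: "'w::real_normed_vector set"
  assumes LE: "locally_euclidean TYPE('e::euclidean_space) S" and C: "compact C" "C \<subseteq> S"
  obtains d where "0 < d"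
    "\<forall>t\<in>universal_cover S a. \<forall>t'\<in>universal_cover S a. cover_proj S a t \<in> C \<longrightarrow>
       cover_proj S a t = cover_proj S a t' \<longrightarrow> dist t t' < d \<longrightarrow> t = t'"
proof -
  obtain d where "0 < d"
    "\<forall>\<gamma>\<in>paths_from S a. \<forall>\<gamma>'\<in>paths_from S a. pathfinish \<gamma> \<in> C \<longrightarrow> pathfinish \<gamma> = pathfinish \<gamma>' \<longrightarrow>
       path_dist S \<gamma> \<gamma>' < d \<longrightarrow> homotopic_paths S \<gamma> \<gamma>'"
    by (rule cover_locally_injective[OF LE C])
  then show ?thesis
    by (intro that[of d]) (auto simp: universal_cover_def cover_proj_point dist_cover_point intro: cover_point_homotopic)
qed

text \<open>A path from the base point is lifted, starting at the class of the constant path, to a path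
  ending at its own class.\<close>

lemma connected_universal_cover:
  fixes S :: "'w::real_normed_vector set"
  assumes a: "a \<in> S"
  shows "connected (universal_cover S a)"
proof (rule path_connected_imp_connected)
  let ?c = "linepath a a"
  have cP: "?c \<in> paths_from S a" using a by (simp add: paths_from_def)
  have "path_component (universal_cover S a) (cover_point S a ?c) (cover_point S a \<gamma>)" if P: "\<gamma> \<in> paths_from S a" for \<gamma>
  proof -
    note g = P[unfolded paths_from_def, simplified]
    let ?l = "\<lambda>(x, y, t). (1 - t) *\<^sub>R x + t *\<^sub>R y :: real"
    let ?p = "\<lambda>x. ?c +++ (\<lambda>t. \<gamma> (?l (0, x, t)))"
    have l: "equiconnecting {0..1::real} ?l" by (rule equiconnecting_convex) simp
    have G: "continuous_on {0..1} \<gamma>" "\<gamma> ` {0..1} \<subseteq> S" using g by (auto simp: path_def path_image_def)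
    have c0: "pathfinish ?c = \<gamma> 0" using g by (simp add: pathstart_def)
    have zero: "(0::real) \<in> {0..1}" by simp
    note lift = continuous_on_lift[OF l G zero cP c0]
    let ?L = "\<lambda>x. cover_point S a (?p x)"
    have "path ?L" unfolding path_def by (rule lift(1))
    moreover have "path_image ?L \<subseteq> universal_cover S a"
      unfolding path_image_def universal_cover_def using lift(2) by blast
    moreover have "pathstart ?L = cover_point S a ?c"
    proof -
      have "(\<lambda>t. \<gamma> (?l (0, 0, t))) = linepath a a" using g by (auto simp: pathstart_def linepath_def algebra_simps)
      moreover have "homotopic_paths S ?c (?c +++ ?c)"
        using homotopic_paths_rid[of ?c S] a by (simp add: homotopic_paths_sym_eq)
      from cover_point_homotopic[OF this cP]
      have "cover_point S a (?c +++ ?c) = cover_point S a ?c" by (rule sym)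
      ultimately show ?thesis by (simp add: pathstart_def)
    qed
    moreover have "pathfinish ?L = cover_point S a \<gamma>"
    proof -
      have "(\<lambda>t. \<gamma> (?l (0, 1, t))) = \<gamma>" by auto
      moreover have "homotopic_paths S \<gamma> (?c +++ \<gamma>)"
        by (rule homotopic_paths_sym, rule homotopic_paths_lid') (use g in auto)
      from cover_point_homotopic[OF this P]
      have "cover_point S a (?c +++ \<gamma>) = cover_point S a \<gamma>" by (rule sym)
      ultimately show ?thesis by (simp add: pathfinish_def)
    qed
    ultimately show ?thesis unfolding path_component_def by blast
  qed
  note reach = this
  show "path_connected (universal_cover S a)"
    unfolding path_connected_component
  proof (intro ballI)
    fix s t assume "s \<in> universal_cover S a" "t \<in> universal_cover S a"
    then obtain \<gamma> \<gamma>' where "\<gamma> \<in> paths_from S a" "s = cover_point S a \<gamma>"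
      "\<gamma>' \<in> paths_from S a" "t = cover_point S a \<gamma>'" unfolding universal_cover_def by blast
    then show "path_component (universal_cover S a) s t"
      using path_component_trans[OF path_component_sym[OF reach] reach] by simp
  qed
qed

text \<open>The inclusion of a chart \<open>U\<close> lifts to a section \<open>\<sigma>\<close> of the projection through any
  given point over \<open>U\<close>. Its image is open: a link that starts in the image and is short enough
  stays in \<open>U\<close>, so it ends in the image.\<close>

lemma locally_euclidean_universal_cover:
  fixes S :: "'w::real_normed_vector set"
  assumes LE: "locally_euclidean TYPE('e::euclidean_space) S"
  shows "locally_euclidean TYPE('e) (universal_cover S a)"
  unfolding locally_euclidean_def
proof
  fix t assume "t \<in> universal_cover S a"
  then obtain \<gamma> where \<gamma>: "\<gamma> \<in> paths_from S a" "t = cover_point S a \<gamma>" by (auto simp: universal_cover_def)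
  note g = \<gamma>(1)[unfolded paths_from_def, simplified]
  define y where "y = pathfinish \<gamma>"
  have yS: "y \<in> S" using g pathfinish_in_path_image unfolding y_def by blast
  then obtain U \<theta> \<theta>' where U: "openin (top_of_set S) U" "y \<in> U"
    and h: "homeomorphism (UNIV::'e set) U \<theta> \<theta>'" "\<theta> 0 = y"
    by (rule locally_euclidean_chart[OF LE])
  have US: "U \<subseteq> S" using U openin_imp_subset by blast
  obtain l where l: "equiconnecting U l" using equiconnecting_chart[OF h(1)] by blast
  let ?c = "\<lambda>z t. id (l (y, z, t))"
  have c: "path (?c z)" "path_image (?c z) \<subseteq> U" "pathstart (?c z) = y" "pathfinish (?c z) = z" if "z \<in> U" for z
    using equiconnecting_path[OF l U(2) that] by simp_all
  define \<sigma> where "\<sigma> z = cover_point S a (\<gamma> +++ ?c z)" for z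
  have fin: "pathfinish \<gamma> = id y" by (simp add: y_def)
  have idU: "continuous_on U id" "id ` U \<subseteq> S" using US by auto
  have lift: "continuous_on U \<sigma>" "\<And>z. z \<in> U \<Longrightarrow> \<gamma> +++ ?c z \<in> paths_from S a"
    unfolding \<sigma>_def by (rule continuous_on_lift[OF l idU U(2) \<gamma>(1) fin]; assumption)+
  have \<sigma>T: "\<sigma> z \<in> universal_cover S a" "cover_proj S a (\<sigma> z) = z" if "z \<in> U" for z
    using lift(2)[OF that] c[OF that] by (simp_all add: \<sigma>_def universal_cover_def cover_proj_point)
  have cproj: "continuous_on (universal_cover S a) (cover_proj S a)"
    unfolding continuous_on_iff using cover_proj_dist by (meson order_le_less_trans)
  have hom: "homeomorphism (\<sigma> ` U) U (cover_proj S a) \<sigma>"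
    unfolding homeomorphism_def
    using lift(1) \<sigma>T continuous_on_subset[OF cproj] by (auto simp: image_iff image_subset_iff)
  have op: "openin (top_of_set (universal_cover S a)) (\<sigma> ` U)"
    unfolding openin_euclidean_subtopology_iff
  proof (intro conjI ballI)
    show "\<sigma> ` U \<subseteq> universal_cover S a" using \<sigma>T by auto
    fix s assume "s \<in> \<sigma> ` U"
    then obtain z where z: "z \<in> U" "s = \<sigma> z" by auto
    obtain d where d: "d > 0" "\<And>w. w \<in> S \<Longrightarrow> dist w z < d \<Longrightarrow> w \<in> U"
      using U(1) z(1) unfolding openin_euclidean_subtopology_iff by blast
    have "s' \<in> \<sigma> ` U" if s': "s' \<in> universal_cover S a" "dist s' s < d" for s'
    proof -
      obtain \<gamma>' where \<gamma>': "\<gamma>' \<in> paths_from S a" "s' = cover_point S a \<gamma>'"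
        using s'(1) by (auto simp: universal_cover_def)
      have "path_dist S (\<gamma> +++ ?c z) \<gamma>' < d"
        using s'(2) dist_cover_point[OF lift(2)[OF z(1)] \<gamma>'(1)] z(2) \<gamma>'(2) by (simp add: \<sigma>_def dist_commute)
      then obtain r where r: "path_dist S (\<gamma> +++ ?c z) \<gamma>' < r" "r < d" using dense by blast
      obtain \<eta> where e: "links S \<eta> (\<gamma> +++ ?c z) \<gamma>'" "\<forall>a\<in>path_image \<eta>. \<forall>b\<in>path_image \<eta>. dist a b \<le> r"
        using path_dist_lt[OF lift(2)[OF z(1)] \<gamma>'(1) r(1)] unfolding path_near_def by blast
      note e1 = e(1)[unfolded links_def]
      have \<eta>z: "pathstart \<eta> = z" using e1 c[OF z(1)] by simp
      have \<eta>U: "path_image \<eta> \<subseteq> U"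
      proof
        fix w assume w: "w \<in> path_image \<eta>"
        have "dist w z \<le> r" using e(2) w \<eta>z pathstart_in_path_image[of \<eta>] by auto
        then show "w \<in> U" using d(2)[of w] w e1 r(2) by auto
      qed
      let ?z = "pathfinish \<eta>"
      have z': "?z \<in> U" using \<eta>U pathfinish_in_path_image by blast
      have "homotopic_paths U (?c z +++ \<eta>) (?c ?z)"
        by (rule equiconnecting_homotopic_paths[OF l])
           (use c[OF z(1)] c[OF z'] e1 \<eta>z \<eta>U path_image_join_subset[of "?c z" \<eta>] in auto)
      then have "homotopic_paths S (?c z +++ \<eta>) (?c ?z)" using US homotopic_paths_subset by blast
      then have "homotopic_paths S (\<gamma> +++ (?c z +++ \<eta>)) (\<gamma> +++ ?c ?z)"
        by (intro homotopic_paths_join) (use g c[OF z(1)] in \<open>auto simp: y_def\<close>)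
      moreover have "homotopic_paths S (\<gamma> +++ (?c z +++ \<eta>)) ((\<gamma> +++ ?c z) +++ \<eta>)"
        by (rule homotopic_paths_assoc) (use g c[OF z(1)] e1 \<eta>z US in \<open>auto simp: y_def\<close>)
      ultimately have "homotopic_paths S \<gamma>' (\<gamma> +++ ?c ?z)"
        using e1 homotopic_paths_sym homotopic_paths_trans by blast
      from cover_point_homotopic[OF this \<gamma>'(1)] have "s' = \<sigma> ?z" using \<gamma>'(2) by (simp add: \<sigma>_def)
      then show ?thesis using z' by blast
    qed
    then show "\<exists>e>0. \<forall>s'\<in>universal_cover S a. dist s' s < e \<longrightarrow> s' \<in> \<sigma> ` U" using d(1) by blast
  qed
  have "links S (?c y) \<gamma> (\<gamma> +++ ?c y)"
    using g c[OF U(2)] US lift(2)[OF U(2)] by (auto simp: links_def y_def paths_from_def)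
  then have "homotopic_paths S \<gamma> (\<gamma> +++ ?c y)"
    by (rule links_in_equiconnected[OF US l \<gamma>(1)]) (use c[OF U(2)] in \<open>auto simp: y_def\<close>)
  from cover_point_homotopic[OF this \<gamma>(1)] have "t = \<sigma> y" using \<gamma>(2) by (simp add: \<sigma>_def)
  then have "t \<in> \<sigma> ` U" using U(2) by blast
  moreover have "\<sigma> ` U homeomorphic U" "U homeomorphic (UNIV::'e set)"
    using hom homeomorphism_symD[OF h(1)] unfolding homeomorphic_def by blast+
  then have "\<sigma> ` U homeomorphic (UNIV::'e set)" by (rule homeomorphic_trans)
  ultimately show "\<exists>V. openin (top_of_set (universal_cover S a)) V \<and> t \<in> V \<and> V homeomorphic (UNIV::'e set)"
    using op by (intro exI[of _ "\<sigma> ` U"] conjI)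
qed


section \<open>Spheres and discs in coordinates\<close>

definition coord_sphere :: "nat \<Rightarrow> (nat \<Rightarrow> real) set" where
  "coord_sphere m = {y. (\<Sum>i\<le>m. (y i)\<^sup>2) = 1 \<and> (\<forall>i>m. y i = 0)}"

definition coord_disc :: "nat \<Rightarrow> (nat \<Rightarrow> real) set" where
  "coord_disc m = {x. (\<Sum>i<m. (x i)\<^sup>2) \<le> 1 \<and> (\<forall>i\<ge>m. x i = 0)}"

lemma nsphere_coord_sphere: "nsphere m = top_of_set (coord_sphere m)"
  by (simp add: nsphere coord_sphere_def euclidean_product_topology)

lemma continuous_on_coord: "continuous_on S (\<lambda>x. x i)" for S :: "('a \<Rightarrow> 'b::topological_space) set"
  by (rule continuous_on_subset[OF continuous_on_product_coordinates]) auto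

lemma compact_bounded_coords:
  fixes A :: "('a::countable \<Rightarrow> real) set"
  assumes "closed A" "\<And>x i. x \<in> A \<Longrightarrow> \<bar>x i\<bar> \<le> 1"
  shows "compact A"
proof -
  have "compactin (product_topology (\<lambda>i::'a. euclideanreal) UNIV) (PiE UNIV (\<lambda>_. {-1..1}))"
    unfolding compactin_PiE by simp
  then have "compact (PiE (UNIV :: 'a set) (\<lambda>_. {-1..1::real}))"
    by (simp add: euclidean_product_topology)
  moreover have "A \<subseteq> PiE UNIV (\<lambda>_. {-1..1})" using assms(2) by (auto simp: abs_le_iff minus_le_iff)
  ultimately show ?thesis
    using assms(1) compact_Int_closed[of "PiE UNIV (\<lambda>_. {-1..1})" A] by (simp add: Int_absorb1)
qed

lemma abs_coord_le_1:
  fixes x :: "'a \<Rightarrow> real"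
  assumes "finite I" "i \<in> I" "(\<Sum>i\<in>I. (x i)\<^sup>2) \<le> 1"
  shows "\<bar>x i\<bar> \<le> 1"
proof -
  have "(x i)\<^sup>2 \<le> (\<Sum>i\<in>I. (x i)\<^sup>2)" by (rule member_le_sum) (use assms in auto)
  then have "(x i)\<^sup>2 \<le> 1" using assms(3) by linarith
  then show ?thesis by (simp add: abs_square_le_1)
qed

lemma compact_coord_sphere: "compact (coord_sphere m)"
proof (rule compact_bounded_coords)
  have "coord_sphere m = {y. (\<Sum>i\<le>m. (y i)\<^sup>2) = 1} \<inter> (\<Inter>i\<in>{m<..}. {y. y i = 0})"
    by (auto simp: coord_sphere_def)
  also have "closed \<dots>"
    by (intro closed_Int closed_INT ballI closed_Collect_eq continuous_intros continuous_on_coord)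
  finally show "closed (coord_sphere m)" .
  show "\<bar>y i\<bar> \<le> 1" if "y \<in> coord_sphere m" for y i
    using that abs_coord_le_1[of "{..m}" i y] by (cases "i \<le> m") (auto simp: coord_sphere_def)
qed

lemma compact_coord_disc: "compact (coord_disc m)"
proof (rule compact_bounded_coords)
  have "coord_disc m = {x. (\<Sum>i<m. (x i)\<^sup>2) \<le> 1} \<inter> (\<Inter>i\<in>{m..}. {x. x i = 0})"
    by (auto simp: coord_disc_def)
  also have "closed \<dots>"
    by (intro closed_Int closed_INT ballI closed_Collect_eq closed_Collect_le continuous_intros continuous_on_coord)
  finally show "closed (coord_disc m)" .
  show "\<bar>x i\<bar> \<le> 1" if "x \<in> coord_disc m" for x i
    using that abs_coord_le_1[of "{..<m}" i x] by (cases "i < m") (auto simp: coord_disc_def)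
qed

definition coord_segment :: "(nat \<Rightarrow> real) \<times> (nat \<Rightarrow> real) \<times> real \<Rightarrow> nat \<Rightarrow> real" where
  "coord_segment = (\<lambda>(x, y, t) i. (1 - t) * x i + t * y i)"

lemma equiconnecting_coord_disc: "equiconnecting (coord_disc m) coord_segment"
  unfolding equiconnecting_def
proof (intro conjI ballI)
  show "continuous_on (coord_disc m \<times> coord_disc m \<times> {0..1}) coord_segment"
    unfolding coord_segment_def case_prod_unfold
    by (intro continuous_on_coordinatewise_then_product continuous_intros
        continuous_on_product_then_coordinatewise[OF continuous_on_fst[OF continuous_on_id]]
        continuous_on_product_then_coordinatewise[OF continuous_on_fst[OF continuous_on_snd[OF continuous_on_id]]])
  fix x y and t :: real assume xy: "x \<in> coord_disc m" "y \<in> coord_disc m" and t: "t \<in> {0..1}"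
  have "((1 - t) * x i + t * y i)\<^sup>2 \<le> (1 - t) * (x i)\<^sup>2 + t * (y i)\<^sup>2" for i
  proof -
    have "(1 - t) * (x i)\<^sup>2 + t * (y i)\<^sup>2 - ((1 - t) * x i + t * y i)\<^sup>2 = t * (1 - t) * (x i - y i)\<^sup>2"
      by (simp add: power2_eq_square algebra_simps)
    also have "\<dots> \<ge> 0" using t by simp
    finally show ?thesis by simp
  qed
  then have "(\<Sum>i<m. ((1 - t) * x i + t * y i)\<^sup>2) \<le> (\<Sum>i<m. (1 - t) * (x i)\<^sup>2 + t * (y i)\<^sup>2)"
    by (rule sum_mono)
  also have "\<dots> = (1 - t) * (\<Sum>i<m. (x i)\<^sup>2) + t * (\<Sum>i<m. (y i)\<^sup>2)"
    by (simp add: sum.distrib sum_distrib_left)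
  also have "\<dots> \<le> (1 - t) * 1 + t * 1"
    using xy t by (intro add_mono mult_left_mono) (auto simp: coord_disc_def)
  finally show "coord_segment (x, y, t) \<in> coord_disc m"
    using xy by (simp add: coord_segment_def coord_disc_def)
  show "coord_segment (x, x, t) = x" by (simp add: coord_segment_def algebra_simps)
qed (auto simp: coord_segment_def)

text \<open>The squared norm on this collar is at least \<open>1/2\<close>, which is where the twofold collapse of
  the corresponding point of the lower hemisphere reaches the north pole; see
  \<open>collapse_collapse_collar\<close>.\<close>

definition coord_collar :: "nat \<Rightarrow> (nat \<Rightarrow> real) set" where
  "coord_collar m = {x \<in> coord_disc m. 0 \<le> 2 * (\<Sum>i<m. (x i)\<^sup>2) - 1}"

definition coord_axis :: "nat \<Rightarrow> real \<Rightarrow> nat \<Rightarrow> real" where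
  "coord_axis k c = (\<lambda>i. if i = k then c else 0)"

lemma sum_coord_axis: "k < m \<Longrightarrow> (\<Sum>i<m. (coord_axis k c i)\<^sup>2) = c\<^sup>2"
  by (simp add: coord_axis_def if_distrib[of "\<lambda>x. x\<^sup>2"] cong: if_cong)

text \<open>Shrink all coordinates but the first to zero while the first one keeps the norm constant. If
  it vanishes at the start, it may grow in either direction; this is how
  \<open>path_connected_coord_collar\<close> passes from one end of the first axis to the other, through a
  point of the second axis.\<close>

lemma path_component_coord_axis:
  assumes x: "x \<in> coord_collar m" and m: "0 < m" and \<sigma>: "\<sigma> = 1 \<or> \<sigma> = -1" "0 \<le> \<sigma> * x 0"
  shows "path_component (coord_collar m) x (coord_axis 0 (\<sigma> * sqrt (\<Sum>i<m. (x i)\<^sup>2)))"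
proof -
  define c where "c = (\<Sum>i<m. (x i)\<^sup>2)"
  define c' where "c' = (\<Sum>i\<in>{..<m} - {0}. (x i)\<^sup>2)"
  have c': "0 \<le> c'" "c = (x 0)\<^sup>2 + c'"
    using m by (auto simp: c_def c'_def sum.remove[of "{..<m}" 0] intro!: sum_nonneg)
  define p where "p t = (\<lambda>i. if i = 0 then \<sigma> * sqrt (c - (1 - t)\<^sup>2 * c') else (1 - t) * x i)" for t
  have "(\<Sum>i<m. (p t i)\<^sup>2) = c" if t: "t \<in> {0..1}" for t
  proof -
    have "(1 - t)\<^sup>2 * c' \<le> 1 * c'"
      using t c'(1) by (intro mult_right_mono) (auto simp: abs_square_le_1)
    then have nn: "0 \<le> c - (1 - t)\<^sup>2 * c'" using c'(2) zero_le_power2[of "x 0"] by linarith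
    have "(\<Sum>i<m. (p t i)\<^sup>2) = (p t 0)\<^sup>2 + (\<Sum>i\<in>{..<m} - {0}. (p t i)\<^sup>2)"
      using m by (simp add: sum.remove[of "{..<m}" 0])
    also have "(\<Sum>i\<in>{..<m} - {0}. (p t i)\<^sup>2) = (1 - t)\<^sup>2 * c'"
      unfolding c'_def sum_distrib_left by (rule sum.cong) (auto simp: p_def power_mult_distrib)
    also have "(p t 0)\<^sup>2 = c - (1 - t)\<^sup>2 * c'" using nn \<sigma>(1) by (auto simp: p_def power_mult_distrib)
    finally show ?thesis by simp
  qed
  then have pc: "p t \<in> coord_collar m" if "t \<in> {0..1}" for t
    using x m that by (auto simp: coord_collar_def coord_disc_def c_def p_def)
  have "path p"
    unfolding path_def
  proof (rule continuous_on_coordinatewise_then_product)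
    show "continuous_on {0..1} (\<lambda>t. p t i)" for i
      by (cases "i = 0") (auto simp: p_def intro!: continuous_intros)
  qed
  moreover have "p 0 = x"
  proof
    have "\<sigma> * \<bar>x 0\<bar> = x 0" using \<sigma> by auto
    then show "p 0 i = x i" for i using c'(2) by (simp add: p_def)
  qed
  moreover have "p 1 = coord_axis 0 (\<sigma> * sqrt c)" by (auto simp: p_def coord_axis_def)
  ultimately show ?thesis
    unfolding path_component_def c_def[symmetric] using pc
    by (intro exI[of _ p]) (auto simp: path_image_def pathstart_def pathfinish_def)
qed

lemma path_connected_coord_collar:
  assumes m: "2 \<le> m"
  shows "path_connected (coord_collar m)"
proof -
  have to_e0: "path_component (coord_collar m) x (coord_axis 0 1)" if x: "x \<in> coord_collar m" for x
  proof -
    define r where "r = sqrt (\<Sum>i<m. (x i)\<^sup>2)"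
    have r2: "r\<^sup>2 = (\<Sum>i<m. (x i)\<^sup>2)" unfolding r_def by (simp add: sum_nonneg)
    have r: "0 \<le> r" "r \<le> 1" "1/2 \<le> r\<^sup>2"
      using x unfolding r_def r2[unfolded r_def] by (auto simp: coord_collar_def coord_disc_def sum_nonneg)
    have axis: "coord_axis k c \<in> coord_collar m" if "k < m" "r \<le> c" "c \<le> 1" for k c
    proof -
      have "r\<^sup>2 \<le> c\<^sup>2" "c\<^sup>2 \<le> 1" using that r by (auto intro: power_mono simp: abs_square_le_1)
      then show ?thesis using that r(3)
        by (simp add: coord_collar_def coord_disc_def sum_coord_axis) (auto simp: coord_axis_def)
    qed
    have e1: "path_component (coord_collar m) (coord_axis 1 r) (coord_axis 0 (\<sigma> * r))"
      if "\<sigma> = 1 \<or> \<sigma> = -1" for \<sigma>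
      using path_component_coord_axis[OF axis[of 1 r] _ that] m r
      by (simp add: sum_coord_axis) (simp add: coord_axis_def)
    have "path_component (coord_collar m) x (coord_axis 0 (\<sigma> * r))" if "\<sigma> = (if 0 \<le> x 0 then 1 else -1)" for \<sigma>
      unfolding r_def by (rule path_component_coord_axis[OF x]) (use that m in auto)
    then have "path_component (coord_collar m) x (coord_axis 0 r)"
      using path_component_trans[OF path_component_sym[OF e1[of "-1"]] e1[of 1]]
      by (cases "0 \<le> x 0") (auto intro: path_component_trans)
    moreover have "path_component (coord_collar m) (coord_axis 0 r) (coord_axis 0 1)"
    proof -
      let ?p = "\<lambda>t i. if i = (0::nat) then (1 - t) * r + t else 0 :: real"
      have "path ?p"
        unfolding path_def
      proof (rule continuous_on_coordinatewise_then_product)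
        show "continuous_on {0..1} (\<lambda>t. ?p t i)" for i
          by (cases "i = 0") (auto intro!: continuous_intros)
      qed
      moreover have "?p t \<in> coord_collar m" if "t \<in> {0..1}" for t
      proof -
        have "(1 - t) * r + t = r + t * (1 - r)" "(1 - t) * r + t = 1 - (1 - t) * (1 - r)"
          by (simp_all add: algebra_simps)
        moreover have "0 \<le> t * (1 - r)" "0 \<le> (1 - t) * (1 - r)" using that r(2) by auto
        ultimately have "r \<le> (1 - t) * r + t" "(1 - t) * r + t \<le> 1" by linarith+
        then show ?thesis using axis[of 0 "(1 - t) * r + t"] m by (simp add: coord_axis_def)
      qed
      ultimately show ?thesis
        unfolding path_component_def
        by (intro exI[of _ ?p]) (auto simp: path_image_def pathstart_def pathfinish_def coord_axis_def)
    qed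
    ultimately show ?thesis by (rule path_component_trans)
  qed
  show ?thesis
    unfolding path_connected_component
    using path_component_trans[OF to_e0 path_component_sym[OF to_e0]] by blast
qed

definition north_pole :: "nat \<Rightarrow> nat \<Rightarrow> real" where
  "north_pole m = coord_axis m 1"

text \<open>Collapses the upper hemisphere to the north pole; on the lower hemisphere it doubles the
  angle from the south pole. It is homotopic to the identity, along normalised segments,
  because it sends no point to its antipode.\<close>

definition collapse :: "nat \<Rightarrow> (nat \<Rightarrow> real) \<Rightarrow> nat \<Rightarrow> real" where
  "collapse m y = (\<lambda>i. north_pole m i + 2 * max 0 (- y m) * y i)"

definition collapse_homotopy :: "nat \<Rightarrow> real \<Rightarrow> (nat \<Rightarrow> real) \<Rightarrow> nat \<Rightarrow> real" where
  "collapse_homotopy m t y = (let b = (1 - t) + 2 * max 0 (- y m) * t in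
     (\<lambda>i. (t * north_pole m i + b * y i) / sqrt (t\<^sup>2 + b\<^sup>2 + 2 * t * b * y m)))"

lemma sum_pole_combination:
  assumes "y \<in> coord_sphere m"
  shows "(\<Sum>i\<le>m. (t * north_pole m i + b * y i)\<^sup>2) = t\<^sup>2 + b\<^sup>2 + 2 * t * b * y m"
proof -
  have "(\<Sum>i\<le>m. (t * north_pole m i + b * y i)\<^sup>2) =
      (\<Sum>i\<le>m. (t * north_pole m i)\<^sup>2 + 2 * t * b * (north_pole m i * y i) + b\<^sup>2 * (y i)\<^sup>2)"
    by (rule sum.cong) (auto simp: power2_eq_square algebra_simps)
  also have "\<dots> = (\<Sum>i\<le>m. (t * north_pole m i)\<^sup>2) + 2 * t * b * (\<Sum>i\<le>m. north_pole m i * y i) + b\<^sup>2 * (\<Sum>i\<le>m. (y i)\<^sup>2)"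
    by (simp add: sum.distrib sum_distrib_left)
  also have "(\<Sum>i\<le>m. (t * north_pole m i)\<^sup>2) = t\<^sup>2"
    by (simp add: north_pole_def coord_axis_def if_distrib[of "\<lambda>x. x\<^sup>2"] if_distrib[of "\<lambda>x. t * x"] cong: if_cong)
  also have "(\<Sum>i\<le>m. north_pole m i * y i) = y m"
    by (simp add: north_pole_def coord_axis_def if_distrib[of "\<lambda>x. x * _"] cong: if_cong)
  finally show ?thesis using assms by (simp add: coord_sphere_def)
qed

lemma coord_sphere_bound: "y \<in> coord_sphere m \<Longrightarrow> \<bar>y i\<bar> \<le> 1"
  using abs_coord_le_1[of "{..m}" i y] by (cases "i \<le> m") (auto simp: coord_sphere_def)

lemma collapse_homotopy_denominator:
  assumes y: "y \<in> coord_sphere m" and t: "t \<in> {0..1}"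
    and b: "b = (1 - t) + 2 * max 0 (- y m) * t"
  shows "0 < t\<^sup>2 + b\<^sup>2 + 2 * t * b * y m"
proof -
  have ym: "-1 \<le> y m" using coord_sphere_bound[OF y, of m] by auto
  have b0: "0 \<le> b" using t by (simp add: b)
  have eq: "t\<^sup>2 + b\<^sup>2 + 2 * t * b * y m = (t - b)\<^sup>2 + 2 * (t * b) * (1 + y m)"
    by (simp add: power2_eq_square algebra_simps)
  have nn: "0 \<le> (t - b)\<^sup>2" "0 \<le> 2 * (t * b) * (1 + y m)" using t b0 ym by auto
  show ?thesis
  proof (rule ccontr)
    assume "\<not> ?thesis"
    then have "(t - b)\<^sup>2 = 0" "2 * (t * b) * (1 + y m) = 0" using eq nn by linarith+
    then have tb: "t = b" "t * b = 0 \<or> y m = -1" by auto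
    then show False
    proof (cases "t = 0")
      case True
      with tb b show False by simp
    next
      case False
      with tb have "y m = -1" by auto
      with b have "b = 1 + t" by simp
      with tb(1) show False by simp
    qed
  qed
qed

lemma collapse_homotopy_sphere:
  assumes y: "y \<in> coord_sphere m" and t: "t \<in> {0..1}"
  shows "collapse_homotopy m t y \<in> coord_sphere m"
proof -
  define b where "b = (1 - t) + 2 * max 0 (- y m) * t"
  define n where "n = t\<^sup>2 + b\<^sup>2 + 2 * t * b * y m"
  have n: "0 < n" unfolding n_def by (rule collapse_homotopy_denominator[OF y t b_def])
  have eq: "collapse_homotopy m t y = (\<lambda>i. (t * north_pole m i + b * y i) / sqrt n)"
    by (simp add: collapse_homotopy_def b_def n_def Let_def)
  have "(\<Sum>i\<le>m. (collapse_homotopy m t y i)\<^sup>2) = (\<Sum>i\<le>m. (t * north_pole m i + b * y i)\<^sup>2) / n"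
    using n by (simp add: eq power_divide sum_divide_distrib)
  also have "\<dots> = 1" using n by (simp add: sum_pole_combination[OF y] n_def)
  finally show ?thesis using y by (auto simp: coord_sphere_def eq north_pole_def coord_axis_def)
qed

lemma collapse_homotopy_0: "collapse_homotopy m 0 y = y"
  by (simp add: collapse_homotopy_def)

lemma collapse_homotopy_1:
  assumes y: "y \<in> coord_sphere m"
  shows "collapse_homotopy m 1 y = collapse m y"
proof -
  have "1\<^sup>2 + ((1 - 1) + 2 * max 0 (- y m) * 1)\<^sup>2 + 2 * 1 * ((1 - 1) + 2 * max 0 (- y m) * 1) * y m = 1"
    by (auto simp: max_def power2_eq_square)
  then show ?thesis unfolding collapse_homotopy_def collapse_def Let_def by (simp only:) simp
qed

lemma collapse_sphere: "y \<in> coord_sphere m \<Longrightarrow> collapse m y \<in> coord_sphere m"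
  using collapse_homotopy_sphere[of y m 1] collapse_homotopy_1[of y m] by simp

lemma collapse_upper: "0 \<le> y m \<Longrightarrow> collapse m y = north_pole m"
  by (simp add: collapse_def)

lemma continuous_on_collapse: "continuous_on Y (collapse m)"
  unfolding collapse_def
  by (intro continuous_on_coordinatewise_then_product continuous_intros continuous_on_coord)

lemma continuous_on_collapse_homotopy:
  "continuous_on (coord_sphere m \<times> {0..1}) (\<lambda>z. collapse_homotopy m (snd z) (fst z))"
proof -
  have "sqrt (t\<^sup>2 + ((1 - t) + 2 * max 0 (- y m) * t)\<^sup>2 + 2 * t * ((1 - t) + 2 * max 0 (- y m) * t) * y m) \<noteq> 0"
    if "y \<in> coord_sphere m" "t \<in> {0..1}" for y t
    using collapse_homotopy_denominator[OF that refl] by simp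
  then show ?thesis
    unfolding collapse_homotopy_def Let_def
    by (intro continuous_on_coordinatewise_then_product continuous_intros
        continuous_on_product_then_coordinatewise[OF continuous_on_fst[OF continuous_on_id]]) auto
qed

definition lower_hemisphere_point :: "nat \<Rightarrow> (nat \<Rightarrow> real) \<Rightarrow> nat \<Rightarrow> real" where
  "lower_hemisphere_point m x = (\<lambda>i. if i = m then - sqrt (1 - (\<Sum>i<m. (x i)\<^sup>2)) else x i)"

lemma lower_hemisphere_point_sphere:
  assumes "x \<in> coord_disc m"
  shows "lower_hemisphere_point m x \<in> coord_sphere m"
proof -
  have "(\<Sum>i\<le>m. (lower_hemisphere_point m x i)\<^sup>2) = (\<Sum>i<m. (x i)\<^sup>2) + (1 - (\<Sum>i<m. (x i)\<^sup>2))"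
    using assms by (simp add: lower_hemisphere_point_def coord_disc_def flip: lessThan_Suc_atMost)
  then show ?thesis using assms by (auto simp: coord_sphere_def lower_hemisphere_point_def coord_disc_def)
qed

lemma continuous_on_lower_hemisphere_point: "continuous_on X (lower_hemisphere_point m)"
proof (rule continuous_on_coordinatewise_then_product)
  show "continuous_on X (\<lambda>x. lower_hemisphere_point m x i)" for i
    unfolding lower_hemisphere_point_def
    by (cases "i = m") (auto intro!: continuous_intros continuous_on_coord)
qed

lemma sphere_projection:
  assumes "y \<in> coord_sphere m"
  shows "y(m := 0) \<in> coord_disc m" "(\<Sum>i<m. ((y(m := 0)) i)\<^sup>2) = 1 - (y m)\<^sup>2"
    "y m \<le> 0 \<Longrightarrow> lower_hemisphere_point m (y(m := 0)) = y"
proof -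
  have eq: "(\<Sum>i<m. ((y(m := 0)) i)\<^sup>2) = (\<Sum>i<m. (y i)\<^sup>2)" by (rule sum.cong) auto
  show *: "(\<Sum>i<m. ((y(m := 0)) i)\<^sup>2) = 1 - (y m)\<^sup>2"
    unfolding eq using assms by (simp add: coord_sphere_def flip: lessThan_Suc_atMost)
  then show "y(m := 0) \<in> coord_disc m"
    using assms unfolding coord_disc_def mem_Collect_eq * by (auto simp: coord_sphere_def)
  show "lower_hemisphere_point m (y(m := 0)) = y" if "y m \<le> 0"
    unfolding lower_hemisphere_point_def * using that by (auto simp: fun_eq_iff)
qed

lemma collapse_collapse_collar:
  assumes x: "x \<in> coord_collar m"
  shows "collapse m (collapse m (lower_hemisphere_point m x)) = north_pole m"
proof (rule collapse_upper)
  define a where "a = sqrt (1 - (\<Sum>i<m. (x i)\<^sup>2))"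
  have "0 \<le> a" "a\<^sup>2 \<le> 1/2" using x by (auto simp: a_def coord_collar_def coord_disc_def)
  moreover have "lower_hemisphere_point m x m = - a" by (simp add: lower_hemisphere_point_def a_def)
  ultimately show "0 \<le> collapse m (lower_hemisphere_point m x) m"
    by (simp add: collapse_def north_pole_def coord_axis_def power2_eq_square)
qed


section \<open>Maps from spheres\<close>

definition loose_on :: "'x::metric_space set \<Rightarrow> 'w::metric_space set \<Rightarrow> ('x \<Rightarrow> 'w) \<Rightarrow> bool" where
  "loose_on X S f \<longleftrightarrow> (\<forall>\<epsilon>>0. \<exists>s. continuous_on X s \<and> (\<forall>x\<in>X. s x \<in> S \<and> s x \<noteq> f x \<and> dist (s x) (f x) < \<epsilon>))"

text \<open>Being loose by small deformation depends only on the homotopy class of a map, since an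
  isotopy covering a homotopy carries deformations of one map to deformations of the other.\<close>

lemma loose_on_moves:
  fixes S :: "'w::metric_space set" and X :: "'x::metric_space set"
  assumes X: "compact X" and m: "moves X S g f" and g: "continuous_on X g" "g ` X \<subseteq> S" and loose: "loose_on X S g"
  shows "loose_on X S f"
  unfolding loose_on_def
proof (intro allI impI)
  fix \<epsilon> :: real assume \<epsilon>: "0 < \<epsilon>"
  obtain K \<Phi> \<Psi> where hf: "homeo_family X S K \<Phi> \<Psi>" and \<Phi>g: "\<forall>x\<in>X. \<Phi> (x, g x) = f x"
    using m by (rule movesE)
  note h = homeo_familyD[OF hf]
  have "compact ((\<lambda>x. (x, g x)) ` X)" by (intro compact_continuous_image continuous_intros g X)
  moreover have "(\<lambda>x. (x, g x)) ` X \<subseteq> X \<times> S" using g(2) by auto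
  ultimately obtain d where d: "d > 0" and near: "\<And>k z. k \<in> (\<lambda>x. (x, g x)) ` X \<Longrightarrow> z \<in> X \<times> S \<Longrightarrow> dist k z < d \<Longrightarrow> dist (\<Phi> k) (\<Phi> z) < \<epsilon>"
    using uniformly_continuous_near_compact[OF h(3) _ _ \<epsilon>] by blast
  obtain s where s: "continuous_on X s" "\<forall>x\<in>X. s x \<in> S \<and> s x \<noteq> g x \<and> dist (s x) (g x) < d"
    using loose d unfolding loose_on_def by blast
  show "\<exists>s. continuous_on X s \<and> (\<forall>x\<in>X. s x \<in> S \<and> s x \<noteq> f x \<and> dist (s x) (f x) < \<epsilon>)"
  proof (intro exI[of _ "\<lambda>x. \<Phi> (x, s x)"] conjI ballI)
    show "continuous_on X (\<lambda>x. \<Phi> (x, s x))"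
      by (rule continuous_on_compose2[OF h(3)], intro continuous_intros s) (use s in auto)
    fix x assume x: "x \<in> X"
    then have sx: "s x \<in> S" "s x \<noteq> g x" "dist (s x) (g x) < d" and gx: "g x \<in> S" using s g(2) by auto
    show "\<Phi> (x, s x) \<in> S" by (rule h(5)[OF x sx(1)])
    show "\<Phi> (x, s x) \<noteq> f x" using h(8)[OF x sx(1)] h(8)[OF x gx] \<Phi>g x sx(2) by metis
    have "dist (\<Phi> (x, g x)) (\<Phi> (x, s x)) < \<epsilon>"
      by (rule near) (use x sx in \<open>auto simp: dist_Pair_Pair dist_commute\<close>)
    then show "dist (\<Phi> (x, s x)) (f x) < \<epsilon>" using \<Phi>g x by (simp add: dist_commute)
  qed
qed

lemma homotopic_paths_cancel_right:
  assumes p: "p \<in> paths_from S a" and q: "q \<in> paths_from S a"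
    and c: "path c" "path_image c \<subseteq> S" "pathstart c = pathfinish p" "pathstart c = pathfinish q"
    and hom: "homotopic_paths S (p +++ c) (q +++ c)"
  shows "homotopic_paths S p q"
proof -
  have P: "path p" "path_image p \<subseteq> S" "path q" "path_image q \<subseteq> S"
    using p q by (auto simp: paths_from_def)
  have lp: "links S c p (p +++ c)" and lq: "links S c q (q +++ c)"
    using P c path_image_join_subset[of p c] path_image_join_subset[of q c] by (auto simp: links_def)
  note rp = linksD(4)[OF links_sym[OF p lp]] and rq = linksD(4)[OF links_sym[OF q lq]]
  have "homotopic_paths S ((p +++ c) +++ reversepath c) ((q +++ c) +++ reversepath c)"
    by (intro homotopic_paths_join hom) (use c in auto)
  then show ?thesis
    using homotopic_paths_trans[OF homotopic_paths_trans[OF homotopic_paths_sym[OF rp]] rq] by blast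
qed

text \<open>The map \<open>f\<close> is first made constant around the upper hemisphere by two collapses, which
  \<open>loose_on_moves\<close> allows. The lower hemisphere is then a disc with a collar on which the map
  is constant. Its lifts are constant on the collar as well: the path along which a point \<open>x\<close>
  of the collar is reached can be deformed into the collar, which is path-connected as
  \<open>2 \<le> m\<close>.\<close>

lemma sphere_loose:
  fixes S :: "'w::real_normed_vector set"
  assumes LE: "locally_euclidean TYPE('e::euclidean_space) S" and S: "path_connected S"
    and g: "g1 \<in> paths_from S a" "g2 \<in> paths_from S a" "g3 \<in> paths_from S a"
    and loop: "pathfinish g1 = a" "pathfinish g2 = a" "pathfinish g3 = a"
    and distinct: "\<not> homotopic_paths S g1 g2" "\<not> homotopic_paths S g1 g3" "\<not> homotopic_paths S g2 g3"
    and m: "2 \<le> m" and f: "continuous_on (coord_sphere m) f" "f ` coord_sphere m \<subseteq> S"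
  shows "loose_on (coord_sphere m) S f"
proof -
  let ?Sp = "coord_sphere m" and ?D = "coord_disc m" and ?k = "collapse m" and ?l = coord_segment
  have fS: "f y \<in> S" if "y \<in> ?Sp" for y using f(2) that by blast
  have mv: "moves ?Sp S (\<lambda>y. f (?k (r y))) (\<lambda>y. f (r y))"
    if r: "continuous_on ?Sp r" "r ` ?Sp \<subseteq> ?Sp" for r
  proof -
    \<comment> \<open>Time is reversed, as the isotopy has to start at the collapsed map.\<close>
    let ?H = "\<lambda>z. f (collapse_homotopy m (1 - snd z) (r (fst z)))"
    have "continuous_on (?Sp \<times> {0..1::real}) (\<lambda>z. (r (fst z), 1 - snd z))"
      by (intro continuous_on_Pair continuous_on_compose2[OF r(1) continuous_on_fst[OF continuous_on_id]]
          ) (auto intro!: continuous_intros)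
    moreover have "(\<lambda>z. (r (fst z), 1 - snd z)) ` (?Sp \<times> {0..1}) \<subseteq> ?Sp \<times> {0..1::real}" using r(2) by auto
    ultimately have "continuous_on (?Sp \<times> {0..1}) (\<lambda>z. collapse_homotopy m (1 - snd z) (r (fst z)))"
      using continuous_on_compose2[OF continuous_on_collapse_homotopy[of m]] by fastforce
    moreover have in_sp: "collapse_homotopy m (1 - snd z) (r (fst z)) \<in> ?Sp" if "z \<in> ?Sp \<times> {0..1}" for z
      using that r(2) by (intro collapse_homotopy_sphere) auto
    ultimately have "continuous_on (?Sp \<times> {0..1}) ?H"
      by (intro continuous_on_compose2[OF f(1)]) auto
    moreover have "?H ` (?Sp \<times> {0..1}) \<subseteq> S" using in_sp fS by blast
    ultimately have "moves ?Sp S (\<lambda>y. ?H (y, 0)) (\<lambda>y. ?H (y, 1))"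
      by (rule moves_homotopy[OF LE compact_coord_sphere])
    moreover have "r y \<in> ?Sp" if "y \<in> ?Sp" for y using r(2) that by blast
    ultimately show ?thesis
      by (simp add: moves_def collapse_homotopy_0 collapse_homotopy_1)
  qed
  have ck: "continuous_on ?Sp ?k" "?k ` ?Sp \<subseteq> ?Sp"
    using collapse_sphere by (auto intro: continuous_on_collapse)
  define G where "G y = f (?k (?k y))" for y
  have "moves ?Sp S G f"
    using moves_trans[OF mv[OF ck] mv[of "\<lambda>y. y"]] unfolding G_def by simp
  moreover have cG: "continuous_on ?Sp G"
    unfolding G_def using ck
    by (intro continuous_on_compose2[OF f(1)] continuous_on_compose2[OF ck(1)]) auto
  moreover have GS: "G ` ?Sp \<subseteq> S" using fS collapse_sphere by (auto simp: G_def)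
  moreover have "loose_on ?Sp S G"
    unfolding loose_on_def
  proof (intro allI impI)
    fix \<epsilon> :: real assume \<epsilon>: "0 < \<epsilon>"
    define F where "F x = G (lower_hemisphere_point m x)" for x
    define h where "h x = 2 * (\<Sum>i<m. (x i)\<^sup>2) - 1" for x :: "nat \<Rightarrow> real"
    define p where "p = f (north_pole m)"
    have cF: "continuous_on ?D F"
      unfolding F_def
      by (rule continuous_on_compose2[OF cG continuous_on_lower_hemisphere_point])
         (use lower_hemisphere_point_sphere in auto)
    have FS: "F ` ?D \<subseteq> S" using GS lower_hemisphere_point_sphere by (auto simp: F_def)
    have col: "{x \<in> ?D. 0 \<le> h x} = coord_collar m" by (simp add: coord_collar_def h_def)
    have Fp: "F x = p" if "x \<in> coord_collar m" for x
      using collapse_collapse_collar[OF that] by (simp add: F_def G_def p_def)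
    define x0 where "x0 = coord_axis 0 1"
    have x0sum: "(\<Sum>i<m. (x0 i)\<^sup>2) = 1"
      unfolding x0_def using m by (subst sum_coord_axis) auto
    have h0: "h x0 = 1" by (simp add: h_def x0sum)
    have x0: "x0 \<in> ?D"
      unfolding coord_disc_def mem_Collect_eq x0sum using m by (simp add: x0_def coord_axis_def)
    have x0c: "x0 \<in> coord_collar m" unfolding col[symmetric] using h0 x0 by simp
    have l: "equiconnecting ?D ?l" by (rule equiconnecting_coord_disc)
    have pS: "p \<in> S" using FS x0 Fp[OF x0c] by force
    have aS: "a \<in> S" using g(1) pathstart_in_path_image by (fastforce simp: paths_from_def)
    obtain \<delta> where \<delta>: "path \<delta>" "path_image \<delta> \<subseteq> S" "pathstart \<delta> = a" "pathfinish \<delta> = p"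
      using S aS pS unfolding path_connected_def by blast
    define c where "c x = (\<lambda>t. F (?l (x0, x, t)))" for x
    define lift where "lift \<gamma> x = cover_point S a ((\<gamma> +++ \<delta>) +++ c x)" for \<gamma> x
    have c: "path (c x)" "path_image (c x) \<subseteq> S" "pathstart (c x) = p" "pathfinish (c x) = F x" if x: "x \<in> ?D" for x
    proof -
      note lp = equiconnecting_path[OF l x0 x]
      have eq: "c x = F \<circ> (\<lambda>t. ?l (x0, x, t))" by (auto simp: c_def)
      show "path (c x)" unfolding eq
        by (rule path_continuous_image[OF lp(1)]) (use cF lp(2) continuous_on_subset in blast)
      show "path_image (c x) \<subseteq> S" unfolding eq path_image_compose using lp(2) FS by blast
      show "pathstart (c x) = p" "pathfinish (c x) = F x"
        unfolding eq pathstart_compose pathfinish_compose lp by (simp_all add: Fp[OF x0c])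
    qed
    have cc: "homotopic_paths S (c x) (linepath p p)" if x: "x \<in> coord_collar m" for x
    proof -
      have xD: "x \<in> ?D" using x col by auto
      note lp = equiconnecting_path[OF l x0 xD]
      obtain w where w: "path w" "path_image w \<subseteq> coord_collar m" "pathstart w = x0" "pathfinish w = x"
        using path_connected_coord_collar[OF m] x x0c unfolding path_connected_def by blast
      have "homotopic_paths ?D (\<lambda>t. ?l (x0, x, t)) w"
        by (rule equiconnecting_homotopic_paths[OF l]) (use lp w col in auto)
      from homotopic_paths_continuous_image[OF this cF, of S]
      have "homotopic_paths S (c x) (F \<circ> w)" using FS by (auto simp: o_def c_def)
      also have "homotopic_paths S (F \<circ> w) (linepath p p)"
      proof (rule homotopic_paths_eq)
        show "(F \<circ> w) t = linepath p p t" if "t \<in> {0..1}" for t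
          using that w(2) Fp by (simp add: path_image_def image_subset_iff linepath_def flip: scaleR_add_left)
        show "path (F \<circ> w)" "path_image (F \<circ> w) \<subseteq> S"
          using homotopic_paths_imp_path homotopic_paths_imp_subset calculation by blast+
      qed
      finally show ?thesis .
    qed
    have \<gamma>\<delta>: "\<gamma> +++ \<delta> \<in> paths_from S a" "pathfinish (\<gamma> +++ \<delta>) = F x0"
      if "\<gamma> \<in> paths_from S a" "pathfinish \<gamma> = a" for \<gamma>
      using that \<delta> path_image_join_subset[of \<gamma> \<delta>] Fp[OF x0c] by (auto simp: paths_from_def)
    have clift: "continuous_on ?D (lift \<gamma>)" and liftP: "\<And>x. x \<in> ?D \<Longrightarrow> (\<gamma> +++ \<delta>) +++ c x \<in> paths_from S a"
      if "\<gamma> \<in> paths_from S a" "pathfinish \<gamma> = a" for \<gamma>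
      unfolding lift_def c_def
      by (rule continuous_on_lift[where G = F and ?x0.0 = x0, OF l cF FS x0 \<gamma>\<delta>[OF that]]; assumption)+
    have lift_ne: "lift \<gamma> x \<noteq> lift \<gamma>' x"
      if \<gamma>: "\<gamma> \<in> paths_from S a" "pathfinish \<gamma> = a" and \<gamma>': "\<gamma>' \<in> paths_from S a" "pathfinish \<gamma>' = a"
        and x: "x \<in> ?D" and ne: "\<not> homotopic_paths S \<gamma> \<gamma>'" for \<gamma> \<gamma>' x
    proof
      assume "lift \<gamma> x = lift \<gamma>' x"
      then have "homotopic_paths S ((\<gamma> +++ \<delta>) +++ c x) ((\<gamma>' +++ \<delta>) +++ c x)"
        unfolding lift_def by (subst (asm) cover_point_eq_iff[OF LE liftP[OF \<gamma> x] liftP[OF \<gamma>' x]])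
      then have "homotopic_paths S (\<gamma> +++ \<delta>) (\<gamma>' +++ \<delta>)"
        by (rule homotopic_paths_cancel_right[OF \<gamma>\<delta>(1)[OF \<gamma>] \<gamma>\<delta>(1)[OF \<gamma>'] c(1,2)[OF x], rotated 2])
           (use c(3)[OF x] \<delta> in auto)
      then have "homotopic_paths S \<gamma> \<gamma>'"
        by (rule homotopic_paths_cancel_right[OF \<gamma>(1) \<gamma>'(1) \<delta>(1,2), rotated 2]) (use \<delta>(3) \<gamma>(2) \<gamma>'(2) in auto)
      with ne show False ..
    qed
    have lift_collar: "lift \<gamma> x = cover_point S a ((\<gamma> +++ \<delta>) +++ linepath p p)"
      if \<gamma>: "\<gamma> \<in> paths_from S a" "pathfinish \<gamma> = a" and x: "x \<in> coord_collar m" for \<gamma> x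
      unfolding lift_def
    proof (rule cover_point_homotopic[OF _ liftP[OF \<gamma>]])
      show "x \<in> ?D" using x col by auto
      then have "pathfinish (\<gamma> +++ \<delta>) = pathstart (c x)" using c(3) \<delta>(4) by simp
      moreover have "homotopic_paths S (\<gamma> +++ \<delta>) (\<gamma> +++ \<delta>)"
        using \<gamma>\<delta>(1)[OF \<gamma>] unfolding homotopic_paths_refl paths_from_def by blast
      ultimately show "homotopic_paths S ((\<gamma> +++ \<delta>) +++ c x) ((\<gamma> +++ \<delta>) +++ linepath p p)"
        using homotopic_paths_join[OF _ cc[OF x]] by blast
    qed
    have lift_in: "lift \<gamma> x \<in> universal_cover S a" and lift_proj: "cover_proj S a (lift \<gamma> x) = F x"
      if \<gamma>: "\<gamma> \<in> paths_from S a" "pathfinish \<gamma> = a" and x: "x \<in> ?D" for \<gamma> x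
      using liftP[OF \<gamma> x] c(4)[OF x] by (auto simp: lift_def universal_cover_def cover_proj_point)
    have "compact (F ` ?D)" by (intro compact_continuous_image cF compact_coord_disc)
    then obtain d where d: "0 < d" and inj: "\<forall>t\<in>universal_cover S a. \<forall>t'\<in>universal_cover S a.
        cover_proj S a t \<in> F ` ?D \<longrightarrow> cover_proj S a t = cover_proj S a t' \<longrightarrow> dist t t' < d \<longrightarrow> t = t'"
      by (rule cover_injective_near_compact[OF LE _ FS])
    \<comment> \<open>Points closer than \<open>d\<close> over the same point of \<open>F ` ?D\<close> are equal, so pushing off by less than \<open>d\<close> remains visible below.\<close>
    have minpos: "0 < min \<epsilon> d" using \<epsilon> d by simp
    have ch: "continuous_on ?D h"
      unfolding h_def by (intro continuous_intros continuous_on_coord)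
    obtain s u where s: "continuous_on ?D s"
      "\<And>x. x \<in> ?D \<Longrightarrow> s x \<in> universal_cover S a \<and> s x \<noteq> lift g1 x \<and> dist (s x) (lift g1 x) < min \<epsilon> d"
      "\<And>x. x \<in> ?D \<Longrightarrow> 1 \<le> h x \<Longrightarrow> s x = u"
    proof (rule push_off_from_three_disjoint[OF locally_euclidean_universal_cover[OF LE] connected_universal_cover[OF aS]
          compact_coord_disc l clift[OF g(1) loop(1)] clift[OF g(2) loop(2)] clift[OF g(3) loop(3)] _ _ ch _ _ x0 _ minpos])
      show "lift g1 x \<in> universal_cover S a \<and> lift g2 x \<in> universal_cover S a \<and> lift g3 x \<in> universal_cover S a"
        if "x \<in> ?D" for x using lift_in g loop that by blast
      show "lift g1 x \<noteq> lift g2 x \<and> lift g1 x \<noteq> lift g3 x \<and> lift g2 x \<noteq> lift g3 x"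
        if "x \<in> ?D" for x using lift_ne g loop that distinct by blast
      show "connected {x \<in> ?D. 0 \<le> h x}"
        unfolding col by (intro path_connected_imp_connected path_connected_coord_collar m)
      show "lift g1 x = cover_point S a ((g1 +++ \<delta>) +++ linepath p p) \<and>
            lift g2 x = cover_point S a ((g2 +++ \<delta>) +++ linepath p p) \<and>
            lift g3 x = cover_point S a ((g3 +++ \<delta>) +++ linepath p p)"
        if "x \<in> ?D" "0 \<le> h x" for x
        using lift_collar g loop that col by blast
      show "0 \<le> h x0" by (simp add: h0)
    qed (use that in blast)
    define sD where "sD x = cover_proj S a (s x)" for x
    have csD: "continuous_on ?D sD"
      unfolding continuous_on_iff
    proof (intro ballI allI impI)
      fix x and e :: real assume x: "x \<in> ?D" and "0 < e"
      then obtain d' where "d' > 0" "\<forall>x'\<in>?D. dist x' x < d' \<longrightarrow> dist (s x') (s x) < e"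
        using s(1) unfolding continuous_on_iff by blast
      then show "\<exists>d>0. \<forall>x'\<in>?D. dist x' x < d \<longrightarrow> dist (sD x') (sD x) < e"
        unfolding sD_def using s(2) x cover_proj_dist by (meson order_le_less_trans)
    qed
    have sD: "sD x \<in> S \<and> sD x \<noteq> F x \<and> dist (sD x) (F x) < \<epsilon>" if x: "x \<in> ?D" for x
    proof -
      have sx: "s x \<in> universal_cover S a" "s x \<noteq> lift g1 x" "dist (s x) (lift g1 x) < min \<epsilon> d"
        using s(2)[OF x] by auto
      note L = lift_in[OF g(1) loop(1) x] lift_proj[OF g(1) loop(1) x]
      have "dist (sD x) (F x) \<le> dist (s x) (lift g1 x)"
        using cover_proj_dist[OF sx(1) L(1)] by (simp add: sD_def L(2))
      moreover have "sD x \<noteq> F x"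
      proof
        assume "sD x = F x"
        then have "s x = lift g1 x" using inj sx(1,3) L x by (auto simp: sD_def)
        with sx(2) show False ..
      qed
      ultimately show ?thesis using cover_proj_in[OF sx(1)] sx(3) by (auto simp: sD_def)
    qed
    have sDu: "sD x = cover_proj S a u" if "x \<in> ?D" "1 \<le> h x" for x
      using s(3)[OF that] by (simp add: sD_def)
    have u: "cover_proj S a u \<in> S" "cover_proj S a u \<noteq> p" "dist (cover_proj S a u) p < \<epsilon>"
      using sD[OF x0] sDu[OF x0] h0 Fp[OF x0c] by auto
    define t where "t y = (if y m \<le> 0 then sD (y(m := 0)) else cover_proj S a u)" for y :: "nat \<Rightarrow> real"
    note pr = sphere_projection[where m = m]
    have "continuous_on ?Sp t"
    proof (rule continuous_on_paste_closed)
      show "closedin (top_of_set ?Sp) {y \<in> ?Sp. y m \<le> 0}" "closedin (top_of_set ?Sp) {y \<in> ?Sp. 0 \<le> y m}"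
        by (rule closedin_Collect_le[OF continuous_on_coord continuous_on_const],
            rule closedin_Collect_le[OF continuous_on_const continuous_on_coord])
      have "continuous_on {y \<in> ?Sp. y m \<le> 0} (\<lambda>y. y(m := 0))"
      proof (rule continuous_on_coordinatewise_then_product)
        show "continuous_on {y \<in> ?Sp. y m \<le> 0} (\<lambda>y. (y(m := 0)) i)" for i
          by (cases "i = m") (auto intro: continuous_on_coord)
      qed
      then show "continuous_on {y \<in> ?Sp. y m \<le> 0} (\<lambda>y. sD (y(m := 0)))"
        by (rule continuous_on_compose2[OF csD]) (use pr(1) in auto)
      show "continuous_on {y \<in> ?Sp. 0 \<le> y m} (\<lambda>_. cover_proj S a u)" by simp
      show "t y = cover_proj S a u" if y: "y \<in> {y \<in> ?Sp. 0 \<le> y m}" for y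
      proof (cases "y m = 0")
        case True
        then have "h (y(m := 0)) = 1" using pr(2)[of y] y by (simp add: h_def)
        then show ?thesis using sDu[OF pr(1)] y by (simp add: t_def)
      qed (use y in \<open>auto simp: t_def\<close>)
    qed (auto simp: t_def)
    moreover have "t y \<in> S \<and> t y \<noteq> G y \<and> dist (t y) (G y) < \<epsilon>" if y: "y \<in> ?Sp" for y
    proof (cases "y m \<le> 0")
      case True
      then have "G y = F (y(m := 0))" using pr(3)[OF y] by (simp add: F_def)
      then show ?thesis using sD[OF pr(1)[OF y]] True by (simp add: t_def)
    next
      case False
      then have "?k y = north_pole m" by (intro collapse_upper) simp
      moreover have "?k (north_pole m) = north_pole m"
        by (rule collapse_upper) (simp add: north_pole_def coord_axis_def)
      ultimately have "G y = p" by (simp add: G_def p_def)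
      then show ?thesis using u False by (simp add: t_def)
    qed
    ultimately show "\<exists>s. continuous_on ?Sp s \<and> (\<forall>x\<in>?Sp. s x \<in> S \<and> s x \<noteq> G x \<and> dist (s x) (G x) < \<epsilon>)"
      by blast
  qed
  ultimately show ?thesis using loose_on_moves[OF compact_coord_sphere] by blast
qed


section \<open>Manifolds given by an atlas\<close>

text \<open>The model depends on the metric with respect to which the deformation has to be small; so
  the smallness of a deformation can be measured in the norm.\<close>

lemma metric_topology_model:
  assumes ms: "Metric_space (topspace N) d" and top: "Metric_space.mtopology (topspace N) d = N"
  obtains e :: "'a \<Rightarrow> ('a discrete \<Rightarrow>\<^sub>C real)" and e'
  where "homeomorphic_maps N (top_of_set (e ` topspace N)) e e'"
    "\<forall>x\<in>topspace N. \<forall>y\<in>topspace N. dist (e x) (e y) = d x y"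
proof -
  interpret Metric_space "topspace N" d by (rule ms)
  let ?M = "topspace N"
  obtain e :: "'a \<Rightarrow> ('a discrete \<Rightarrow>\<^sub>C real)" where e: "\<forall>x\<in>?M. \<forall>y\<in>?M. dist (e x) (e y) = d x y"
    using pseudometric_embedding[of ?M d] by (metis commute mdist_zero triangle)
  let ?S = "e ` ?M"
  define e' where "e' = inv_into ?M e"
  have inj: "inj_on e ?M"
    by (rule inj_onI) (metis dist_self e zero)
  have e'e: "e' (e x) = x" if "x \<in> ?M" for x using inj that by (simp add: e'_def)
  have opN: "openin N U \<longleftrightarrow> U \<subseteq> ?M \<and> (\<forall>x\<in>U. \<exists>r>0. mball x r \<subseteq> U)" for U
    using openin_mtopology[of U] unfolding top by blast
  have "continuous_map N (top_of_set ?S) e"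
    unfolding continuous_map_def
  proof (intro conjI allI impI)
    fix U assume U: "openin (top_of_set ?S) U"
    show "openin N {x \<in> ?M. e x \<in> U}"
      unfolding opN
    proof (intro conjI ballI)
      fix x assume x: "x \<in> {x \<in> ?M. e x \<in> U}"
      then obtain r where "r > 0" "\<forall>s\<in>?S. dist s (e x) < r \<longrightarrow> s \<in> U"
        using U unfolding openin_euclidean_subtopology_iff by blast
      then show "\<exists>r>0. mball x r \<subseteq> {x \<in> ?M. e x \<in> U}"
        using e x by (intro exI[of _ r]) (auto simp: commute)
    qed auto
  qed auto
  moreover have "continuous_map (top_of_set ?S) N e'"
    unfolding continuous_map_def
  proof (intro conjI allI impI)
    fix U assume U: "openin N U"
    show "openin (top_of_set ?S) {s \<in> topspace (top_of_set ?S). e' s \<in> U}"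
      unfolding openin_euclidean_subtopology_iff
    proof (intro conjI ballI)
      fix s assume "s \<in> {s \<in> topspace (top_of_set ?S). e' s \<in> U}"
      then obtain x where x: "x \<in> ?M" "s = e x" "x \<in> U" using e'e by auto
      then obtain r where r: "r > 0" "mball x r \<subseteq> U" using U opN by blast
      have "s' \<in> {s \<in> topspace (top_of_set ?S). e' s \<in> U}" if s': "s' \<in> ?S" "dist s' s < r" for s'
      proof -
        obtain y where y: "y \<in> ?M" "s' = e y" using s'(1) by blast
        then have "y \<in> mball x r" using s'(2) x(1,2) e by (simp add: dist_commute)
        then show ?thesis using r(2) y e'e by auto
      qed
      then show "\<exists>r>0. \<forall>s'\<in>?S. dist s' s < r \<longrightarrow> s' \<in> {s \<in> topspace (top_of_set ?S). e' s \<in> U}"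
        using r(1) by blast
    qed auto
  qed (use e'e in auto)
  ultimately have "homeomorphic_maps N (top_of_set ?S) e e'"
    unfolding homeomorphic_maps_def using e'e by auto
  then show ?thesis using e by (rule that)
qed

lemma homeomorphic_space_imp_homeomorphic:
  assumes "top_of_set A homeomorphic_space top_of_set B"
  shows "A homeomorphic B"
proof -
  obtain f g where "homeomorphic_maps (top_of_set A) (top_of_set B) f g"
    using assms by (auto simp: homeomorphic_space_def)
  then have "continuous_on A f" "continuous_on B g" "f ` A \<subseteq> B" "g ` B \<subseteq> A"
    "\<And>x. x \<in> A \<Longrightarrow> g (f x) = x" "\<And>y. y \<in> B \<Longrightarrow> f (g y) = y"
    by (auto simp: homeomorphic_maps_def)
  then show ?thesis unfolding homeomorphic_def by (blast intro: homeomorphismI)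
qed

lemma locally_euclidean_smooth_atlas:
  fixes \<A> :: "('a set \<times> ('a \<Rightarrow> 'e::euclidean_space)) set" and e :: "'a \<Rightarrow> 'w::metric_space"
  assumes at: "smooth_atlas N \<A>" and e: "homeomorphic_maps N (top_of_set S) e e'"
  shows "locally_euclidean TYPE('e) S"
  unfolding locally_euclidean_def
proof
  fix s assume s: "s \<in> S"
  have hm: "homeomorphic_map N (top_of_set S) e" using e homeomorphic_map_maps by blast
  have e's: "e' s \<in> topspace N" "e (e' s) = s"
    using e s by (auto simp: homeomorphic_maps_def continuous_map_def)
  obtain U \<phi> where U: "(U, \<phi>) \<in> \<A>" "e' s \<in> U"
    using at e's(1) unfolding smooth_atlas_def by blast
  then obtain V where opU: "openin N U" and V: "open V" and \<phi>: "homeomorphic_map (subtopology N U) (top_of_set V) \<phi>"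
    using at unfolding smooth_atlas_def by blast
  have UN: "U \<subseteq> topspace N" using opU openin_subset by blast
  have tU: "topspace (subtopology N U) = U" using UN by auto
  have \<phi>V: "\<phi> ` U = V" using homeomorphic_imp_surjective_map[OF \<phi>] tU by simp
  have "\<phi> (e' s) \<in> V" using \<phi>V U(2) by blast
  then obtain r where r: "r > 0" "ball (\<phi> (e' s)) r \<subseteq> V" using V openE by blast
  let ?B = "ball (\<phi> (e' s)) r"
  define W where "W = {x \<in> U. \<phi> x \<in> ?B}"
  have WU: "W \<subseteq> U" by (auto simp: W_def)
  have "openin (top_of_set V) ?B" using r(2) V by (simp add: openin_open_eq)
  then have "openin (subtopology N U) {x \<in> topspace (subtopology N U). \<phi> x \<in> ?B}"
    using homeomorphic_imp_continuous_map[OF \<phi>] by (rule openin_continuous_map_preimage[rotated])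
  then have "openin (subtopology N U) W" by (simp only: tU W_def)
  then have opW: "openin N W" using opU by (rule openin_trans_full)
  then have opeW: "openin (top_of_set S) (e ` W)"
    using homeomorphic_map_openness_eq[OF hm] by blast
  have eWS: "e ` W \<subseteq> S" using opeW openin_imp_subset by blast
  have "homeomorphic_map (subtopology N W) (subtopology (top_of_set S) (e ` W)) e"
    by (rule homeomorphic_map_subtopologies[OF hm]) (use WU UN eWS in auto)
  then have "subtopology N W homeomorphic_space top_of_set (e ` W)"
    using eWS homeomorphic_map_imp_homeomorphic_space by (force simp: subtopology_subtopology Int_absorb1)
  moreover have "homeomorphic_map (subtopology (subtopology N U) W) (subtopology (top_of_set V) ?B) \<phi>"
    by (rule homeomorphic_map_subtopologies[OF \<phi>]) (use WU UN r(2) \<phi>V in \<open>auto simp: W_def tU\<close>)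
  then have "subtopology N W homeomorphic_space top_of_set ?B"
    using WU r(2) homeomorphic_map_imp_homeomorphic_space by (force simp: subtopology_subtopology Int_absorb1)
  ultimately have "top_of_set (e ` W) homeomorphic_space top_of_set ?B"
    using homeomorphic_space_sym homeomorphic_space_trans by blast
  then have "e ` W homeomorphic ?B"
    by (rule homeomorphic_space_imp_homeomorphic)
  also have "?B homeomorphic (UNIV :: 'e set)" by (rule homeomorphic_ball_UNIV[OF r(1)])
  finally have "e ` W homeomorphic (UNIV :: 'e set)" .
  moreover have "s \<in> e ` W" using U(2) e's(2) r(1) by (force simp: W_def)
  ultimately show "\<exists>U. openin (top_of_set S) U \<and> s \<in> U \<and> U homeomorphic (UNIV :: 'e set)"
    using opeW by blast
qed

text \<open>The classes are those of the constant loop, of a nontrivial element of the subgroup, and of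
  an element outside it.\<close>

lemma three_loops_of_proper_subgroup:
  assumes x0: "x0 \<in> topspace N"
    and H: "subgroup H (fundamental_group N x0)" "H \<noteq> {\<one>\<^bsub>fundamental_group N x0\<^esub>}" "H \<noteq> carrier (fundamental_group N x0)"
  obtains l1 l2 l3 where "l1 \<in> loops_at N x0" "l2 \<in> loops_at N x0" "l3 \<in> loops_at N x0"
    "\<not> loop_homotopic N x0 l1 l2" "\<not> loop_homotopic N x0 l1 l3" "\<not> loop_homotopic N x0 l2 l3"
proof -
  let ?G = "fundamental_group N x0"
  define C where "C p = {q. loop_homotopic N x0 p q}" for p
  have carrier: "carrier ?G = C ` loops_at N x0"
    by (auto simp: fundamental_group_def quotient_def C_def)
  have one: "\<one>\<^bsub>?G\<^esub> = C (\<lambda>_. x0)" by (simp add: fundamental_group_def C_def)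
  have C_eq: "C p = C q" if "loop_homotopic N x0 p q" for p q
    unfolding C_def using loop_homotopic_trans[OF that] loop_homotopic_trans[OF loop_homotopic_sym[OF that]] by blast
  have oneH: "\<one>\<^bsub>?G\<^esub> \<in> H" by (rule subgroup.one_closed[OF H(1)])
  have sub: "H \<subseteq> carrier ?G" by (rule subgroup.subset[OF H(1)])
  obtain A where A: "A \<in> H" "A \<noteq> \<one>\<^bsub>?G\<^esub>" using oneH H(2) by blast
  obtain B where B: "B \<in> carrier ?G" "B \<notin> H" using sub H(3) by blast
  obtain l2 where l2: "l2 \<in> loops_at N x0" "A = C l2" using A(1) sub carrier by blast
  obtain l3 where l3: "l3 \<in> loops_at N x0" "B = C l3" using B(1) carrier by blast
  have "(\<lambda>_. x0) \<in> loops_at N x0" using x0 by (simp add: loops_at_def pathin_const)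
  moreover have "C (\<lambda>_. x0) \<noteq> C l2" "C (\<lambda>_. x0) \<noteq> C l3" "C l2 \<noteq> C l3"
    using A B oneH one l2(2) l3(2) by auto
  ultimately show ?thesis using l2(1) l3(1) C_eq that by metis
qed

theorem corollary1p26:
  fixes N :: "'a topology"
    and \<A> :: "('a set \<times> ('a \<Rightarrow> 'e::euclidean_space)) set"
    and x\<^sub>0 :: 'a and m :: nat and f :: "(nat \<Rightarrow> real) \<Rightarrow> 'a"
  assumes "smooth_manifold N \<A>" and "connected_space N" and "DIM('e) \<ge> 1"
    and "x\<^sub>0 \<in> topspace N"
    and "\<exists>H. subgroup H (fundamental_group N x\<^sub>0) \<and>
           H \<noteq> {\<one>\<^bsub>fundamental_group N x\<^sub>0\<^esub>} \<and> H \<noteq> carrier (fundamental_group N x\<^sub>0)"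
    and "m \<ge> 2"
    and "continuous_map (nsphere m) N f"
  shows "self_loose_by_small_deformation (nsphere m) N f"
  unfolding self_loose_by_small_deformation_def
proof (intro allI impI, elim conjE)
  fix d and \<epsilon> :: real
  assume ms: "Metric_space (topspace N) d" "Metric_space.mtopology (topspace N) d = N" and \<epsilon>: "0 < \<epsilon>"
  obtain e :: "'a \<Rightarrow> ('a discrete \<Rightarrow>\<^sub>C real)" and e' where
    e: "homeomorphic_maps N (top_of_set (e ` topspace N)) e e'"
    and iso: "\<forall>x\<in>topspace N. \<forall>y\<in>topspace N. dist (e x) (e y) = d x y"
    by (rule metric_topology_model[OF ms])
  define S where "S = e ` topspace N"
  have ce: "continuous_map N (top_of_set S) e" and ce': "continuous_map (top_of_set S) N e'"
    and e'e: "\<And>x. x \<in> topspace N \<Longrightarrow> e' (e x) = x" and ee': "\<And>s. s \<in> S \<Longrightarrow> e (e' s) = s"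
    using e by (auto simp: homeomorphic_maps_def S_def)
  have e'N: "e' s \<in> topspace N" if "s \<in> S" for s
    using ce' that by (auto simp: continuous_map_def)
  have LE: "locally_euclidean TYPE('e) S"
    using assms(1) locally_euclidean_smooth_atlas[of N \<A>, OF _ e] by (simp add: smooth_manifold_def S_def)
  have "connectedin (top_of_set S) (e ` topspace N)"
    using connectedin_continuous_map_image[OF ce] assms(2) connectedin_topspace by blast
  then have "connected S" by (simp add: S_def connectedin_subtopology)
  then have pc: "path_connected S" by (rule locally_euclidean_path_connected[OF LE])
  obtain H where H: "subgroup H (fundamental_group N x\<^sub>0)" "H \<noteq> {\<one>\<^bsub>fundamental_group N x\<^sub>0\<^esub>}"
    "H \<noteq> carrier (fundamental_group N x\<^sub>0)" using assms(5) by blast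
  obtain l1 l2 l3 where l: "l1 \<in> loops_at N x\<^sub>0" "l2 \<in> loops_at N x\<^sub>0" "l3 \<in> loops_at N x\<^sub>0"
    and ne: "\<not> loop_homotopic N x\<^sub>0 l1 l2" "\<not> loop_homotopic N x\<^sub>0 l1 l3" "\<not> loop_homotopic N x\<^sub>0 l2 l3"
    by (rule three_loops_of_proper_subgroup[OF assms(4) H])
  have image_loop: "e \<circ> l \<in> paths_from S (e x\<^sub>0)" "pathfinish (e \<circ> l) = e x\<^sub>0" if "l \<in> loops_at N x\<^sub>0" for l
  proof -
    have "continuous_map (top_of_set {0..1}) (top_of_set S) (e \<circ> l)"
      using that ce unfolding loops_at_def pathin_def by (blast intro: continuous_map_compose)
    then show "e \<circ> l \<in> paths_from S (e x\<^sub>0)" "pathfinish (e \<circ> l) = e x\<^sub>0"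
      using that by (auto simp: paths_from_def path_def path_image_def pathstart_def pathfinish_def loops_at_def image_subset_iff)
  qed
  have reflect: "loop_homotopic N x\<^sub>0 l l'"
    if l: "l \<in> loops_at N x\<^sub>0" "l' \<in> loops_at N x\<^sub>0" and hom: "homotopic_paths S (e \<circ> l) (e \<circ> l')" for l l'
  proof -
    have lN: "l t \<in> topspace N" "l' t \<in> topspace N" if "t \<in> {0..1}" for t
      using l that by (auto simp: loops_at_def pathin_def continuous_map_def)
    have "homotopic_with (\<lambda>r. r 0 = x\<^sub>0 \<and> r 1 = x\<^sub>0) (top_of_set {0..1}) N (e' \<circ> (e \<circ> l)) (e' \<circ> (e \<circ> l'))"
      by (rule homotopic_with_compose_continuous_map_left[OF hom[unfolded homotopic_paths_def] ce'])
         (use l e'e assms(4) in \<open>auto simp: pathstart_def pathfinish_def loops_at_def\<close>)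
    then show ?thesis
      unfolding loop_homotopic_def by (rule homotopic_with_eq) (use lN e'e in auto)
  qed
  have cf: "continuous_map (nsphere m) (top_of_set S) (e \<circ> f)"
    by (rule continuous_map_compose[OF assms(7) ce])
  have "loose_on (coord_sphere m) S (e \<circ> f)"
  proof (rule sphere_loose[OF LE pc image_loop(1)[OF l(1)] image_loop(1)[OF l(2)] image_loop(1)[OF l(3)]
        image_loop(2)[OF l(1)] image_loop(2)[OF l(2)] image_loop(2)[OF l(3)] _ _ _ assms(6)])
    show "continuous_on (coord_sphere m) (e \<circ> f)" "(e \<circ> f) ` coord_sphere m \<subseteq> S"
      using cf by (auto simp: nsphere_coord_sphere image_subset_iff)
  qed (use reflect l ne in blast)+
  then obtain s where s: "continuous_on (coord_sphere m) s"
    "\<forall>x\<in>coord_sphere m. s x \<in> S \<and> s x \<noteq> (e \<circ> f) x \<and> dist (s x) ((e \<circ> f) x) < \<epsilon>"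
    using \<epsilon> unfolding loose_on_def by blast
  have top_sphere: "topspace (nsphere m) = coord_sphere m" by (simp add: nsphere_coord_sphere)
  have fN: "f x \<in> topspace N" if "x \<in> coord_sphere m" for x
    using assms(7) that by (auto simp: continuous_map_def top_sphere)
  show "\<exists>f'. continuous_map (nsphere m) N f' \<and> (\<forall>x\<in>topspace (nsphere m). d (f x) (f' x) < \<epsilon>) \<and>
      (\<forall>x\<in>topspace (nsphere m). f' x \<noteq> f x)"
  proof (intro exI[of _ "e' \<circ> s"] conjI ballI)
    have "continuous_map (nsphere m) (top_of_set S) s"
      using s by (auto simp: nsphere_coord_sphere)
    then show "continuous_map (nsphere m) N (e' \<circ> s)" using ce' by (rule continuous_map_compose)
    fix x assume "x \<in> topspace (nsphere m)"
    then have x: "x \<in> coord_sphere m" by (simp add: top_sphere)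
    then have sx: "s x \<in> S" "s x \<noteq> e (f x)" "dist (s x) (e (f x)) < \<epsilon>" using s(2) by auto
    have "d (f x) (e' (s x)) = dist (e (f x)) (e (e' (s x)))"
      using iso fN[OF x] e'N[OF sx(1)] by simp
    then show "d (f x) ((e' \<circ> s) x) < \<epsilon>" using sx ee' by (simp add: dist_commute)
    show "(e' \<circ> s) x \<noteq> f x" using ee'[OF sx(1)] sx(2) by auto
  qed
qed

end
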